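(* Let $K$ be a convex body in $\mathbb{R}^n$. Consider only real numbers $t$ (and $s$) for which $S(K,t)\ne\emptyset$ (respectively $S(K,s)\neq\emptyset$). Then: (i) $S(K,t)$ is strictly convex for all $t$. (ii) $S(A(K),t)=A(S(K,t))$ for all regular (i.e. invertible) affine transformations $A$ of $\mathbb{R}^n$ and all $t$. (iii) The boundary of $S(K,t)$ is $C^\infty$ for all $t$. (iv) The map $t\mapsto S(K,t)$ is increasing (with respect to inclusion) and concave, that is, for all $t,s$ and all $\alpha\in\mathbb{R}$ with $0\le\alpha\le 1$, $$S(K,\alpha t+(1-\alpha)s)\supset \alpha S(K,t)+(1-\alpha)S(K,s).$$ (v) For all $0<\delta<\frac12$, $K_{\delta|K|}$ is contained in $S\bigl(K,\frac{1}{4\delta(1-\delta)}\bigr)$.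
   Context: A convex body is a compact convex set with non-empty interior. $|\cdot|$ denotes $n$-dimensional volume and $v_n$ the volume of the Euclidean unit ball of $\mathbb{R}^n$. For $x\in K$, $K^x=\{y\in\mathbb{R}^n:\langle y,z-x\rangle\le 1\text{ for all }z\in K\}$ is the polar body of $K$ with respect to $x$ (of infinite volume if $x\in\partial K$). For $t\in\mathbb{R}$ the Santaló-region is $$S(K,t)=\Bigl\{x\in K:\ \frac{|K|\,|K^x|}{v_n^2}\le t\Bigr\}.$$ For $\delta>0$ (small enough) and $u\in S^{n-1}$ (the Euclidean unit sphere), let $a^u_\delta$ be defined by $|\{x\in K:\langle x,u\rangle\ge a^u_\delta\}|=\delta$; the (convex) floating body is $K_\delta=\bigcap_{u\in S^{n-1}}\{x\in K:\langle x,u\rangle\le a_\delta^u\}$. *)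

theory Defs
  imports "HOL-Analysis.Analysis"
begin

definition convex_body :: "'a::euclidean_space set \<Rightarrow> bool" where
  "convex_body K \<longleftrightarrow> compact K \<and> convex K \<and> interior K \<noteq> {}"

definition polar_at :: "'a::euclidean_space set \<Rightarrow> 'a \<Rightarrow> 'a set" where
  "polar_at K x = {y. \<forall>z\<in>K. y \<bullet> (z - x) \<le> 1}"

(* Volumes are taken in ennreal because polar_at K x has infinite volume for x on the
   boundary of K; the junk value ennreal t = 0 for t < 0 is harmless, since the volume
   product of a convex body is positive. *)
definition santalo_region :: "'a::euclidean_space set \<Rightarrow> real \<Rightarrow> 'a set" where
  "santalo_region K t =
     {x \<in> K. emeasure lborel K * emeasure lborel (polar_at K x)
              / (emeasure lborel (cball (0::'a) 1))\<^sup>2 \<le> ennreal t}"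

(* THE is well defined for 0 < \<delta> < |K|: the volume of the cut-off part is then continuous
   and strictly decreasing in a on the range where it lies strictly between 0 and |K|. *)
definition cut_level :: "'a::euclidean_space set \<Rightarrow> real \<Rightarrow> 'a \<Rightarrow> real" where
  "cut_level K \<delta> u = (THE a. measure lborel {x \<in> K. x \<bullet> u \<ge> a} = \<delta>)"

definition floating_body :: "'a::euclidean_space set \<Rightarrow> real \<Rightarrow> 'a set" where
  "floating_body K \<delta> = (\<Inter>u\<in>sphere 0 1. {x \<in> K. x \<bullet> u \<le> cut_level K \<delta> u})"

definition strictly_convex :: "'a::euclidean_space set \<Rightarrow> bool" where
  "strictly_convex S \<longleftrightarrow>
     convex S \<and> (\<forall>x\<in>S. \<forall>y\<in>S. x \<noteq> y \<longrightarrow> open_segment x y \<subseteq> interior S)"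

(* Meant for open U only: the derivatives are taken in the whole space. *)
primrec Ck_on :: "nat \<Rightarrow> 'a::euclidean_space set \<Rightarrow> ('a \<Rightarrow> real) \<Rightarrow> bool" where
  "Ck_on 0 U f \<longleftrightarrow> continuous_on U f"
| "Ck_on (Suc k) U f \<longleftrightarrow>
     (\<forall>x\<in>U. f differentiable (at x)) \<and>
     (\<forall>v. Ck_on k U (\<lambda>x. frechet_derivative f (at x) v))"

definition Cinf_on :: "'a::euclidean_space set \<Rightarrow> ('a \<Rightarrow> real) \<Rightarrow> bool" where
  "Cinf_on U f \<longleftrightarrow> (\<forall>k. Ck_on k U f)"

(* Embedded C-infinity submanifold of codimension c: locally the common zero set of c smooth
   functions whose differentials are linearly independent. *)
definition Cinf_submanifold :: "nat \<Rightarrow> 'a::euclidean_space set \<Rightarrow> bool" where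
  "Cinf_submanifold c M \<longleftrightarrow>
     (\<forall>p\<in>M. \<exists>U f. open U \<and> p \<in> U \<and> (\<forall>i<c. Cinf_on U (f i)) \<and>
        M \<inter> U = {x\<in>U. \<forall>i<c. f i x = 0} \<and>
        (\<forall>b::nat \<Rightarrow> real.
           (\<forall>v. (\<Sum>i<c. b i * frechet_derivative (f i) (at p) v) = 0) \<longrightarrow> (\<forall>i<c. b i = 0)))"

(* For a set with interior points the boundary has to be a smooth hypersurface.  Other
   codimensions are admitted only for sets without interior, so as to cover the smallest
   non-empty Santalo region, which is a single point: its boundary is a smooth submanifold
   of dimension 0, but a hypersurface only on the line. *)
definition Cinf_boundary :: "'a::euclidean_space set \<Rightarrow> bool" where
  "Cinf_boundary S \<longleftrightarrow>
     (\<exists>c. Cinf_submanifold c (frontier S) \<and> (interior S \<noteq> {} \<longrightarrow> c = 1))"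

end

theory Submission
  imports Defs "HOL-Probability.Probability"
begin

text \<open>
  With \<open>h\<close> the support function of \<open>K\<close>, integrating over the level sets of the gauge of \<open>K\<^sup>x\<close> gives
  \<open>n! |K\<^sup>x| = \<integral> exp (\<langle>x, y\<rangle> - h y) dy\<close>. This Laplace transform is finite exactly on the interior of
  \<open>K\<close>, where it is smooth and strictly convex; parts (i), (iii) and (iv) are statements about its
  sublevel sets.

  Part (v) rests on a theorem of Meyer and Pajor: a hyperplane that cuts off the proportion \<open>\<lambda>\<close> of
  the volume of \<open>K\<close> contains a point \<open>z\<close> with \<open>|K| |K\<^sup>z| \<le> v\<^sub>n\<^sup>2 / (4 \<lambda> (1 - \<lambda>))\<close>. Applied to a hyperplane
  that separates a point of the floating body from the Santalo region it yields a contradiction.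
  To prove it, let \<open>z\<close> be the point where the line through the barycentres of the two pieces meets
  the hyperplane. Reflecting a piece along this line gives a set with barycentre \<open>z\<close>, so that each
  piece is controlled by the Blaschke-Santalo inequality for centred sets. That inequality follows
  from its functional form (\<open>f x * g y \<le> exp (- \<langle>x, y\<rangle>)\<close> with \<open>f\<close> centred implies
  \<open>\<integral>f \<integral>g \<le> (2 \<pi>)\<^sup>n\<close>), which is proved by Lehec's induction on the dimension: cut the mass of \<open>g\<close> in
  half by a hyperplane orthogonal to a coordinate axis, shear so that the line through the two
  half-barycentres becomes the axis, integrate along the axis, and combine the one-dimensional
  inequality with the induction hypothesis. A translation of \<open>g\<close> costs only a factor
  \<open>exp \<langle>x, w\<rangle>\<close> on \<open>f\<close>, which cannot decrease the integral of a centred function.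
\<close>

subsection \<open>An inequality on the half-line\<close>

text \<open>That \<open>f\<close> is centred is expressed by
  \<open>\<integral>f \<le> \<integral>f * exp (x \<bullet> w)\<close> for all \<open>w\<close>, not
  by a vanishing first moment. This form needs no moment to exist, is exactly what a translation of
  \<open>g\<close> requires, and passes to mixtures of dilates; a vanishing moment implies it
  because \<open>exp l \<ge> 1 + l\<close>. The dimension is fixed by the type, so the induction
  runs over finite sets of coordinates instead. The two roles are exchanged at each step: a half of
  \<open>g\<close> becomes the centred function for the induction hypothesis, and a half of
  \<open>f\<close> its partner. The constant closes up because each half costs \<open>pi / 2\<close>
  against half of the mass of \<open>g\<close>, so that the two together give \<open>2 * pi\<close>.
  In passing from functions to sets no sharp constant has to be computed: the unit ball produces
  Gaussians, for which the functional inequality is an equality. The 4 in part (v) arises because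
  reflection doubles both the piece of \<open>K\<close> and the matching part of the polar
  body.\<close>

lemma nn_integral_layer_cake:
  fixes \<phi> :: "'a \<Rightarrow> real" and a :: real
  assumes M: "sigma_finite_measure M" and [measurable]: "\<phi> \<in> borel_measurable M" and a: "a > 0"
  shows "(\<integral>\<^sup>+s. ennreal (\<phi> s) \<partial>M) =
    ennreal a * (\<integral>\<^sup>+t. indicator {0<..} t * emeasure M {s \<in> space M. t * a < \<phi> s} \<partial>lborel)"
proof -
  interpret sigma_finite_measure M by fact
  interpret pair_sigma_finite M "lborel :: real measure" ..
  let ?I = "\<lambda>s t. indicator {0<..} t * indicator {s \<in> space M. t * a < \<phi> s} s :: ennreal"
  have "(\<integral>\<^sup>+s. ennreal (\<phi> s) \<partial>M) = (\<integral>\<^sup>+s. ennreal a * (\<integral>\<^sup>+t. ?I s t \<partial>lborel) \<partial>M)"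
  proof (rule nn_integral_cong)
    fix s assume "s \<in> space M"
    hence "(\<integral>\<^sup>+t. ?I s t \<partial>lborel) = (\<integral>\<^sup>+t. indicator {0<..<\<phi> s / a} t \<partial>lborel)"
      using a by (intro nn_integral_cong) (auto simp: indicator_def field_simps)
    also have "\<dots> = ennreal (\<phi> s / a)"
      using a by (cases "\<phi> s \<ge> 0") (auto simp: ennreal_neg field_simps)
    finally show "ennreal (\<phi> s) = ennreal a * (\<integral>\<^sup>+t. ?I s t \<partial>lborel)"
      using a by (cases "\<phi> s \<ge> 0") (auto simp: ennreal_mult'[symmetric] ennreal_neg divide_nonpos_pos)
  qed
  also have "\<dots> = ennreal a * (\<integral>\<^sup>+s. (\<integral>\<^sup>+t. ?I s t \<partial>lborel) \<partial>M)"
    by (rule nn_integral_cmult) measurable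
  also have "(\<integral>\<^sup>+s. (\<integral>\<^sup>+t. ?I s t \<partial>lborel) \<partial>M) = (\<integral>\<^sup>+t. (\<integral>\<^sup>+s. ?I s t \<partial>M) \<partial>lborel)"
    by (rule Fubini'[symmetric]) measurable
  also have "\<dots> = (\<integral>\<^sup>+t. indicator {0<..} t * emeasure M {s \<in> space M. t * a < \<phi> s} \<partial>lborel)"
    by (simp add: nn_integral_cmult)
  finally show ?thesis .
qed

text \<open>The measure \<open>ds / s\<close> is the Haar measure of the multiplicative group of positive reals;
  with respect to it the geometric mean plays the role of the midpoint.\<close>

definition log_measure :: "real measure" where
  "log_measure = density lborel (\<lambda>s. ennreal (indicator {0<..} s / s))"

lemma sets_log_measure [measurable_cong, simp]: "sets log_measure = sets borel"
  by (simp add: log_measure_def)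

lemma space_log_measure [simp]: "space log_measure = UNIV"
  by (simp add: log_measure_def)

lemma sigma_finite_log_measure: "sigma_finite_measure log_measure"
  unfolding log_measure_def by (subst sigma_finite_measure.sigma_finite_iff_density_finite[OF sigma_finite_lborel]) auto

lemma emeasure_log_measure_Icc:
  assumes "0 < a" "a \<le> b"
  shows "emeasure log_measure {a..b} = ennreal (ln b - ln a)"
proof -
  have "emeasure log_measure {a..b} = (\<integral>\<^sup>+s. ennreal (1 / s) * indicator {a..b} s \<partial>lborel)"
    unfolding log_measure_def using assms
    by (subst emeasure_density) (auto intro!: nn_integral_cong simp: indicator_def)
  also have "\<dots> = ennreal (ln b - ln a)"
  proof (rule nn_integral_FTC_Icc[OF _ _ _ assms(2)])
    fix x assume x: "x \<in> {a..b}"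
    hence "x > 0" using assms by auto
    then have "(ln has_field_derivative 1 / x) (at x)"
      using DERIV_ln_divide by blast
    then show "(ln has_real_derivative 1 / x) (at x)" .
  qed (use assms in auto)
  finally show ?thesis .
qed

lemma emeasure_log_measure_Ioo:
  assumes "0 < a" "a \<le> b"
  shows "emeasure log_measure {a<..<b} = ennreal (ln b - ln a)"
proof -
  have "AE s in lborel. s \<noteq> a \<and> s \<noteq> b" using AE_lborel_singleton[of a] AE_lborel_singleton[of b] by eventually_elim simp
  hence "AE s in log_measure. s \<noteq> a \<and> s \<noteq> b" unfolding log_measure_def by (subst AE_density) auto
  hence "emeasure log_measure {a<..<b} = emeasure log_measure {a..b}"
    by (intro emeasure_eq_AE) auto
  thus ?thesis by (simp add: emeasure_log_measure_Icc[OF assms])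
qed

lemma nn_integral_log_measure:
  assumes [measurable]: "f \<in> borel_measurable borel"
  shows "(\<integral>\<^sup>+s. f s \<partial>log_measure) = (\<integral>\<^sup>+s. f s * ennreal (indicator {0<..} s / s) \<partial>lborel)"
  unfolding log_measure_def by (subst nn_integral_density) (auto simp: mult.commute)

text \<open>The sets may be replaced by their hulls: \<open>J\<close> is an interval that contains
  geometric means of points near the two infima and near the two suprema, hence the whole open
  interval between \<open>sqrt (a0 * b0)\<close> and \<open>sqrt (a1 * b1)\<close>, whose
  logarithmic length is half the sum of those of the hulls. One point of each set, together with the
  bounds on \<open>J\<close>, confines the other set to a compact part of the half-line.\<close>

lemma log_measure_geometric_mean:
  assumes [measurable]: "A \<in> sets borel" "B \<in> sets borel"
    and A: "A \<subseteq> {0<..}" "A \<noteq> {}" and B: "B \<subseteq> {0<..}" "B \<noteq> {}"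
    and J: "J \<subseteq> {c..d}" "c > 0" "convex J" and [measurable]: "J \<in> sets borel"
    and AB: "\<And>s r. s \<in> A \<Longrightarrow> r \<in> B \<Longrightarrow> sqrt (s * r) \<in> J"
  shows "emeasure log_measure A + emeasure log_measure B \<le> 2 * emeasure log_measure J"
proof -
  obtain s0 r0 where s0: "s0 \<in> A" and r0: "r0 \<in> B" using A B by auto
  have sr0: "s0 > 0" "r0 > 0" using s0 r0 A B by auto
  have cJ: "c^2 \<le> s * r \<and> s * r \<le> d^2" if "s \<in> A" "r \<in> B" for s r
  proof -
    have *: "c \<le> sqrt (s * r)" "sqrt (s * r) \<le> d" using AB[OF that] J by auto
    have "s > 0" "r > 0" using that A B by auto
    hence "s * r \<ge> 0" by simp
    with * show ?thesis using J(2)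
      by (metis (no_types, opaque_lifting) less_imp_le order_trans power_mono real_sqrt_ge_0_iff real_sqrt_pow2)
  qed
  define a0 a1 b0 b1 where "a0 = Inf A" "a1 = Sup A" "b0 = Inf B" "b1 = Sup B"
  have Abd: "c^2 / r0 \<le> s" "s \<le> d^2 / r0" if "s \<in> A" for s
    using cJ[OF that r0] sr0 by (auto simp: field_simps)
  have Bbd: "c^2 / s0 \<le> r" "r \<le> d^2 / s0" if "r \<in> B" for r
    using cJ[OF s0 that] sr0 by (auto simp: field_simps)
  have bddA: "bdd_below A" "bdd_above A" and bddB: "bdd_below B" "bdd_above B"
    using Abd Bbd by (meson bdd_belowI bdd_aboveI)+
  have a0: "a0 > 0" 
  proof -
    have "c^2 / r0 \<le> a0" unfolding a0_a1_b0_b1_def using Abd A by (intro cInf_greatest) auto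
    moreover have "c^2 / r0 > 0" using sr0 J by auto
    ultimately show ?thesis by linarith
  qed
  have b0: "b0 > 0" 
  proof -
    have "c^2 / s0 \<le> b0" unfolding a0_a1_b0_b1_def using Bbd B by (intro cInf_greatest) auto
    moreover have "c^2 / s0 > 0" using sr0 J by auto
    ultimately show ?thesis by linarith
  qed
  have A': "A \<subseteq> {a0..a1}" and B': "B \<subseteq> {b0..b1}"
    unfolding a0_a1_b0_b1_def using bddA bddB by (auto intro: cInf_lower cSup_upper)
  have a01: "a0 \<le> a1" and b01: "b0 \<le> b1" using A' B' s0 r0 by force+
  have "emeasure log_measure A \<le> ennreal (ln a1 - ln a0)"
    using emeasure_mono[OF A'] emeasure_log_measure_Icc[OF a0 a01] by (metis sets_log_measure borel_closed closed_atLeastAtMost)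
  moreover have "emeasure log_measure B \<le> ennreal (ln b1 - ln b0)"
    using emeasure_mono[OF B'] emeasure_log_measure_Icc[OF b0 b01] by (metis sets_log_measure borel_closed closed_atLeastAtMost)
  ultimately have AB1: "emeasure log_measure A + emeasure log_measure B \<le> ennreal (ln a1 - ln a0 + (ln b1 - ln b0))"
    using a0 b0 a01 b01 by (subst ennreal_plus) (auto intro!: add_mono)
  define x y where "x = sqrt (a0 * b0)" and "y = sqrt (a1 * b1)"
  have "a0 * b0 \<le> a1 * b1" using a0 b0 a01 b01 by (intro mult_mono) auto
  hence xy: "0 < x" "x \<le> y" using a0 b0 by (auto simp: x_def y_def)
  have xsq: "x\<^sup>2 = a0 * b0" "y\<^sup>2 = a1 * b1" using a0 b0 a01 b01 by (simp_all add: x_def y_def)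
  have "{x<..<y} \<subseteq> J"
  proof
    fix t assume "t \<in> {x<..<y}"
    hence t: "t > 0" "a0 * b0 < t\<^sup>2" "t\<^sup>2 < a1 * b1"
      using xy unfolding xsq[symmetric] by (auto intro: power_strict_mono)
    have "a0 < t\<^sup>2 / b0" using t b0 by (simp add: field_simps)
    then obtain p where p: "p \<in> A" "p < t\<^sup>2 / b0" using cInf_lessD[OF A(2)] unfolding a0_a1_b0_b1_def by metis
    hence "b0 < t\<^sup>2 / p" using A(1) b0 by (auto simp: field_simps)
    then obtain r where r: "r \<in> B" "r < t\<^sup>2 / p" using cInf_lessD[OF B(2)] unfolding a0_a1_b0_b1_def by metis
    have "p * r < t\<^sup>2" using p r A(1) by (auto simp: field_simps)
    hence lo: "sqrt (p * r) < t" using t(1) by (intro real_less_lsqrt) auto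
    have "t\<^sup>2 / b1 < a1" using t b0 b01 by (simp add: field_simps)
    then obtain p' where p': "p' \<in> A" "t\<^sup>2 / b1 < p'" using less_cSupD[OF A(2)] unfolding a0_a1_b0_b1_def by metis
    hence "t\<^sup>2 / p' < b1" using A(1) b0 b01 by (auto simp: field_simps)
    then obtain r' where r': "r' \<in> B" "t\<^sup>2 / p' < r'" using less_cSupD[OF B(2)] unfolding a0_a1_b0_b1_def by metis
    have "t\<^sup>2 < p' * r'" using p' r' A(1) by (auto simp: field_simps)
    hence hi: "t < sqrt (p' * r')" by (rule real_less_rsqrt)
    have "is_interval J" using J(3) by (simp add: is_interval_convex_1)
    thus "t \<in> J" using AB[OF p(1) r(1)] AB[OF p'(1) r'(1)] lo hi unfolding is_interval_1 by (meson less_imp_le)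
  qed
  hence "ennreal (ln y - ln x) \<le> emeasure log_measure J"
    unfolding emeasure_log_measure_Ioo[OF xy, symmetric] by (intro emeasure_mono) auto
  hence "2 * ennreal (ln y - ln x) \<le> 2 * emeasure log_measure J" by (rule mult_left_mono) simp
  moreover have "2 * (ln y - ln x) = ln a1 - ln a0 + (ln b1 - ln b0)"
  proof -
    have "a1 > 0" "b1 > 0" using a0 b0 a01 b01 by auto
    hence "ln x = (ln a0 + ln b0) / 2" "ln y = (ln a1 + ln b1) / 2"
      using a0 b0 by (simp_all add: x_def y_def ln_sqrt ln_mult_pos)
    thus ?thesis by (simp add: field_simps)
  qed
  hence "2 * ennreal (ln y - ln x) = ennreal (ln a1 - ln a0 + (ln b1 - ln b0))"
    by (metis ennreal_mult' ennreal_numeral zero_le_numeral)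
  ultimately show ?thesis using AB1 by simp
qed

lemma half_gaussian_integral:
  "(\<integral>\<^sup>+c. ennreal (exp (- c\<^sup>2 / 2)) * indicator {0<..} c \<partial>lborel) = ennreal (sqrt (pi / 2))"
proof -
  have "(\<integral>\<^sup>+c. ennreal (exp (- c\<^sup>2 / 2)) * indicator {0<..} c \<partial>lborel) 
    = (\<integral>\<^sup>+c. ennreal (exp (- c\<^sup>2 / 2)) * indicator {0..} c \<partial>lborel)"
    by (intro nn_integral_cong_AE AE_I[where N="{0}"]) (auto simp: indicator_def)
  also have "\<dots> = ennreal \<bar>sqrt 2\<bar> * (\<integral>\<^sup>+c. ennreal (exp (- (0 + sqrt 2 * c)\<^sup>2 / 2)) * indicator {0..} (0 + sqrt 2 * c) \<partial>lborel)"
    by (rule nn_integral_real_affine) auto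
  also have "(\<integral>\<^sup>+c. ennreal (exp (- (0 + sqrt 2 * c)\<^sup>2 / 2)) * indicator {0..} (0 + sqrt 2 * c) \<partial>lborel) 
    = (\<integral>\<^sup>+c. ennreal (indicator {0..} c *\<^sub>R exp (- c\<^sup>2)) \<partial>lborel)"
    by (intro nn_integral_cong) (auto simp: indicator_def power_mult_distrib zero_le_mult_iff)
  also have "\<dots> = ennreal (sqrt pi / 2)"
    using gaussian_moment_0 by (intro nn_integral_eq_integral[THEN trans]) (auto simp: has_bochner_integral_iff)
  also have "ennreal \<bar>sqrt 2\<bar> * ennreal (sqrt pi / 2) = ennreal (sqrt (pi / 2))"
    by (subst ennreal_mult'[symmetric]) (auto simp: real_sqrt_divide field_simps)
  finally show ?thesis .
qed

text \<open>In logarithmic form the condition reads \<open>c^2 / 2 - ln c < - ln k\<close>, a strict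
  sublevel set of a convex function, as the derivative \<open>c - 1 / c\<close> increases.\<close>

lemma convex_superlevel:
  fixes k :: real
  assumes "k > 0"
  shows "convex {c. 0 < c \<and> k < c * exp (- c\<^sup>2 / 2)}"
proof -
  have der: "((\<lambda>c. c\<^sup>2 / 2 - ln c) has_real_derivative (c - 1 / c)) (at c)" if "c > 0" for c :: real
    using that by (auto intro!: derivative_eq_intros)
  have "convex_on {0<..} (\<lambda>c::real. c\<^sup>2 / 2 - ln c)"
  proof (rule convex_on_realI[where f' = "\<lambda>c. c - 1 / c"])
    fix x y :: real assume "x \<in> {0<..}" "y \<in> {0<..}" "x \<le> y"
    thus "x - 1 / x \<le> y - 1 / y" using divide_left_mono[of x y 1] by auto
  qed (use der in \<open>auto intro: convex_connected\<close>)
  note cv = this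
  have "convex {c \<in> {0<..}. c\<^sup>2 / 2 - ln c < - ln k}"
  proof (intro convexI)
    fix x y u v :: real
    assume *: "x \<in> {c \<in> {0<..}. c\<^sup>2 / 2 - ln c < - ln k}" "y \<in> {c \<in> {0<..}. c\<^sup>2 / 2 - ln c < - ln k}"
      "u \<ge> 0" "v \<ge> 0" "u + v = 1"
    let ?f = "\<lambda>c::real. c\<^sup>2 / 2 - ln c"
    have "?f (u *\<^sub>R x + v *\<^sub>R y) \<le> u * ?f x + v * ?f y"
      using cv * unfolding convex_on_def by blast
    also have "\<dots> < - ln k" using * by (intro convex_bound_lt) auto
    finally have "?f (u *\<^sub>R x + v *\<^sub>R y) < - ln k" .
    moreover have "u *\<^sub>R x + v *\<^sub>R y \<in> {0<..}"
      using * by (intro convexD[OF convex_real_interval(3)]) auto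
    ultimately show "u *\<^sub>R x + v *\<^sub>R y \<in> {c \<in> {0<..}. c\<^sup>2 / 2 - ln c < - ln k}" by simp
  qed
  also have "{c \<in> {0<..}. c\<^sup>2 / 2 - ln c < - ln k} = {c. 0 < c \<and> k < c * exp (- c\<^sup>2 / 2)}"
  proof -
    have "c\<^sup>2 / 2 - ln c < - ln k \<longleftrightarrow> k < c * exp (- c\<^sup>2 / 2)" if "c > 0" for c
    proof -
      have "k < c * exp (- c\<^sup>2 / 2) \<longleftrightarrow> ln k < ln (c * exp (- c\<^sup>2 / 2))" using that assms by simp
      also have "ln (c * exp (- c\<^sup>2 / 2)) = ln c - c\<^sup>2 / 2" using that by (simp add: ln_mult)
      finally show ?thesis by auto
    qed
    thus ?thesis by auto
  qed
  finally show ?thesis .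
qed

text \<open>The arithmetic-geometric mean inequality; finiteness of both factors is read off from
  the bound on their sum.\<close>

lemma ennreal_mult_le_square:
  fixes x y :: ennreal and z :: real
  assumes "x + y \<le> 2 * ennreal z" "z \<ge> 0"
  shows "x * y \<le> ennreal (z\<^sup>2)"
proof -
  have "x + y \<noteq> top" using assms by (metis ennreal_mult_eq_top_iff ennreal_neq_top ennreal_numeral neq_top_trans)
  then obtain a b where ab: "x = ennreal a" "y = ennreal b" "a \<ge> 0" "b \<ge> 0"
    by (cases x; cases y) auto
  have "ennreal (a + b) \<le> ennreal (2 * z)" using assms ab by (simp add: ennreal_mult')
  hence "a + b \<le> 2 * z" using assms(2) by (simp add: ennreal_le_iff)
  hence "4 * (a * b) \<le> (2 * z)\<^sup>2" 
    using ab power_mono[of "a + b" "2 * z" 2] sum_squares_ge_zero[of "a - b" 0] by (simp add: power2_eq_square algebra_simps)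
  hence "a * b \<le> z\<^sup>2" by simp
  thus ?thesis using ab by (simp add: ennreal_mult'[symmetric] ennreal_leI)
qed

text \<open>A one-dimensional multiplicative Prekopa-Leindler inequality. As the bound is an explicit
  function of \<open>s * r\<close> whose superlevel sets are intervals, it only needs the trivial case of the
  Brunn-Minkowski inequality.\<close>

lemma santalo_half_line_real:
  fixes f g :: "real \<Rightarrow> real" 
  assumes [measurable]: "f \<in> borel_measurable borel" "g \<in> borel_measurable borel"
    and nonneg: "\<And>s. f s \<ge> 0" "\<And>s. g s \<ge> 0" and C: "C > 0"
    and ex: "s0 > 0" "f s0 > 0" "r0 > 0" "g r0 > 0"
    and fg: "\<And>s r. s > 0 \<Longrightarrow> r > 0 \<Longrightarrow> f s * g r \<le> C * exp (- (s * r))"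
  shows "(\<integral>\<^sup>+s. ennreal (f s) * indicator {0<..} s \<partial>lborel) * (\<integral>\<^sup>+r. ennreal (g r) * indicator {0<..} r \<partial>lborel)
     \<le> ennreal (C * pi / 2)"
proof -
  \<comment> \<open>The factor \<open>s\<close> compensates the density \<open>1 / s\<close> of
    \<open>log_measure\<close>.\<close>
  define \<phi> \<psi> where "\<phi> s = (if s > 0 then s * f s else 0)" and "\<psi> s = (if s > 0 then s * g s else 0)" for s
  have [measurable]: "\<phi> \<in> borel_measurable borel" "\<psi> \<in> borel_measurable borel"
    unfolding \<phi>_def \<psi>_def by measurable
  have bnd: "x * exp (- (q * x)) \<le> 1 / q" if "q > 0" for x q :: real
  proof -
    have "q * x \<le> exp (q * x)" using exp_ge_add_one_self[of "q * x"] by linarith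
    thus ?thesis using that by (simp add: exp_minus field_simps)
  qed
  \<comment> \<open>One point \<open>r0\<close> with \<open>g r0 > 0\<close> already bounds
    \<open>\<phi>\<close>, because \<open>x * exp (- (q * x)) \<le> 1 / q\<close>; this makes the
    suprema below finite.\<close>
  have \<phi>b: "\<phi> s \<le> C / (r0 * g r0)" for s
  proof (cases "s > 0")
    case True
    have "s * f s * g r0 \<le> s * (C * exp (- (s * r0)))" using fg[OF True ex(3)] True by (simp add: mult.assoc)
    also have "\<dots> = C * (s * exp (- (r0 * s)))" by (simp add: ac_simps)
    also have "\<dots> \<le> C * (1 / r0)" using bnd[OF ex(3)] C by (intro mult_left_mono) auto
    finally show ?thesis using ex True by (simp add: \<phi>_def field_simps)
  qed (use C ex in \<open>auto simp: \<phi>_def\<close>)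
  have \<psi>b: "\<psi> s \<le> C / (s0 * f s0)" for s
  proof (cases "s > 0")
    case True
    have "s * g s * f s0 \<le> s * (C * exp (- (s * s0)))" using fg[OF ex(1) True] True by (simp add: ac_simps)
    also have "\<dots> = C * (s * exp (- (s0 * s)))" by (simp add: ac_simps)
    also have "\<dots> \<le> C * (1 / s0)" using bnd[OF ex(1)] C by (intro mult_left_mono) auto
    finally show ?thesis using ex True by (simp add: \<psi>_def field_simps)
  qed (use C ex in \<open>auto simp: \<psi>_def\<close>)
  \<comment> \<open>Levels are measured relative to these suprema. Then both superlevel sets are
    non-empty for every \<open>t < 1\<close> and empty for \<open>t \<ge> 1\<close>; the
    geometric-mean inequality requires both to be non-empty at once.\<close>
  define a b where "a = (SUP s. \<phi> s)" and "b = (SUP s. \<psi> s)"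
  have bdd: "bdd_above (range \<phi>)" "bdd_above (range \<psi>)" using \<phi>b \<psi>b by (auto intro!: bdd_aboveI)
  have le_a: "\<phi> s \<le> a" and le_b: "\<psi> s \<le> b" for s
    unfolding a_def b_def using bdd by (auto intro: cSUP_upper)
  have "\<phi> s0 > 0" "\<psi> r0 > 0" using ex by (auto simp: \<phi>_def \<psi>_def)
  hence a: "a > 0" and b: "b > 0" using le_a[of s0] le_b[of r0] by auto
  \<comment> \<open>From \<open>t * a < \<phi> s\<close> and \<open>t * b < \<psi> r\<close> follows
    \<open>t^2 < C / (a * b) * (s * r * exp (- (s * r)))\<close>. The square root of this is the
    condition that defines \<open>J t\<close> at \<open>c = sqrt (s * r)\<close>, whence
    \<open>K\<close>.\<close>
  define K where "K = sqrt (C / (a * b))"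
  have K: "K > 0" using C a b by (simp add: K_def)
  define J where "J t = {c. 0 < c \<and> t < K * (c * exp (- c\<^sup>2 / 2))}" for t
  have half: "emeasure log_measure {s. t * a < \<phi> s} + emeasure log_measure {s. t * b < \<psi> s}
      \<le> 2 * emeasure log_measure (J t)" if t: "t > 0" for t
  proof (cases "t < 1")
    case False
    hence e: "{s. t * a < \<phi> s} = {}" "{s. t * b < \<psi> s} = {}" using le_a le_b a b 
      by (auto simp: not_less intro: order_trans[of _ "1 * a"] order_trans[of _ "1 * b"] mult_right_mono)
    show ?thesis unfolding e by simp
  next
    case True
    have Jeq: "J t = {c. 0 < c \<and> t / K < c * exp (- c\<^sup>2 / 2)}" 
      using K by (auto simp: J_def field_simps)
    have tab: "t * a > 0" "t * b > 0" using t a b by auto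
    show ?thesis
    proof (rule log_measure_geometric_mean)
      show "{s. t * a < \<phi> s} \<subseteq> {0<..}" "{s. t * b < \<psi> s} \<subseteq> {0<..}" 
        using tab by (auto simp: \<phi>_def \<psi>_def split: if_splits)
      have "t * a < a" "t * b < b" using True a b by auto
      thus "{s. t * a < \<phi> s} \<noteq> {}" "{s. t * b < \<psi> s} \<noteq> {}"
        using less_cSUP_iff[OF _ bdd(1)] less_cSUP_iff[OF _ bdd(2)] unfolding a_def b_def by (auto)
      \<comment> \<open>The lower end comes from \<open>exp (- c^2 / 2) \<le> 1\<close>, the upper
        one from \<open>bnd\<close> with \<open>q = c / 2\<close>.\<close>
      show "J t \<subseteq> {t / K..2 * K / t}"
      proof
        fix c assume c: "c \<in> J t"
        have "t / K < c * exp (- c\<^sup>2 / 2)" "c > 0" using c unfolding Jeq by auto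
        moreover have "c * exp (- c\<^sup>2 / 2) \<le> c * 1" using \<open>c > 0\<close> by (intro mult_left_mono) auto
        moreover have "c * exp (- c\<^sup>2 / 2) \<le> 2 / c" 
          using bnd[of "c/2" c] \<open>c > 0\<close> by (simp add: power2_eq_square)
        ultimately have "t / K \<le> c" "t / K \<le> 2 / c" by linarith+
        thus "c \<in> {t / K..2 * K / t}" using \<open>c > 0\<close> K t by (auto simp: field_simps)
      qed
      show "0 < t / K" using K t by simp
      thus "convex (J t)" unfolding Jeq by (rule convex_superlevel)
      show "{s. t * a < \<phi> s} \<in> sets borel" "{s. t * b < \<psi> s} \<in> sets borel" by measurable
      show "J t \<in> sets borel" unfolding J_def by measurable
      fix s r assume sr: "s \<in> {s. t * a < \<phi> s}" "r \<in> {s. t * b < \<psi> s}"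
      have pos: "s > 0" "r > 0" using sr tab by (auto simp: \<phi>_def \<psi>_def split: if_splits)
      have "(t * a) * (t * b) < \<phi> s * \<psi> r" using sr tab by (intro mult_strict_mono) auto
      also have "\<dots> = s * r * (f s * g r)" using pos by (simp add: \<phi>_def \<psi>_def)
      also have "\<dots> \<le> s * r * (C * exp (- (s * r)))" using fg[OF pos] pos by (intro mult_left_mono) auto
      finally have "t\<^sup>2 < (C / (a * b)) * (s * r * exp (- (s * r)))"
        using a b by (simp add: power2_eq_square field_simps)
      also have "\<dots> = (K * (sqrt (s * r) * exp (- (sqrt (s * r))\<^sup>2 / 2)))\<^sup>2"
        using pos a b C by (simp add: K_def power_mult_distrib exp_double[symmetric])
      finally have "t < K * (sqrt (s * r) * exp (- (sqrt (s * r))\<^sup>2 / 2))"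
        by (rule power_less_imp_less_base) (use K pos in auto)
      thus "sqrt (s * r) \<in> J t" using pos by (simp add: J_def)
    qed
  qed
  define F where "F = (\<integral>\<^sup>+t. indicator {0<..} t * emeasure log_measure {s. t * a < \<phi> s} \<partial>lborel)"
  define G where "G = (\<integral>\<^sup>+t. indicator {0<..} t * emeasure log_measure {s. t * b < \<psi> s} \<partial>lborel)"
  note cake = nn_integral_layer_cake[OF sigma_finite_log_measure]
  have F: "(\<integral>\<^sup>+s. ennreal (f s) * indicator {0<..} s \<partial>lborel) = ennreal a * F"
  proof -
    have "(\<integral>\<^sup>+s. ennreal (f s) * indicator {0<..} s \<partial>lborel) = (\<integral>\<^sup>+s. ennreal (\<phi> s) \<partial>log_measure)"
      by (subst nn_integral_log_measure) (auto intro!: nn_integral_cong simp: \<phi>_def indicator_def ennreal_mult'[symmetric] nonneg)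
    also have "\<dots> = ennreal a * F" unfolding F_def by (subst cake[OF _ a]) auto
    finally show ?thesis .
  qed
  have G: "(\<integral>\<^sup>+s. ennreal (g s) * indicator {0<..} s \<partial>lborel) = ennreal b * G"
  proof -
    have "(\<integral>\<^sup>+s. ennreal (g s) * indicator {0<..} s \<partial>lborel) = (\<integral>\<^sup>+s. ennreal (\<psi> s) \<partial>log_measure)"
      by (subst nn_integral_log_measure) (auto intro!: nn_integral_cong simp: \<psi>_def indicator_def ennreal_mult'[symmetric] nonneg)
    also have "\<dots> = ennreal b * G" unfolding G_def by (subst cake[OF _ b]) auto
    finally show ?thesis .
  qed
  interpret log: sigma_finite_measure log_measure by (rule sigma_finite_log_measure)
  have [measurable]: "(\<lambda>t. emeasure log_measure {s. t * c < h s}) \<in> borel_measurable borel"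
    if [measurable]: "h \<in> borel_measurable borel" for h and c :: real
    by measurable
  define \<theta> where "\<theta> c = (if 0 < c then K * (c * exp (- c\<^sup>2 / 2)) else 0)" for c
  have [measurable]: "\<theta> \<in> borel_measurable borel" unfolding \<theta>_def by measurable
  have J\<theta>: "J t = {c. t * 1 < \<theta> c}" if "t > 0" for t using that by (auto simp: J_def \<theta>_def)
  have "F + G = (\<integral>\<^sup>+t. indicator {0<..} t * (emeasure log_measure {s. t * a < \<phi> s} + emeasure log_measure {s. t * b < \<psi> s}) \<partial>lborel)"
    unfolding F_def G_def by (subst nn_integral_add[symmetric]) (auto simp: distrib_left)
  also have "\<dots> \<le> (\<integral>\<^sup>+t. 2 * (indicator {0<..} t * emeasure log_measure {c. t * 1 < \<theta> c}) \<partial>lborel)"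
    using half J\<theta> by (intro nn_integral_mono) (auto simp: indicator_def)
  also have "\<dots> = 2 * (\<integral>\<^sup>+t. indicator {0<..} t * emeasure log_measure {c. t * 1 < \<theta> c} \<partial>lborel)"
    by (rule nn_integral_cmult) measurable
  also have "(\<integral>\<^sup>+t. indicator {0<..} t * emeasure log_measure {c. t * 1 < \<theta> c} \<partial>lborel) = (\<integral>\<^sup>+c. ennreal (\<theta> c) \<partial>log_measure)"
    by (subst cake[OF _ zero_less_one]) auto
  also have "\<dots> = (\<integral>\<^sup>+c. ennreal K * (ennreal (exp (- c\<^sup>2 / 2)) * indicator {0<..} c) \<partial>lborel)"
    using K by (subst nn_integral_log_measure) (auto intro!: nn_integral_cong simp: \<theta>_def indicator_def ennreal_mult'[symmetric])
  also have "\<dots> = ennreal (K * sqrt (pi / 2))"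
    using K by (subst nn_integral_cmult, measurable) (simp only: half_gaussian_integral, simp add: ennreal_mult' del: real_sqrt_divide)
  \<comment> \<open>The arithmetic-geometric mean inequality turns the bound on \<open>F + G\<close>
    into one on \<open>F * G\<close>; the factor \<open>a * b\<close> then cancels the denominator
    in \<open>K^2\<close>.\<close>
  finally have "F * G \<le> ennreal ((K * sqrt (pi / 2))\<^sup>2)"
    using K by (intro ennreal_mult_le_square) auto
  hence "ennreal (a * b) * (F * G) \<le> ennreal (a * b) * ennreal ((K * sqrt (pi / 2))\<^sup>2)"
    by (intro mult_left_mono) auto
  also have "\<dots> = ennreal (C * pi / 2)"
    using a b C by (subst ennreal_mult'[symmetric]) (auto simp: K_def power_mult_distrib field_simps)
  also have "ennreal (a * b) * (F * G) = (ennreal a * F) * (ennreal b * G)"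
    using a b by (simp add: ennreal_mult' ac_simps)
  finally show ?thesis unfolding F G .
qed

text \<open>A positive value of one function bounds the other pointwise by a finite number, so
  either one integral vanishes or both functions are finite on the half-line and the real-valued
  case applies.\<close>

lemma santalo_half_line:
  fixes f g :: "real \<Rightarrow> ennreal" 
  assumes [measurable]: "f \<in> borel_measurable borel" "g \<in> borel_measurable borel" and C: "C > 0"
    and fg: "\<And>s r. s > 0 \<Longrightarrow> r > 0 \<Longrightarrow> f s * g r \<le> ennreal (C * exp (- (s * r)))"
  shows "(\<integral>\<^sup>+s. f s * indicator {0<..} s \<partial>lborel) * (\<integral>\<^sup>+r. g r * indicator {0<..} r \<partial>lborel) \<le> ennreal (C * pi / 2)"
proof (cases "(\<forall>s>0. f s = 0) \<or> (\<forall>r>0. g r = 0)")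
  case True
  hence "(\<integral>\<^sup>+s. f s * indicator {0<..} s \<partial>lborel) = 0 \<or> (\<integral>\<^sup>+r. g r * indicator {0<..} r \<partial>lborel) = 0"
    by (auto simp: nn_integral_0_iff_AE indicator_def)
  thus ?thesis by auto
next
  case False
  then obtain s0 r0 where sr: "s0 > 0" "f s0 \<noteq> 0" "r0 > 0" "g r0 \<noteq> 0" by auto
  have f: "f s \<noteq> top" if "s > 0" for s
    using fg[OF that sr(3)] sr(4) by (auto simp: ennreal_top_mult top_unique)
  have g: "g s \<noteq> top" if "s > 0" for s
    using fg[OF sr(1) that] sr(2) by (auto simp: ennreal_mult_top top_unique)
  have ff: "ennreal (enn2real (f s)) = f s" and gg: "ennreal (enn2real (g s)) = g s" if "s > 0" for s
    using f[OF that] g[OF that] by (auto simp: less_top)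
  have "(\<integral>\<^sup>+s. f s * indicator {0<..} s \<partial>lborel) = (\<integral>\<^sup>+s. ennreal (enn2real (f s)) * indicator {0<..} s \<partial>lborel)"
    by (intro nn_integral_cong) (auto simp: ff indicator_def)
  moreover have "(\<integral>\<^sup>+s. g s * indicator {0<..} s \<partial>lborel) = (\<integral>\<^sup>+s. ennreal (enn2real (g s)) * indicator {0<..} s \<partial>lborel)"
    by (intro nn_integral_cong) (auto simp: gg indicator_def)
  moreover have "(\<integral>\<^sup>+s. ennreal (enn2real (f s)) * indicator {0<..} s \<partial>lborel) * 
       (\<integral>\<^sup>+s. ennreal (enn2real (g s)) * indicator {0<..} s \<partial>lborel) \<le> ennreal (C * pi / 2)"
  proof (rule santalo_half_line_real[OF _ _ _ _ C sr(1) _ sr(3)])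
    show "0 < enn2real (f s0)" "0 < enn2real (g r0)" using sr f g by (auto simp: enn2real_positive_iff less_top zero_less_iff_neq_zero)
    fix s r :: real assume s: "s > 0" and r: "r > 0"
    have "ennreal (enn2real (f s) * enn2real (g r)) \<le> ennreal (C * exp (- (s * r)))"
      using fg[OF s r] by (simp add: ennreal_mult' ff[OF s] gg[OF r])
    thus "enn2real (f s) * enn2real (g r) \<le> C * exp (- (s * r))" using C by (simp add: ennreal_le_iff)
  qed auto
  ultimately show ?thesis by simp
qed

subsection \<open>The functional Santalo inequality\<close>

text \<open>Integrates \<open>exp l \<ge> 1 + l\<close> against \<open>k\<close>. With
  \<open>l\<close> linear and of mean zero this is how a barycentre at the origin yields the tilt
  form of being centred.\<close>

lemma nn_integral_exp_tilt:
  fixes k l :: "'a \<Rightarrow> real"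
  assumes [measurable]: "k \<in> borel_measurable M" "l \<in> borel_measurable M"
    and k: "\<And>x. k x \<ge> 0" "integrable M k" and kl: "integrable M (\<lambda>x. k x * l x)" "(\<integral>x. k x * l x \<partial>M) \<ge> 0"
  shows "(\<integral>\<^sup>+x. ennreal (k x) \<partial>M) \<le> (\<integral>\<^sup>+x. ennreal (k x) * ennreal (exp (l x)) \<partial>M)"
proof (cases "(\<integral>\<^sup>+x. ennreal (k x) * ennreal (exp (l x)) \<partial>M) = \<infinity>")
  case False
  have int: "integrable M (\<lambda>x. k x * exp (l x))"
    using False k by (intro integrableI_nonneg) (auto simp: ennreal_mult less_top)
  have "(\<integral>x. k x \<partial>M) \<le> (\<integral>x. k x \<partial>M) + (\<integral>x. k x * l x \<partial>M)" using kl by simp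
  also have "\<dots> = (\<integral>x. k x * (1 + l x) \<partial>M)"
    using k kl by (subst Bochner_Integration.integral_add[symmetric]) (auto simp: distrib_left)
  also have "\<dots> \<le> (\<integral>x. k x * exp (l x) \<partial>M)"
  proof (rule integral_mono)
    show "integrable M (\<lambda>x. k x * (1 + l x))" using k kl by (simp add: distrib_left)
  qed (use int k in \<open>auto intro: mult_left_mono\<close>)
  finally show ?thesis
    using k int by (simp add: nn_integral_eq_integral ennreal_mult[symmetric] ennreal_leI)
qed simp

lemma (in finite_borel_measure) cdf_surj:
  assumes "\<And>x. measure M {x} = 0" "0 < p" "p < measure M (space M)"
  shows "\<exists>c. cdf M c = p"
proof -
  have "eventually (\<lambda>x. cdf M x < p) at_bot" using order_tendstoD(2)[OF cdf_lim_at_bot assms(2)] .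
  then obtain a where a: "cdf M a < p" by (auto simp: eventually_at_bot_linorder)
  have "eventually (\<lambda>x. p < cdf M x) at_top" using order_tendstoD(1)[OF cdf_lim_at_top assms(3)] .
  then obtain b where b: "p < cdf M b" by (auto simp: eventually_at_top_linorder)
  have "a \<le> b" using a b cdf_nondecreasing by (meson le_cases less_le_trans not_less order.strict_trans)
  with a b show ?thesis
    using IVT[of "cdf M" a p b] isCont_cdf assms(1) by auto
qed

text \<open>The mass of \<open>k\<close> is pushed forward along \<open>Y\<close>; the resulting
  distribution function is continuous because no level of \<open>Y\<close> carries mass. This gives
  both the median hyperplane in the induction and the cut levels of a convex body.\<close>

lemma quantile_exists:
  fixes k Y :: "'a \<Rightarrow> real"
  assumes [measurable]: "k \<in> borel_measurable M" "Y \<in> borel_measurable M"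
    and k: "\<And>x. 0 \<le> k x" "integrable M k" and atomless: "\<And>c. AE x in M. Y x \<noteq> c"
    and p: "0 < p" "p < (\<integral>x. k x \<partial>M)"
  shows "\<exists>c. (\<integral>x. k x * indicator {..c} (Y x) \<partial>M) = p"
proof -
  define \<nu> where "\<nu> = distr (density M (\<lambda>x. ennreal (k x))) borel Y"
  have int: "integrable M (\<lambda>x. k x * indicator A (Y x))" if [measurable]: "A \<in> sets borel" for A
    by (rule Bochner_Integration.integrable_bound[OF k(2)]) (auto simp: indicator_def k(1))
  have \<nu>: "emeasure \<nu> A = ennreal (\<integral>x. k x * indicator A (Y x) \<partial>M)" if [measurable]: "A \<in> sets borel" for A
  proof -
    have "emeasure \<nu> A = emeasure (density M (\<lambda>x. ennreal (k x))) (Y -` A \<inter> space M)"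
      unfolding \<nu>_def by (subst emeasure_distr) auto
    also have "\<dots> = (\<integral>\<^sup>+x. ennreal (k x) * indicator (Y -` A \<inter> space M) x \<partial>M)"
      by (rule emeasure_density) measurable
    also have "\<dots> = (\<integral>\<^sup>+x. ennreal (k x * indicator A (Y x)) \<partial>M)"
      by (intro nn_integral_cong) (auto simp: indicator_def)
    also have "\<dots> = ennreal (\<integral>x. k x * indicator A (Y x) \<partial>M)"
      using int[OF that] k(1) by (intro nn_integral_eq_integral) auto
    finally show ?thesis .
  qed
  have sp: "space \<nu> = UNIV" "sets \<nu> = sets borel" by (simp_all add: \<nu>_def)
  interpret \<nu>: finite_borel_measure \<nu>
  proof (intro finite_borel_measure.intro finite_measureI finite_borel_measure_axioms.intro)
    show "emeasure \<nu> (space \<nu>) \<noteq> \<infinity>" using \<nu>[of UNIV] by (simp add: sp)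
  qed (simp add: sp)
  have m\<nu>: "measure \<nu> A = (\<integral>x. k x * indicator A (Y x) \<partial>M)" if "A \<in> sets borel" for A
    using \<nu>[OF that] k(1) by (simp add: measure_def Bochner_Integration.integral_nonneg)
  have "measure \<nu> {c} = 0" for c
  proof -
    have "(\<integral>x. k x * indicator {c} (Y x) \<partial>M) = 0"
      by (rule integral_eq_zero_AE) (use atomless[of c] in \<open>eventually_elim, simp\<close>)
    thus ?thesis using m\<nu>[of "{c}"] by simp
  qed
  then obtain c where "cdf \<nu> c = p" using \<nu>.cdf_surj[of p] p m\<nu>[of UNIV] by (auto simp: sp)
  thus ?thesis using m\<nu>[of "{..c}"] by (auto simp: cdf_def)
qed

section \<open>Products of Lebesgue measures and shears of a half-space\<close>

abbreviation lborel_on :: "'i set \<Rightarrow> ('i \<Rightarrow> real) measure" where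
  "lborel_on I \<equiv> PiM I (\<lambda>_. lborel)"

interpretation lborel_prod: product_sigma_finite "\<lambda>_ :: 'i. lborel :: real measure"
  by standard

text \<open>The functional inequality over a finite set of coordinates, so that the dimension grows
  by inserting one index. The first condition says that \<open>w = 0\<close> minimises the Laplace
  transform of \<open>f\<close>; for a function with enough exponential moments this means that its
  barycentre is 0.\<close>

definition santalo_on :: "'i set \<Rightarrow> bool" where
  "santalo_on I \<longleftrightarrow> (\<forall>f \<in> borel_measurable (lborel_on I). \<forall>g \<in> borel_measurable (lborel_on I).
     (\<forall>w. (\<integral>\<^sup>+x. f x \<partial>lborel_on I) \<le> (\<integral>\<^sup>+x. f x * ennreal (exp (\<Sum>j\<in>I. x j * w j)) \<partial>lborel_on I)) \<longrightarrow>
     (\<forall>x\<in>space (lborel_on I). \<forall>y\<in>space (lborel_on I). f x * g y \<le> ennreal (exp (- (\<Sum>j\<in>I. x j * y j)))) \<longrightarrow>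
     (\<integral>\<^sup>+x. f x \<partial>lborel_on I) * (\<integral>\<^sup>+x. g x \<partial>lborel_on I) \<le> ennreal ((2 * pi) ^ card I))"

lemma sigma_finite_lborel_on: "finite I \<Longrightarrow> sigma_finite_measure (lborel_on I)"
  by (rule lborel_prod.sigma_finite)

lemma nn_integral_lborel_on_shift:
  fixes a :: "'i \<Rightarrow> real"
  assumes I: "finite I" and [measurable]: "h \<in> borel_measurable (lborel_on I)"
  shows "(\<integral>\<^sup>+x. h (\<lambda>j\<in>I. x j + a j) \<partial>lborel_on I) = (\<integral>\<^sup>+x. h x \<partial>lborel_on I)"
proof -
  let ?T = "\<lambda>x. \<lambda>j\<in>I. x j + a j"
  have [measurable]: "?T \<in> measurable (lborel_on I) (lborel_on I)" by measurable
  have "distr (lborel_on I) (lborel_on I) ?T = lborel_on I"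
  proof (rule lborel_prod.PiM_eqI[OF I])
    fix A :: "'i \<Rightarrow> real set" assume A: "\<And>i. i \<in> I \<Longrightarrow> A i \<in> sets lborel"
    have "emeasure (distr (lborel_on I) (lborel_on I) ?T) (Pi\<^sub>E I A) = 
      emeasure (lborel_on I) (?T -` Pi\<^sub>E I A \<inter> space (lborel_on I))"
      using A I by (intro emeasure_distr) (auto intro!: sets_PiM_I_finite)
    also have "?T -` Pi\<^sub>E I A \<inter> space (lborel_on I) = Pi\<^sub>E I (\<lambda>j. (+) (a j) -` A j)"
      by (auto simp: space_PiM PiE_iff add.commute extensional_def)
    also have "emeasure (lborel_on I) \<dots> = (\<Prod>j\<in>I. emeasure lborel ((+) (a j) -` A j))"
    proof (rule lborel_prod.emeasure_PiM[OF I])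
      fix i assume "i \<in> I"
      then have "A i \<in> sets borel" using A by simp
      then show "(+) (a i) -` A i \<in> sets lborel" 
        using measurable_sets[of "(+) (a i)" borel borel "A i"] by simp
    qed
    also have "\<dots> = (\<Prod>j\<in>I. emeasure lborel (A j))"
    proof (rule prod.cong[OF refl])
      fix j assume "j \<in> I"
      then have "A j \<in> sets borel" using A by simp
      then have "emeasure (distr lborel borel ((+) (a j))) (A j) = emeasure lborel ((+) (a j) -` A j)"
        by (subst emeasure_distr) auto
      then show "emeasure lborel ((+) (a j) -` A j) = emeasure lborel (A j)"
        by (simp add: lborel_distr_plus)
    qed
    finally show "emeasure (distr (lborel_on I) (lborel_on I) ?T) (Pi\<^sub>E I A) = (\<Prod>j\<in>I. emeasure lborel (A j))" .
  qed simp
  then have "(\<integral>\<^sup>+x. h x \<partial>lborel_on I) = (\<integral>\<^sup>+x. h x \<partial>distr (lborel_on I) (lborel_on I) ?T)" by simp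
  also have "\<dots> = (\<integral>\<^sup>+x. h (?T x) \<partial>lborel_on I)" by (rule nn_integral_distr) measurable
  finally show ?thesis by simp
qed

context
  fixes J :: "'i set" and i :: 'i and \<sigma> :: real
  assumes J: "finite J" "i \<notin> J" and \<sigma>: "\<sigma> * \<sigma> = 1"
begin

text \<open>Coordinates adapted to one half of the space: \<open>r\<close> runs along the oblique
  direction with components \<open>v\<close> over \<open>J\<close> and 1 at \<open>i\<close>,
  starting on the hyperplane \<open>y i = c\<close>, and the sign \<open>\<sigma>\<close> selects
  the side.\<close>

lemma measurable_shear_dual [measurable]:
  "(\<lambda>(\<eta>, r). (\<lambda>j\<in>J. \<eta> j + w j + \<sigma> * r * v j)(i := c + \<sigma> * r)) 
     \<in> measurable (lborel_on J \<Otimes>\<^sub>M lborel) (lborel_on (insert i J))"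
proof -
  have "(\<lambda>p. (\<lambda>j\<in>J. fst p j + w j + \<sigma> * snd p * v j)(i := c + \<sigma> * snd p)) 
     \<in> measurable (lborel_on J \<Otimes>\<^sub>M lborel) (lborel_on (insert i J))"
    by (rule measurable_fun_upd[where J = J]) (auto intro!: measurable_restrict)
  thus ?thesis by (simp add: case_prod_beta)
qed

lemma measurable_shear [measurable]:
  "(\<lambda>(h, s). h(i := \<sigma> * s - (\<Sum>j\<in>J. v j * h j))) \<in> measurable (lborel_on J \<Otimes>\<^sub>M lborel) (lborel_on (insert i J))"
proof -
  have "(\<lambda>p. (fst p)(i := \<sigma> * snd p - (\<Sum>j\<in>J. v j * fst p j))) 
     \<in> measurable (lborel_on J \<Otimes>\<^sub>M lborel) (lborel_on (insert i J))"
    by (rule measurable_fun_upd[where J = J]) auto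
  thus ?thesis by (simp add: case_prod_beta)
qed

lemma abs_sign: "\<bar>\<sigma>\<bar> = 1"
  using \<sigma> by (metis abs_mult abs_one abs_square_eq_1 power2_eq_square)

lemma sign_nonzero: "\<sigma> \<noteq> 0"
  using \<sigma> by auto

text \<open>For fixed \<open>r\<close> the map translates the coordinates in \<open>J\<close>, and
  in the remaining variable it is affine with slope \<open>\<sigma>\<close> of modulus 1, so no
  Jacobian appears.\<close>

lemma nn_integral_shear_dual:
  assumes [measurable]: "k \<in> borel_measurable (lborel_on (insert i J))"
  shows "(\<integral>\<^sup>+y. k y \<partial>lborel_on (insert i J)) =
    (\<integral>\<^sup>+\<eta>. (\<integral>\<^sup>+r. k ((\<lambda>j\<in>J. \<eta> j + w j + \<sigma> * r * v j)(i := c + \<sigma> * r)) \<partial>lborel) \<partial>lborel_on J)"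
proof -
  interpret J: sigma_finite_measure "lborel_on J" using J(1) by (rule sigma_finite_lborel_on)
  interpret pair_sigma_finite "lborel_on J" lborel ..
  have upd: "(\<lambda>p. (fst p)(i := snd p)) \<in> measurable (lborel_on J \<Otimes>\<^sub>M lborel) (lborel_on (insert i J))"
    by (rule measurable_fun_upd[where J = J]) auto
  note [measurable] = measurable_compose[OF upd assms]
  have m1: "(\<lambda>r. \<integral>\<^sup>+\<eta>. k (\<eta>(i := r)) \<partial>lborel_on J) \<in> borel_measurable lborel"
    by measurable
  have "(\<integral>\<^sup>+y. k y \<partial>lborel_on (insert i J)) = (\<integral>\<^sup>+r. (\<integral>\<^sup>+\<eta>. k (\<eta>(i := r)) \<partial>lborel_on J) \<partial>lborel)"
    by (rule lborel_prod.product_nn_integral_insert_rev) (use J in auto)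
  also have "\<dots> = ennreal \<bar>\<sigma>\<bar> * (\<integral>\<^sup>+r. (\<integral>\<^sup>+\<eta>. k (\<eta>(i := c + \<sigma> * r)) \<partial>lborel_on J) \<partial>lborel)"
    by (rule nn_integral_real_affine) (use m1 sign_nonzero in auto)
  also have "\<dots> = (\<integral>\<^sup>+r. (\<integral>\<^sup>+\<eta>. k (\<eta>(i := c + \<sigma> * r)) \<partial>lborel_on J) \<partial>lborel)"
    by (simp add: abs_sign)
  also have "\<dots> = (\<integral>\<^sup>+r. (\<integral>\<^sup>+\<eta>. k ((\<lambda>j\<in>J. \<eta> j + w j + \<sigma> * r * v j)(i := c + \<sigma> * r)) \<partial>lborel_on J) \<partial>lborel)"
  proof (rule nn_integral_cong)
    fix r :: real
    have "(\<lambda>\<eta>. k (\<eta>(i := c + \<sigma> * r))) \<in> borel_measurable (lborel_on J)"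
      by (rule measurable_compose[OF _ assms], rule measurable_fun_upd[where J = J]) auto
    from nn_integral_lborel_on_shift[OF J(1) this, of "\<lambda>j. w j + \<sigma> * r * v j"]
    show "(\<integral>\<^sup>+\<eta>. k (\<eta>(i := c + \<sigma> * r)) \<partial>lborel_on J) = 
      (\<integral>\<^sup>+\<eta>. k ((\<lambda>j\<in>J. \<eta> j + w j + \<sigma> * r * v j)(i := c + \<sigma> * r)) \<partial>lborel_on J)"
      by (simp add: add.assoc)
  qed
  also have "\<dots> = (\<integral>\<^sup>+\<eta>. (\<integral>\<^sup>+r. k ((\<lambda>j\<in>J. \<eta> j + w j + \<sigma> * r * v j)(i := c + \<sigma> * r)) \<partial>lborel) \<partial>lborel_on J)"
    by (rule Fubini'[of "\<lambda>\<eta> r. k ((\<lambda>j\<in>J. \<eta> j + w j + \<sigma> * r * v j)(i := c + \<sigma> * r))"]) measurable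
  finally show ?thesis .
qed

lemma nn_integral_shear:
  assumes [measurable]: "k \<in> borel_measurable (lborel_on (insert i J))"
  shows "(\<integral>\<^sup>+y. k y \<partial>lborel_on (insert i J)) =
    (\<integral>\<^sup>+h. (\<integral>\<^sup>+s. k (h(i := \<sigma> * s - (\<Sum>j\<in>J. v j * h j))) \<partial>lborel) \<partial>lborel_on J)"
proof -
  have "(\<integral>\<^sup>+y. k y \<partial>lborel_on (insert i J)) = (\<integral>\<^sup>+h. (\<integral>\<^sup>+r. k (h(i := r)) \<partial>lborel) \<partial>lborel_on J)"
    by (rule lborel_prod.product_nn_integral_insert) (use J in auto)
  also have "\<dots> = (\<integral>\<^sup>+h. (\<integral>\<^sup>+s. k (h(i := \<sigma> * s - (\<Sum>j\<in>J. v j * h j))) \<partial>lborel) \<partial>lborel_on J)"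
  proof (rule nn_integral_cong)
    fix h :: "'i \<Rightarrow> real" assume h: "h \<in> space (lborel_on J)"
    have "(\<lambda>r. k (h(i := r))) \<in> borel_measurable borel"
      by (rule measurable_compose[OF _ assms], rule measurable_fun_upd[where J = J]) (use h in auto)
    from nn_integral_real_affine[OF this sign_nonzero, of "- (\<Sum>j\<in>J. v j * h j)"]
    show "(\<integral>\<^sup>+r. k (h(i := r)) \<partial>lborel) = (\<integral>\<^sup>+s. k (h(i := \<sigma> * s - (\<Sum>j\<in>J. v j * h j))) \<partial>lborel)"
      by (simp add: abs_sign)
  qed
  finally show ?thesis .
qed

text \<open>In the two dual sheared coordinate systems the pairing becomes
  \<open>(\<Sum>j\<in>J. \<eta> j * h j) + r * s\<close>. For fixed \<open>\<eta>\<close> and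
  \<open>h\<close> the half-line inequality therefore applies to the fibres, and their integrals
  \<open>G\<close> and \<open>F\<close> satisfy the polarity condition over \<open>J\<close> up to
  the factor \<open>pi / 2\<close>. The assumption \<open>cen\<close> says exactly that
  \<open>G\<close> is centred, hence the induction hypothesis applies with \<open>G\<close> in the
  role of the centred function.\<close>

lemma santalo_half_space:
  fixes f g :: "('i \<Rightarrow> real) \<Rightarrow> ennreal"
  assumes IH: "santalo_on J"
    and [measurable]: "f \<in> borel_measurable (lborel_on (insert i J))" "g \<in> borel_measurable (lborel_on (insert i J))"
    and cen: "\<And>a. (\<integral>\<^sup>+y. g y * indicator {0<..} (\<sigma> * (y i - c)) \<partial>lborel_on (insert i J)) \<le>
      (\<integral>\<^sup>+y. g y * indicator {0<..} (\<sigma> * (y i - c)) * ennreal (exp (\<Sum>j\<in>J. (y j - w j - (y i - c) * v j) * a j)) \<partial>lborel_on (insert i J))"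
    and fg: "\<And>x y. x \<in> space (lborel_on (insert i J)) \<Longrightarrow> y \<in> space (lborel_on (insert i J)) \<Longrightarrow> 
      f x * g y \<le> ennreal (exp (- ((\<Sum>j\<in>J. x j * (y j - w j)) + x i * (y i - c))))"
  shows "(\<integral>\<^sup>+y. g y * indicator {0<..} (\<sigma> * (y i - c)) \<partial>lborel_on (insert i J)) *
     (\<integral>\<^sup>+x. f x * indicator {0<..} (\<sigma> * (x i + (\<Sum>j\<in>J. v j * x j))) \<partial>lborel_on (insert i J)) \<le> ennreal (pi / 2 * (2 * pi) ^ card J)"
proof -
  let ?M = "lborel_on (insert i J)" and ?N = "lborel_on J"
  \<comment> \<open>\<open>P\<close> parametrises a side of \<open>y i = c\<close>, and
    \<open>Q\<close> a side of the hyperplane \<open>x i + (\<Sum>j\<in>J. v j * x j) = 0\<close>: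
    with these choices \<open>P \<eta> r i - c\<close> equals \<open>\<sigma> * r\<close>, and the
    linear form equals \<open>\<sigma> * s\<close> at \<open>Q h s\<close>.\<close>
  define P where "P \<eta> r = (\<lambda>j\<in>J. \<eta> j + w j + \<sigma> * r * v j)(i := c + \<sigma> * r)" for \<eta> r
  define Q where "Q h s = h(i := \<sigma> * s - (\<Sum>j\<in>J. v j * h j))" for h s
  have [measurable]: "(\<lambda>(\<eta>, r). P \<eta> r) \<in> measurable (?N \<Otimes>\<^sub>M lborel) ?M"
    "(\<lambda>(\<eta>, r). Q \<eta> r) \<in> measurable (?N \<Otimes>\<^sub>M lborel) ?M"
    unfolding P_def Q_def by measurable
  have Pi: "P \<eta> r i = c + \<sigma> * r" "Q \<eta> r i = \<sigma> * r - (\<Sum>j\<in>J. v j * \<eta> j)" for \<eta> r by (auto simp: P_def Q_def)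
  have Pj: "P \<eta> r j = \<eta> j + w j + \<sigma> * r * v j" "Q \<eta> r j = \<eta> j" if "j \<in> J" for \<eta> r j using that J by (auto simp: P_def Q_def)
  define G where "G \<eta> = (\<integral>\<^sup>+r. g (P \<eta> r) * indicator {0<..} r \<partial>lborel)" for \<eta>
  define F where "F h = (\<integral>\<^sup>+s. f (Q h s) * indicator {0<..} s \<partial>lborel)" for h
  have [measurable]: "F \<in> borel_measurable ?N" "G \<in> borel_measurable ?N"
    unfolding F_def G_def by measurable
  have s1: "\<sigma> * (\<sigma> * r) = r" for r using \<sigma> by (simp add: mult.assoc[symmetric])
  have G: "(\<integral>\<^sup>+y. g y * indicator {0<..} (\<sigma> * (y i - c)) \<partial>?M) = (\<integral>\<^sup>+\<eta>. G \<eta> \<partial>?N)"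
    unfolding G_def P_def[abs_def]
    by (subst nn_integral_shear_dual[of _ w v c], measurable) (simp add: s1)
  have Ga: "(\<integral>\<^sup>+y. g y * indicator {0<..} (\<sigma> * (y i - c)) * ennreal (exp (\<Sum>j\<in>J. (y j - w j - (y i - c) * v j) * a j)) \<partial>?M)
    = (\<integral>\<^sup>+\<eta>. G \<eta> * ennreal (exp (\<Sum>j\<in>J. \<eta> j * a j)) \<partial>?N)" for a
  proof -
    have "(\<integral>\<^sup>+y. g y * indicator {0<..} (\<sigma> * (y i - c)) * ennreal (exp (\<Sum>j\<in>J. (y j - w j - (y i - c) * v j) * a j)) \<partial>?M)
      = (\<integral>\<^sup>+\<eta>. (\<integral>\<^sup>+r. g (P \<eta> r) * indicator {0<..} (\<sigma> * (P \<eta> r i - c)) * ennreal (exp (\<Sum>j\<in>J. (P \<eta> r j - w j - (P \<eta> r i - c) * v j) * a j)) \<partial>lborel) \<partial>?N)"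
      unfolding P_def[abs_def] by (rule nn_integral_shear_dual) measurable
    also have "\<dots> = (\<integral>\<^sup>+\<eta>. (\<integral>\<^sup>+r. g (P \<eta> r) * indicator {0<..} r * ennreal (exp (\<Sum>j\<in>J. \<eta> j * a j)) \<partial>lborel) \<partial>?N)"
      by (simp add: Pi Pj s1 cong: sum.cong)
    also have "\<dots> = (\<integral>\<^sup>+\<eta>. G \<eta> * ennreal (exp (\<Sum>j\<in>J. \<eta> j * a j)) \<partial>?N)"
      unfolding G_def by (intro nn_integral_cong nn_integral_multc) measurable
    finally show ?thesis .
  qed
  have F: "(\<integral>\<^sup>+x. f x * indicator {0<..} (\<sigma> * (x i + (\<Sum>j\<in>J. v j * x j))) \<partial>?M) = (\<integral>\<^sup>+h. F h \<partial>?N)"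
  proof -
    have "(\<integral>\<^sup>+x. f x * indicator {0<..} (\<sigma> * (x i + (\<Sum>j\<in>J. v j * x j))) \<partial>?M) =
      (\<integral>\<^sup>+h. (\<integral>\<^sup>+s. f (Q h s) * indicator {0<..} (\<sigma> * (Q h s i + (\<Sum>j\<in>J. v j * Q h s j))) \<partial>lborel) \<partial>?N)"
      unfolding Q_def[abs_def] by (rule nn_integral_shear) measurable
    thus ?thesis unfolding F_def by (simp add: Pi Pj s1 cong: sum.cong)
  qed
  have FG: "G \<eta> * F h \<le> ennreal (exp (- (\<Sum>j\<in>J. \<eta> j * h j)) * pi / 2)"
    if \<eta>: "\<eta> \<in> space ?N" and h: "h \<in> space ?N" for \<eta> h
    unfolding F_def G_def
  proof (rule santalo_half_line)
    show "(\<lambda>r. g (P \<eta> r)) \<in> borel_measurable borel" "(\<lambda>s. f (Q h s)) \<in> borel_measurable borel"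
      using \<eta> h by measurable
    fix r s :: real assume "r > 0" "s > 0"
    have sp: "P \<eta> r \<in> space ?M" "Q h s \<in> space ?M"
      using h by (auto simp: P_def Q_def space_PiM PiE_iff extensional_def)
    \<comment> \<open>The mixed terms \<open>\<sigma> * r * (\<Sum>j\<in>J. v j * h j)\<close>
      coming from the two shears cancel.\<close>
    have "(\<Sum>j\<in>J. Q h s j * (P \<eta> r j - w j)) + Q h s i * (P \<eta> r i - c) =
      (\<Sum>j\<in>J. h j * \<eta> j + \<sigma> * r * (v j * h j)) + (\<sigma> * s - (\<Sum>j\<in>J. v j * h j)) * (\<sigma> * r)"
      by (simp add: Pi Pj algebra_simps cong: sum.cong)
    also have "\<dots> = (\<Sum>j\<in>J. \<eta> j * h j) + (\<sigma> * \<sigma>) * (r * s)"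
      by (simp only: sum.distrib sum_distrib_left[symmetric]) (simp add: algebra_simps)
    finally have eq: "(\<Sum>j\<in>J. Q h s j * (P \<eta> r j - w j)) + Q h s i * (P \<eta> r i - c) = (\<Sum>j\<in>J. \<eta> j * h j) + r * s"
      by (simp add: \<sigma>)
    show "g (P \<eta> r) * f (Q h s) \<le> ennreal (exp (- (\<Sum>j\<in>J. \<eta> j * h j)) * exp (- (r * s)))"
      using fg[OF sp(2,1)] unfolding eq by (simp only: mult.commute[of "f _"] minus_add_distrib exp_add)
  qed simp
  have "(\<integral>\<^sup>+x. G x \<partial>?N) * (\<integral>\<^sup>+x. F x * ennreal (2 / pi) \<partial>?N) \<le> ennreal ((2 * pi) ^ card J)"
  \<comment> \<open>The weight \<open>2 / pi\<close> removes the constant of the half-line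
    inequality, so that the pair satisfies the polarity condition exactly.\<close>
  proof (rule IH[unfolded santalo_on_def, rule_format])
    show "(\<integral>\<^sup>+x. G x \<partial>?N) \<le> (\<integral>\<^sup>+x. G x * ennreal (exp (\<Sum>j\<in>J. x j * a j)) \<partial>?N)" for a
      using cen[of a] unfolding G Ga .
    fix x y assume "x \<in> space ?N" "y \<in> space ?N"
    from FG[OF this] have "G x * F y * ennreal (2 / pi) \<le> ennreal (exp (- (\<Sum>j\<in>J. x j * y j)) * pi / 2) * ennreal (2 / pi)"
      by (intro mult_right_mono) auto
    also have "\<dots> = ennreal (exp (- (\<Sum>j\<in>J. x j * y j)))" by (subst ennreal_mult'[symmetric]) auto
    finally show "G x * (F y * ennreal (2 / pi)) \<le> ennreal (exp (- (\<Sum>j\<in>J. x j * y j)))" by (simp add: ac_simps)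
  qed measurable
  hence "(\<integral>\<^sup>+x. G x \<partial>?N) * (\<integral>\<^sup>+x. F x \<partial>?N) * ennreal (2 / pi) * ennreal (pi / 2) \<le> ennreal ((2 * pi) ^ card J) * ennreal (pi / 2)"
    by (intro mult_right_mono) (auto simp: nn_integral_multc ac_simps)
  also have "(\<integral>\<^sup>+x. G x \<partial>?N) * (\<integral>\<^sup>+x. F x \<partial>?N) * ennreal (2 / pi) * ennreal (pi / 2) = 
    (\<integral>\<^sup>+x. G x \<partial>?N) * (\<integral>\<^sup>+x. F x \<partial>?N)" by (simp add: mult.assoc ennreal_mult'[symmetric])
  also have "ennreal ((2 * pi) ^ card J) * ennreal (pi / 2) = ennreal (pi / 2 * (2 * pi) ^ card J)"
    by (simp add: ennreal_mult'[symmetric] ac_simps)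
  finally show ?thesis unfolding F G .
qed

end

section \<open>The induction on the number of coordinates\<close>

lemma AE_lborel_on_hyperplane:
  fixes v :: "'i \<Rightarrow> real"
  assumes J: "finite J" "i \<notin> J"
  shows "AE x in lborel_on (insert i J). x i + (\<Sum>j\<in>J. v j * x j) \<noteq> c"
proof -
  let ?N = "{x \<in> space (lborel_on (insert i J)). x i + (\<Sum>j\<in>J. v j * x j) = c}"
  have [measurable]: "?N \<in> sets (lborel_on (insert i J))" by measurable
  have "emeasure (lborel_on (insert i J)) ?N = (\<integral>\<^sup>+x. indicator ?N x \<partial>lborel_on (insert i J))"
    by simp
  also have "\<dots> = (\<integral>\<^sup>+h. (\<integral>\<^sup>+s. indicator ?N (h(i := s)) \<partial>lborel) \<partial>lborel_on J)"
    by (rule lborel_prod.product_nn_integral_insert) (use J in auto)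
  also have "\<dots> = (\<integral>\<^sup>+h. 0 \<partial>lborel_on J)"
  proof (rule nn_integral_cong)
    fix h :: "'i \<Rightarrow> real" assume h: "h \<in> space (lborel_on J)"
    have le: "indicator ?N (h(i := s)) \<le> (indicator {c - (\<Sum>j\<in>J. v j * h j)} s :: ennreal)" for s
    proof -
      have "(\<Sum>j\<in>J. v j * (h(i := s)) j) = (\<Sum>j\<in>J. v j * h j)"
        using J by (intro sum.cong) auto
      thus ?thesis by (auto simp: indicator_def)
    qed
    have "(\<integral>\<^sup>+s. indicator ?N (h(i := s)) \<partial>lborel) \<le> (\<integral>\<^sup>+s. indicator {c - (\<Sum>j\<in>J. v j * h j)} s \<partial>lborel)"
      by (rule nn_integral_mono) (rule le)
    thus "(\<integral>\<^sup>+s. indicator ?N (h(i := s)) \<partial>lborel) = (0::ennreal)" by simp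
  qed
  finally have "emeasure (lborel_on (insert i J)) ?N = 0" by simp
  thus ?thesis by (intro AE_I[of _ _ ?N]) auto
qed

text \<open>With \<open>g\<close> bounded and of bounded support all barycentres exist. The halves
  of \<open>g\<close> are centred by the choice of the shear; \<open>f\<close> is divided by the
  hyperplane dual to the line of barycentres, with no control over how its mass is
  distributed.\<close>

lemma santalo_insert_bounded:
  fixes f :: "('i \<Rightarrow> real) \<Rightarrow> ennreal" and g :: "('i \<Rightarrow> real) \<Rightarrow> real"
  assumes J: "finite J" "i \<notin> J"
    and IH: "santalo_on J"
    and mf [measurable]: "f \<in> borel_measurable (lborel_on (insert i J))" and mg [measurable]: "g \<in> borel_measurable (lborel_on (insert i J))"
    and cen: "\<And>w. (\<integral>\<^sup>+x. f x \<partial>lborel_on (insert i J)) \<le> (\<integral>\<^sup>+x. f x * ennreal (exp (\<Sum>j\<in>insert i J. x j * w j)) \<partial>lborel_on (insert i J))"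
    and fg: "\<And>x y. x \<in> space (lborel_on (insert i J)) \<Longrightarrow> y \<in> space (lborel_on (insert i J)) \<Longrightarrow> 
      f x * ennreal (g y) \<le> ennreal (exp (- (\<Sum>j\<in>insert i J. x j * y j)))"
    and g: "\<And>y. 0 \<le> g y" "\<And>y. g y \<le> B" "\<And>y j. j \<in> insert i J \<Longrightarrow> \<bar>y j\<bar> > R \<Longrightarrow> g y = 0"
  shows "(\<integral>\<^sup>+x. f x \<partial>lborel_on (insert i J)) * (\<integral>\<^sup>+x. ennreal (g x) \<partial>lborel_on (insert i J)) \<le> ennreal ((2 * pi) ^ card (insert i J))"
proof -
  let ?M = "lborel_on (insert i J)"
  have B: "B \<ge> 0" using g(1,2) order_trans by blast
  define box where "box = Pi\<^sub>E (insert i J) (\<lambda>_. {-R..R})"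
  have [measurable]: "box \<in> sets ?M" unfolding box_def using J by (intro sets_PiM_I_finite) auto
  have box: "emeasure ?M box < \<infinity>"
  proof -
    have "emeasure ?M box = (\<Prod>j\<in>insert i J. emeasure lborel {-R..R})"
      unfolding box_def using J by (intro lborel_prod.emeasure_PiM) auto
    also have "\<dots> = emeasure lborel {-R..R} ^ card (insert i J)" by (rule prod_constant)
    also have "\<dots> < \<infinity>" by (simp add: power_less_top_ennreal emeasure_lborel_Icc_eq)
    finally show ?thesis .
  qed
  have supp: "y \<in> box" if "y \<in> space ?M" "g y \<noteq> 0" for y
    using that g(3)[of _ y] by (fastforce simp: box_def space_PiM PiE_iff not_less abs_le_iff)
  have int: "integrable ?M (\<lambda>y. q y * g y)" if [measurable]: "q \<in> borel_measurable ?M" and q: "\<And>y. y \<in> box \<Longrightarrow> \<bar>q y\<bar> \<le> C" for q C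
  proof (rule integrableI_bounded_set[where A = box and B = "\<bar>C\<bar> * B"])
    show "AE y in ?M. y \<in> box \<longrightarrow> norm (q y * g y) \<le> \<bar>C\<bar> * B"
    proof (rule AE_I2, rule impI)
      fix y assume "y \<in> box"
      then show "norm (q y * g y) \<le> \<bar>C\<bar> * B"
        using q[of y] g(1,2)[of y] unfolding real_norm_def abs_mult by (intro mult_mono) auto
    qed
    show "AE y in ?M. y \<notin> box \<longrightarrow> q y * g y = 0" using supp by (intro AE_I2) auto
  qed (use box in auto)
  have ybox: "\<bar>y j\<bar> \<le> R" if "y \<in> box" "j \<in> insert i J" for y j
    using that by (auto simp: box_def PiE_iff abs_le_iff)
  have intg: "integrable ?M g" using int[of "\<lambda>_. 1" 1] by simp
  define m where "m = (\<integral>y. g y \<partial>?M)"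
  have m0: "m \<ge> 0" unfolding m_def using g by (intro Bochner_Integration.integral_nonneg) auto
  have m: "(\<integral>\<^sup>+y. ennreal (g y) \<partial>?M) = ennreal m"
    unfolding m_def using intg g by (intro nn_integral_eq_integral) auto
  show ?thesis
  proof (cases "m = 0")
    case True
    then show ?thesis unfolding m by simp
  next
    case False
    with m0 have mpos: "m > 0" by simp
    have ni: "AE y in ?M. y i \<noteq> c" for c
      using AE_lborel_on_hyperplane[OF J, of "\<lambda>_. 0" c] by simp
    obtain c where c: "(\<integral>y. g y * indicator {..c} (y i) \<partial>?M) = m / 2"
      using quantile_exists[of g ?M "\<lambda>y. y i" "m / 2"] g(1) intg ni mpos by (auto simp: m_def)
    define P where "P s y = (indicator {0<..} (s * (y i - c)) :: real)" for s :: real and y :: "'i \<Rightarrow> real"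
    have [measurable]: "P s \<in> borel_measurable ?M" for s unfolding P_def by measurable
    have P01: "0 \<le> P s y" "P s y \<le> 1" for s y by (auto simp: P_def indicator_def)
    have intP: "integrable ?M (\<lambda>y. P s y * y j * g y)" if "j \<in> insert i J" for s j
      using that ybox[OF _ that] P01 by (intro int[where C = R]) (auto simp: abs_mult intro!: mult_left_le_one_le order_trans[OF mult_left_le_one_le])
    have intP1: "integrable ?M (\<lambda>y. P s y * g y)" for s
      using P01 by (intro int[where C = 1]) auto
    have halfneg: "(\<integral>y. P (-1) y * g y \<partial>?M) = m / 2"
      unfolding c[symmetric] using ni[of c] by (intro integral_cong_AE) (auto simp: P_def indicator_def)
    have "(\<integral>y. P 1 y * g y \<partial>?M) + (\<integral>y. P (-1) y * g y \<partial>?M) = (\<integral>y. P 1 y * g y + P (-1) y * g y \<partial>?M)"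
      by (rule Bochner_Integration.integral_add[OF intP1 intP1, symmetric])
    also have "\<dots> = m"
      unfolding m_def using ni[of c] by (intro integral_cong_AE) (auto simp: P_def indicator_def)
    finally have "(\<integral>y. P 1 y * g y \<partial>?M) + (\<integral>y. P (-1) y * g y \<partial>?M) = m" .
    with halfneg have halfpos: "(\<integral>y. P 1 y * g y \<partial>?M) = m / 2" by simp
    have half: "(\<integral>y. P s y * g y \<partial>?M) = m / 2" if "s = 1 \<or> s = -1" for s using that halfneg halfpos by auto
    define b where "b s j = (\<integral>y. P s y * y j * g y \<partial>?M) / (m / 2)" for s j
    have b_eq: "(\<integral>y. P s y * y j * g y \<partial>?M) = b s j * (m / 2)" for s j using mpos by (simp add: b_def)
    \<comment> \<open>The inequality is strict because each open half-space carries the mass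
      \<open>m / 2 > 0\<close>.\<close>
    have bpos: "s * (b s i - c) > 0" if s: "s = 1 \<or> s = -1" for s
    proof -
      have e: "P s y * (s * (y i - c)) * g y = s * (P s y * y i * g y) - s * c * (P s y * g y)" for y by (simp add: algebra_simps)
      have i1: "integrable ?M (\<lambda>y. P s y * (s * (y i - c)) * g y)" unfolding e using intP[of i s] intP1[of s] by simp
      have nn: "P s y * (s * (y i - c)) * g y \<ge> 0" for y using g(1)[of y] by (auto simp: P_def indicator_def)
      have "(\<integral>y. P s y * (s * (y i - c)) * g y \<partial>?M) \<noteq> 0"
      proof
        assume "(\<integral>y. P s y * (s * (y i - c)) * g y \<partial>?M) = 0"
        hence "AE y in ?M. P s y * (s * (y i - c)) * g y = 0"
          using integral_nonneg_eq_0_iff_AE[OF i1] nn by simp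
        hence "AE y in ?M. P s y * g y = 0" by eventually_elim (auto simp: P_def indicator_def split: if_splits)
        hence "(\<integral>y. P s y * g y \<partial>?M) = 0" by (rule integral_eq_zero_AE)
        with half[OF s] mpos show False by simp
      qed
      moreover have "(\<integral>y. P s y * (s * (y i - c)) * g y \<partial>?M) \<ge> 0" using nn by (intro Bochner_Integration.integral_nonneg) auto
      moreover have "(\<integral>y. P s y * (s * (y i - c)) * g y \<partial>?M) = s * (b s i - c) * (m / 2)"
      proof -
        have "(\<integral>y. P s y * (s * (y i - c)) * g y \<partial>?M) = s * (\<integral>y. P s y * y i * g y \<partial>?M) - s * c * (\<integral>y. P s y * g y \<partial>?M)"
          unfolding e using intP[OF insertI1, of s] intP1[of s] by simp
        also have "\<dots> = s * (b s i - c) * (m / 2)" unfolding b_eq half[OF s] by (simp add: algebra_simps)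
        finally show ?thesis .
      qed
      ultimately have "s * (b s i - c) * (m / 2) > 0" by linarith
      thus ?thesis using mpos by (simp add: zero_less_mult_iff)
    qed
    define bp bm where "bp = b 1 i - c" and "bm = c - b (-1) i"
    have bb: "bp > 0" "bm > 0" using bpos[of 1] bpos[of "-1"] by (auto simp: bp_def bm_def)
    \<comment> \<open>The line through the two half-barycentres meets the hyperplane \<open>y i = c\<close> in \<open>w\<close> and has
       direction \<open>v\<close> with \<open>i\<close>-th component \<open>1\<close>.\<close>
    define v w where "v j = (b 1 j - b (-1) j) / (bp + bm)" and "w j = (bm * b 1 j + bp * b (-1) j) / (bp + bm)" for j
    have bvw: "b s j - w j - (b s i - c) * v j = 0" if s: "s = 1 \<or> s = -1" for s j
    proof -
      have p: "bp + bm \<noteq> 0" using bb by simp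
      have e: "(bp + bm) * (b 1 j - w j - bp * v j) = (bp + bm) * b 1 j - (bp + bm) * w j - bp * ((bp + bm) * v j)"
        "(bp + bm) * (b (-1) j - w j + bm * v j) = (bp + bm) * b (-1) j - (bp + bm) * w j + bm * ((bp + bm) * v j)"
        by (simp_all add: algebra_simps)
      have vw: "(bp + bm) * w j = bm * b 1 j + bp * b (-1) j" "(bp + bm) * v j = b 1 j - b (-1) j"
        using p by (simp_all add: v_def w_def)
      have "(bp + bm) * (b 1 j - w j - bp * v j) = 0" "(bp + bm) * (b (-1) j - w j + bm * v j) = 0"
        unfolding e vw by (simp_all add: algebra_simps)
      hence "b 1 j - w j - bp * v j = 0" "b (-1) j - w j + bm * v j = 0" using p by auto
      with s show ?thesis by (auto simp: bp_def bm_def algebra_simps)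
    qed
    \<comment> \<open>The choice of \<open>w\<close> and \<open>v\<close> puts the barycentre of
      either half at 0 in the sheared coordinates over \<open>J\<close>; these moments supply the
      tilt hypothesis of \<open>santalo_half_space\<close> for both signs.\<close>
    have moment: "(\<integral>y. P s y * (y j - w j - (y i - c) * v j) * g y \<partial>?M) = 0"
      and moment_int: "integrable ?M (\<lambda>y. P s y * (y j - w j - (y i - c) * v j) * g y)"
      if s: "s = 1 \<or> s = -1" and j: "j \<in> J" for s j
    proof -
      have e: "P s y * (y j - w j - (y i - c) * v j) * g y = P s y * y j * g y - (w j - c * v j) * (P s y * g y) - v j * (P s y * y i * g y)" for y
        by (simp add: algebra_simps)
      show "integrable ?M (\<lambda>y. P s y * (y j - w j - (y i - c) * v j) * g y)"
        unfolding e using intP[of i s] intP[of j s] intP1[of s] j by simp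
      have "(\<integral>y. P s y * (y j - w j - (y i - c) * v j) * g y \<partial>?M) = b s j * (m/2) - (w j - c * v j) * (m/2) - v j * (b s i * (m/2))"
        unfolding e using intP[of i s] intP[of j s] intP1[of s] j by (simp add: b_eq half[OF s])
      also have "\<dots> = (b s j - w j - (b s i - c) * v j) * (m / 2)" by (simp add: algebra_simps)
      finally show "(\<integral>y. P s y * (y j - w j - (y i - c) * v j) * g y \<partial>?M) = 0" using bvw[OF s] by simp
    qed
    \<comment> \<open>Moving the origin of the \<open>y\<close>-space to \<open>W\<close> multiplies
      the bound on \<open>f x * g y\<close> by an exponential in \<open>x\<close>, which is absorbed
      into \<open>f\<close>. As \<open>f\<close> is centred, the integral of \<open>f'\<close> is at
      least that of \<open>f\<close>.\<close>
    define W where "W = w(i := c)"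
    define f' where "f' x = f x * ennreal (exp (\<Sum>j\<in>insert i J. x j * W j))" for x
    have [measurable]: "f' \<in> borel_measurable ?M" unfolding f'_def by measurable
    have WS: "(\<Sum>j\<in>insert i J. x j * y j) - (\<Sum>j\<in>insert i J. x j * W j) = (\<Sum>j\<in>J. x j * (y j - w j)) + x i * (y i - c)" for x y :: "'i \<Rightarrow> real"
    proof -
      have "(\<Sum>j\<in>insert i J. x j * y j) - (\<Sum>j\<in>insert i J. x j * W j) = (\<Sum>j\<in>insert i J. x j * (y j - W j))"
        by (simp add: sum_subtractf right_diff_distrib)
      also have "\<dots> = x i * (y i - c) + (\<Sum>j\<in>J. x j * (y j - W j))" using J by (simp add: W_def)
      also have "(\<Sum>j\<in>J. x j * (y j - W j)) = (\<Sum>j\<in>J. x j * (y j - w j))" using J by (intro sum.cong) (auto simp: W_def)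
      finally show ?thesis by simp
    qed
    have half_ineq: "ennreal (m / 2) * (\<integral>\<^sup>+x. f' x * indicator {0<..} (s * (x i + (\<Sum>j\<in>J. v j * x j))) \<partial>?M) \<le> ennreal (pi / 2 * (2 * pi) ^ card J)"
      if s: "s = 1 \<or> s = -1" for s
    proof -
      have Pe: "ennreal (g y) * indicator {0<..} (s * (y i - c)) = ennreal (P s y * g y)" for y by (auto simp: P_def indicator_def)
      have "(\<integral>\<^sup>+y. ennreal (g y) * indicator {0<..} (s * (y i - c)) \<partial>?M) *
       (\<integral>\<^sup>+x. f' x * indicator {0<..} (s * (x i + (\<Sum>j\<in>J. v j * x j))) \<partial>?M) \<le> ennreal (pi / 2 * (2 * pi) ^ card J)"
      proof (rule santalo_half_space[OF J, where w = w])
        show "s * s = 1" using s by auto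
        show "f' \<in> borel_measurable ?M" "(\<lambda>y. ennreal (g y)) \<in> borel_measurable ?M" by measurable
        fix a :: "'i \<Rightarrow> real"
        have kl: "P s y * g y * (\<Sum>j\<in>J. (y j - w j - (y i - c) * v j) * a j) = (\<Sum>j\<in>J. a j * (P s y * (y j - w j - (y i - c) * v j) * g y))" for y
          by (simp add: sum_distrib_left algebra_simps)
        show "(\<integral>\<^sup>+y. ennreal (g y) * indicator {0<..} (s * (y i - c)) \<partial>?M) \<le>
          (\<integral>\<^sup>+y. ennreal (g y) * indicator {0<..} (s * (y i - c)) * ennreal (exp (\<Sum>j\<in>J. (y j - w j - (y i - c) * v j) * a j)) \<partial>?M)"
          unfolding Pe
        proof (rule nn_integral_exp_tilt)
          show "integrable ?M (\<lambda>y. P s y * g y * (\<Sum>j\<in>J. (y j - w j - (y i - c) * v j) * a j))"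
            unfolding kl using moment_int[OF s] by (intro Bochner_Integration.integrable_sum integrable_mult_right) auto
          show "0 \<le> (\<integral>y. P s y * g y * (\<Sum>j\<in>J. (y j - w j - (y i - c) * v j) * a j) \<partial>?M)"
            unfolding kl using moment_int[OF s] moment[OF s] by (subst Bochner_Integration.integral_sum) auto
        qed (use intP1 P01 g(1) in auto)
        fix x y assume xy: "x \<in> space ?M" "y \<in> space ?M"
        have "f' x * ennreal (g y) = f x * ennreal (g y) * ennreal (exp (\<Sum>j\<in>insert i J. x j * W j))"
          by (simp add: f'_def ac_simps)
        also have "\<dots> \<le> ennreal (exp (- (\<Sum>j\<in>insert i J. x j * y j))) * ennreal (exp (\<Sum>j\<in>insert i J. x j * W j))"
          using fg[OF xy] by (intro mult_right_mono) auto
        also have "\<dots> = ennreal (exp (- ((\<Sum>j\<in>insert i J. x j * y j) - (\<Sum>j\<in>insert i J. x j * W j))))"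
          by (simp add: ennreal_mult[symmetric] exp_add[symmetric])
        finally show "f' x * ennreal (g y) \<le> ennreal (exp (- ((\<Sum>j\<in>J. x j * (y j - w j)) + x i * (y i - c))))"
          unfolding WS .
      qed (fact IH)
      moreover have "(\<integral>\<^sup>+y. ennreal (g y) * indicator {0<..} (s * (y i - c)) \<partial>?M) = ennreal (m / 2)"
        unfolding Pe half[OF s, symmetric] using intP1 P01 g(1) by (intro nn_integral_eq_integral) auto
      ultimately show ?thesis by simp
    qed
    have "(\<integral>\<^sup>+x. f x \<partial>?M) \<le> (\<integral>\<^sup>+x. f' x \<partial>?M)" unfolding f'_def by (rule cen)
    also have "\<dots> = (\<integral>\<^sup>+x. f' x * indicator {0<..} (1 * (x i + (\<Sum>j\<in>J. v j * x j))) + f' x * indicator {0<..} ((-1) * (x i + (\<Sum>j\<in>J. v j * x j))) \<partial>?M)"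
      using AE_lborel_on_hyperplane[OF J, of v 0] by (intro nn_integral_cong_AE) (auto simp: indicator_def)
    also have "\<dots> = (\<integral>\<^sup>+x. f' x * indicator {0<..} (1 * (x i + (\<Sum>j\<in>J. v j * x j))) \<partial>?M) + (\<integral>\<^sup>+x. f' x * indicator {0<..} ((-1) * (x i + (\<Sum>j\<in>J. v j * x j))) \<partial>?M)"
      by (rule nn_integral_add) measurable
    finally have "ennreal (m / 2) * (\<integral>\<^sup>+x. f x \<partial>?M) \<le> ennreal (m / 2) * ((\<integral>\<^sup>+x. f' x * indicator {0<..} (1 * (x i + (\<Sum>j\<in>J. v j * x j))) \<partial>?M) + (\<integral>\<^sup>+x. f' x * indicator {0<..} ((-1) * (x i + (\<Sum>j\<in>J. v j * x j))) \<partial>?M))"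
      by (intro mult_left_mono) auto
    also have "\<dots> \<le> ennreal (pi / 2 * (2 * pi) ^ card J) + ennreal (pi / 2 * (2 * pi) ^ card J)"
      unfolding distrib_left using half_ineq[of 1] half_ineq[of "-1"] by (intro add_mono) simp_all
    finally have "ennreal (m / 2) * (\<integral>\<^sup>+x. f x \<partial>?M) \<le> ennreal (pi / 2 * (2 * pi) ^ card J) + ennreal (pi / 2 * (2 * pi) ^ card J)" .
    \<comment> \<open>The two halves of \<open>f\<close> share the bound
      \<open>pi / 2 * (2 * pi) ^ card J\<close> against the mass \<open>m / 2\<close>; adding them
      and doubling restores the full mass \<open>m\<close> and produces one more factor
      \<open>2 * pi\<close>.\<close>
    hence "2 * (ennreal (m / 2) * (\<integral>\<^sup>+x. f x \<partial>?M)) \<le> 2 * (ennreal (pi / 2 * (2 * pi) ^ card J) + ennreal (pi / 2 * (2 * pi) ^ card J))"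
      by (intro mult_left_mono) auto
    also have "\<dots> = ennreal ((2 * pi) ^ card (insert i J))"
      using J by (simp add: ennreal_plus[symmetric] ennreal_mult'[symmetric] del: ennreal_plus flip: ennreal_numeral)
    also have "2 * (ennreal (m / 2) * (\<integral>\<^sup>+x. f x \<partial>?M)) = (2 * ennreal (m / 2)) * (\<integral>\<^sup>+x. f x \<partial>?M)" by (simp add: mult.assoc)
    also have "2 * ennreal (m / 2) = ennreal m" using m0 by (simp add: ennreal_mult'[symmetric] flip: ennreal_numeral)
    finally show ?thesis unfolding m by (simp add: mult.commute)
  qed
qed

text \<open>Truncating \<open>g\<close> in height and support preserves the hypotheses, since only
  \<open>f\<close> has to be centred; monotone convergence removes the truncation. Over no
  coordinates at all the space is one point and the claim is the pointwise bound itself.\<close>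

theorem santalo_on_finite: "finite (I :: 'i set) \<Longrightarrow> santalo_on I"
proof (induction I rule: finite_induct)
  case empty
  have "(\<lambda>_. undefined) \<in> space (lborel_on ({} :: 'i set))" by (simp add: space_PiM)
  then show ?case by (fastforce simp: santalo_on_def lborel_prod.nn_integral_empty)
next
  case (insert i J)
  let ?M = "lborel_on (insert i J)"
  show ?case
    unfolding santalo_on_def
  proof (intro ballI impI)
    fix f g :: "('i \<Rightarrow> real) \<Rightarrow> ennreal"
    assume [measurable]: "f \<in> borel_measurable ?M" "g \<in> borel_measurable ?M"
      and cen: "\<forall>w. (\<integral>\<^sup>+x. f x \<partial>?M) \<le> (\<integral>\<^sup>+x. f x * ennreal (exp (\<Sum>j\<in>insert i J. x j * w j)) \<partial>?M)"
      and fg: "\<forall>x\<in>space ?M. \<forall>y\<in>space ?M. f x * g y \<le> ennreal (exp (- (\<Sum>j\<in>insert i J. x j * y j)))"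
    note fin = insert.hyps(1)
    define D where "D k = {y \<in> space ?M. \<forall>j\<in>insert i J. \<bar>y j\<bar> \<le> real k}" for k :: nat
    have [measurable]: "D k \<in> sets ?M" for k
      unfolding D_def using fin by (intro sets.sets_Collect_finite_All) auto
    define gk where "gk k y = min (g y) (of_nat k) * indicator (D k) y" for k :: nat and y
    have [measurable]: "gk k \<in> borel_measurable ?M" for k unfolding gk_def by measurable
    have fin_gk: "gk k y \<le> ennreal (real k)" for k y
      by (auto simp: gk_def indicator_def ennreal_of_nat_eq_real_of_nat)
    have gk_real: "ennreal (enn2real (gk k y)) = gk k y" for k y
      using fin_gk[of k y] by (intro ennreal_enn2real) (auto simp: less_top[symmetric] top_unique)
    have gk_le: "gk k y \<le> g y" for k y by (auto simp: gk_def indicator_def)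
    have bound: "(\<integral>\<^sup>+x. f x \<partial>?M) * (\<integral>\<^sup>+x. gk k x \<partial>?M) \<le> ennreal ((2 * pi) ^ card (insert i J))" for k
    proof -
      have "(\<integral>\<^sup>+x. f x \<partial>?M) * (\<integral>\<^sup>+x. ennreal (enn2real (gk k x) * indicator (D k) x) \<partial>?M) \<le> ennreal ((2 * pi) ^ card (insert i J))"
      proof (rule santalo_insert_bounded[OF insert.hyps(1,2), where B = "real k" and R = "real k"])
        show "f \<in> borel_measurable ?M" "(\<lambda>x. enn2real (gk k x) * indicator (D k) x) \<in> borel_measurable ?M" by measurable
        show "(\<integral>\<^sup>+x. f x \<partial>?M) \<le> (\<integral>\<^sup>+x. f x * ennreal (exp (\<Sum>j\<in>insert i J. x j * w j)) \<partial>?M)" for w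
          using cen by blast
        show "0 \<le> enn2real (gk k y) * indicator (D k) y" for y by simp
        show "enn2real (gk k y) * indicator (D k) y \<le> real k" for y
          using enn2real_mono[OF fin_gk[of k y]] by (auto simp: indicator_def)
        show "enn2real (gk k y) * indicator (D k) y = 0" if "j \<in> insert i J" "real k < \<bar>y j\<bar>" for y j
        proof -
          have "y \<notin> D k" using that by (force simp: D_def)
          thus ?thesis by simp
        qed
        fix x y assume xy: "x \<in> space ?M" "y \<in> space ?M"
        have "ennreal (enn2real (gk k y) * indicator (D k) y) \<le> gk k y" 
          using gk_real by (auto simp: indicator_def)
        hence "f x * ennreal (enn2real (gk k y) * indicator (D k) y) \<le> f x * g y"
          by (intro mult_left_mono order_trans[OF _ gk_le]) auto
        also have "\<dots> \<le> ennreal (exp (- (\<Sum>j\<in>insert i J. x j * y j)))" using fg xy by blast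
        finally show "f x * ennreal (enn2real (gk k y) * indicator (D k) y) \<le> ennreal (exp (- (\<Sum>j\<in>insert i J. x j * y j)))" .
      qed (fact insert.IH)
      moreover have "ennreal (enn2real (gk k x) * indicator (D k) x) = gk k x" for x
        using gk_real[of k x] by (auto simp: gk_def indicator_def)
      ultimately show ?thesis by simp
    qed
    have incs: "incseq gk"
    proof (rule incseq_SucI, rule le_funI)
      fix k y 
      have "D k \<subseteq> D (Suc k)" by (auto simp: D_def)
      moreover have "min (g y) (of_nat k) \<le> min (g y) (of_nat (Suc k))" by (intro min.mono) (auto simp: ennreal_of_nat_eq_real_of_nat ennreal_leI)
      ultimately show "gk k y \<le> gk (Suc k) y"
        unfolding gk_def by (intro mult_mono) (auto simp: indicator_def)
    qed
    have SUP: "(SUP k. gk k y) = g y" if y: "y \<in> space ?M" for y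
    proof (rule antisym)
      show "(SUP k. gk k y) \<le> g y" by (rule SUP_least) (rule gk_le)
      obtain k0 :: nat where k0: "(\<Sum>j\<in>insert i J. \<bar>y j\<bar>) \<le> real k0" using real_arch_simple by blast
      have D: "y \<in> D k" if "k \<ge> k0" for k
      proof -
        have "\<bar>y j\<bar> \<le> real k" if j: "j \<in> insert i J" for j
        proof -
          have "\<bar>y j\<bar> \<le> (\<Sum>j\<in>insert i J. \<bar>y j\<bar>)" using j fin by (intro member_le_sum) auto
          thus ?thesis using k0 \<open>k \<ge> k0\<close> by linarith
        qed
        thus ?thesis using y by (auto simp: D_def)
      qed
      show "g y \<le> (SUP k. gk k y)"
      \<comment> \<open>\<open>g y\<close> may be infinite, so it is approached by smaller values
        \<open>z\<close>, each of which is finite and hence below some truncation level.\<close>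
      proof (rule dense_le)
        fix z assume z: "z < g y"
        hence "z \<noteq> top" by auto
        then obtain k1 :: nat where k1: "z \<le> of_nat k1" using ennreal_Ex_less_of_nat[of z] by (auto simp: less_top intro: less_imp_le)
        have "z \<le> gk (max k0 k1) y"
        proof -
          have "z \<le> of_nat (max k0 k1)" using k1 by (rule order_trans) (auto simp: ennreal_of_nat_eq_real_of_nat ennreal_leI)
          thus ?thesis using z D[of "max k0 k1"] by (simp add: gk_def)
        qed
        also have "\<dots> \<le> (SUP k. gk k y)" by (rule SUP_upper) simp
        finally show "z \<le> (SUP k. gk k y)" .
      qed
    qed
    have "(\<integral>\<^sup>+x. g x \<partial>?M) = (\<integral>\<^sup>+x. (SUP k. gk k x) \<partial>?M)" using SUP by (intro nn_integral_cong) simp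
    also have "\<dots> = (SUP k. \<integral>\<^sup>+x. gk k x \<partial>?M)" by (rule nn_integral_monotone_convergence_SUP[OF incs]) measurable
    finally have "(\<integral>\<^sup>+x. f x \<partial>?M) * (\<integral>\<^sup>+x. g x \<partial>?M) = (SUP k. (\<integral>\<^sup>+x. f x \<partial>?M) * (\<integral>\<^sup>+x. gk k x \<partial>?M))"
      by (simp add: SUP_mult_left_ennreal)
    also have "\<dots> \<le> ennreal ((2 * pi) ^ card (insert i J))" by (rule SUP_least) (rule bound)
    finally show "(\<integral>\<^sup>+x. f x \<partial>?M) * (\<integral>\<^sup>+x. g x \<partial>?M) \<le> ennreal ((2 * pi) ^ card (insert i J))" .
  qed
qed

subsection \<open>Blaschke-Santalo inequalities for sets\<close>

abbreviation vol :: "'a::euclidean_space set \<Rightarrow> ennreal" where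
  "vol \<equiv> emeasure lborel"

theorem functional_santalo:
  fixes f g :: "'a::euclidean_space \<Rightarrow> ennreal"
  assumes [measurable]: "f \<in> borel_measurable borel" "g \<in> borel_measurable borel"
    and cen: "\<And>w. (\<integral>\<^sup>+x. f x \<partial>lborel) \<le> (\<integral>\<^sup>+x. f x * ennreal (exp (x \<bullet> w)) \<partial>lborel)"
    and fg: "\<And>x y. f x * g y \<le> ennreal (exp (- (x \<bullet> y)))"
  shows "(\<integral>\<^sup>+x. f x \<partial>lborel) * (\<integral>\<^sup>+x. g x \<partial>lborel) \<le> ennreal ((2 * pi) ^ DIM('a))"
proof -
  define T :: "('a \<Rightarrow> real) \<Rightarrow> 'a" where "T x = (\<Sum>b\<in>Basis. x b *\<^sub>R b)" for x
  have [measurable]: "T \<in> measurable (lborel_on Basis) borel" unfolding T_def by measurable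
  have int: "(\<integral>\<^sup>+x. h x \<partial>lborel) = (\<integral>\<^sup>+x. h (T x) \<partial>lborel_on Basis)" if [measurable]: "h \<in> borel_measurable borel" for h :: "'a \<Rightarrow> ennreal"
    unfolding lborel_eq[where ?'a = 'a] T_def[symmetric] by (subst nn_integral_distr) auto
  have inner: "T x \<bullet> T y = (\<Sum>b\<in>Basis. x b * y b)" for x y
    unfolding T_def by (subst inner_sum_left) (auto simp: inner_sum_left_Basis inner_sum_right inner_Basis if_distrib cong: if_cong intro!: sum.cong)
  have "(\<integral>\<^sup>+x. f (T x) \<partial>lborel_on Basis) * (\<integral>\<^sup>+x. g (T x) \<partial>lborel_on Basis) \<le> ennreal ((2 * pi) ^ DIM('a))"
  proof (rule santalo_on_finite[OF finite_Basis, unfolded santalo_on_def, rule_format])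
    show "(\<integral>\<^sup>+x. f (T x) \<partial>lborel_on Basis) \<le> (\<integral>\<^sup>+x. f (T x) * ennreal (exp (\<Sum>j\<in>Basis. x j * w j)) \<partial>lborel_on Basis)" for w
      using cen[of "T w"] by (simp add: int inner)
    show "f (T x) * g (T y) \<le> ennreal (exp (- (\<Sum>j\<in>Basis. x j * y j)))" for x y
      using fg[of "T x" "T y"] by (simp add: inner)
  qed auto
  thus ?thesis by (simp add: int)
qed

section \<open>Changes of variables and Gaussian integrals\<close>

lemma nn_integral_lborel_scaleR:
  fixes h :: "'a::euclidean_space \<Rightarrow> ennreal"
  assumes [measurable]: "h \<in> borel_measurable borel" and s: "s > 0"
  shows "(\<integral>\<^sup>+x. h x \<partial>lborel) = ennreal (s ^ DIM('a)) * (\<integral>\<^sup>+x. h (s *\<^sub>R x) \<partial>lborel)"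
proof -
  have "(\<integral>\<^sup>+x. h x \<partial>lborel) = (\<integral>\<^sup>+x. h x \<partial>density (distr lborel borel (\<lambda>x. 0 + s *\<^sub>R x)) (\<lambda>_. ennreal (\<bar>s\<bar> ^ DIM('a))))"
    using lborel_affine[of s "0::'a"] s by simp
  also have "\<dots> = ennreal (s ^ DIM('a)) * (\<integral>\<^sup>+x. h (s *\<^sub>R x) \<partial>lborel)"
    using s by (simp add: nn_integral_density nn_integral_distr nn_integral_cmult)
  finally show ?thesis .
qed

lemma nn_integral_lborel_plus:
  fixes h :: "'a::euclidean_space \<Rightarrow> ennreal"
  assumes [measurable]: "h \<in> borel_measurable borel"
  shows "(\<integral>\<^sup>+x. h (a + x) \<partial>lborel) = (\<integral>\<^sup>+x. h x \<partial>lborel)"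
proof -
  have "(\<integral>\<^sup>+x. h x \<partial>distr lborel borel ((+) a)) = (\<integral>\<^sup>+x. h (a + x) \<partial>lborel)"
    by (subst nn_integral_distr) auto
  thus ?thesis by (simp add: lborel_distr_plus)
qed

text \<open>The weight is minus the derivative of \<open>exp (- s^2 / 2)\<close>; integrating over
  the scales \<open>s \<ge> a\<close> thus writes a Gaussian in \<open>a\<close> as a mixture of
  indicators.\<close>

lemma rayleigh_tail:
  assumes "a \<ge> 0"
  shows "(\<integral>\<^sup>+s. ennreal (s * exp (- s\<^sup>2 / 2)) * indicator {a..} s \<partial>lborel) = ennreal (exp (- a\<^sup>2 / 2))"
proof -
  have "(\<integral>\<^sup>+s. ennreal (s * exp (- s\<^sup>2 / 2)) * indicator {a..} s \<partial>lborel) = ennreal (0 - (- exp (- a\<^sup>2 / 2)))"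
  proof (rule nn_integral_FTC_atLeast)
    show "((\<lambda>s::real. - exp (- s\<^sup>2 / 2)) has_real_derivative s * exp (- s\<^sup>2 / 2)) (at s)" for s
      by (auto intro!: derivative_eq_intros)
    show "((\<lambda>s::real. - exp (- s\<^sup>2 / 2)) \<longlongrightarrow> 0) at_top" by real_asymp
  qed (use assms in auto)
  thus ?thesis by simp
qed

lemma nn_integral_gaussian:
  "(\<integral>\<^sup>+x. ennreal (exp (- (norm x)\<^sup>2 / 2)) \<partial>(lborel :: 'a::euclidean_space measure)) = ennreal (sqrt (2 * pi) ^ DIM('a))"
proof -
  have one: "(\<integral>\<^sup>+x. ennreal (exp (- x\<^sup>2 / 2)) \<partial>lborel) = ennreal (sqrt (2 * pi))"
  proof -
    have "(\<integral>\<^sup>+x. ennreal (exp (- x\<^sup>2 / 2)) \<partial>lborel) = (\<integral>\<^sup>+x. ennreal (sqrt (2 * pi)) * ennreal (std_normal_density x) \<partial>lborel)"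
      by (intro nn_integral_cong) (simp add: std_normal_density_def ennreal_mult[symmetric])
    also have "\<dots> = ennreal (sqrt (2 * pi)) * (\<integral>\<^sup>+x. ennreal (std_normal_density x) \<partial>lborel)"
      by (rule nn_integral_cmult) auto
    also have "(\<integral>\<^sup>+x. ennreal (std_normal_density x) \<partial>lborel) = 1"
      using prob_space.emeasure_space_1[OF prob_space_normal_density[of 1 0]] by (simp add: emeasure_density)
    finally show ?thesis by simp
  qed
  have "(\<integral>\<^sup>+x. ennreal (exp (- (norm x)\<^sup>2 / 2)) \<partial>(lborel :: 'a measure)) = 
     (\<integral>\<^sup>+x. (\<Prod>b\<in>Basis. ennreal (exp (- (x \<bullet> b)\<^sup>2 / 2))) \<partial>(lborel :: 'a measure))"
  proof (rule nn_integral_cong)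
    fix x :: 'a
    have "(norm x)\<^sup>2 = (\<Sum>b\<in>Basis. (x \<bullet> b)\<^sup>2)"
      unfolding power2_norm_eq_inner by (subst euclidean_inner) (simp add: power2_eq_square)
    hence "exp (- (norm x)\<^sup>2 / 2) = exp (\<Sum>b\<in>Basis. - (x \<bullet> b)\<^sup>2 / 2)"
      by (simp add: sum_negf sum_divide_distrib)
    thus "ennreal (exp (- (norm x)\<^sup>2 / 2)) = (\<Prod>b\<in>Basis. ennreal (exp (- (x \<bullet> b)\<^sup>2 / 2)))"
      by (simp add: exp_sum prod_ennreal)
  qed
  also have "\<dots> = (\<Prod>b\<in>(Basis :: 'a set). (\<integral>\<^sup>+x. ennreal (exp (- x\<^sup>2 / 2)) \<partial>lborel))"
    by (rule nn_integral_lborel_prod) auto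
  also have "\<dots> = ennreal (sqrt (2 * pi)) ^ DIM('a)" unfolding one by (rule prod_constant)
  also have "\<dots> = ennreal (sqrt (2 * pi) ^ DIM('a))" by (rule ennreal_power) simp
  finally show ?thesis .
qed

section \<open>From functions to sets: mixtures of dilates\<close>

text \<open>An average of the indicators of the dilates of \<open>L\<close>. It is used with the
  Rayleigh weight for Gaussians and with an exponential weight for the Laplace transform attached to
  a polar body.\<close>

definition dilate_mixture :: "(real \<Rightarrow> ennreal) \<Rightarrow> 'a::euclidean_space set \<Rightarrow> 'a \<Rightarrow> ennreal" where
  "dilate_mixture \<rho> L x = (\<integral>\<^sup>+s. \<rho> s * indicator L (x /\<^sub>R s) \<partial>lborel)"

lemma borel_measurable_dilate_mixture [measurable]:
  assumes [measurable]: "\<rho> \<in> borel_measurable borel" "L \<in> sets borel"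
  shows "dilate_mixture \<rho> L \<in> borel_measurable borel"
  unfolding dilate_mixture_def by measurable

lemma nn_integral_dilate_mixture:
  fixes L :: "'a::euclidean_space set"
  assumes [measurable]: "\<rho> \<in> borel_measurable borel" "L \<in> sets borel" "h \<in> borel_measurable borel"
    and \<rho>: "\<And>s. s \<le> 0 \<Longrightarrow> \<rho> s = 0"
  shows "(\<integral>\<^sup>+x. dilate_mixture \<rho> L x * h x \<partial>lborel) = 
    (\<integral>\<^sup>+s. \<rho> s * ennreal (s ^ DIM('a)) * (\<integral>\<^sup>+x. indicator L x * h (s *\<^sub>R x) \<partial>lborel) \<partial>lborel)"
proof -
  have "(\<integral>\<^sup>+x. dilate_mixture \<rho> L x * h x \<partial>lborel) = (\<integral>\<^sup>+x. (\<integral>\<^sup>+s. \<rho> s * indicator L (x /\<^sub>R s) * h x \<partial>lborel) \<partial>lborel)"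
    unfolding dilate_mixture_def by (simp add: nn_integral_multc)
  also have "\<dots> = (\<integral>\<^sup>+s. (\<integral>\<^sup>+x. \<rho> s * indicator L (x /\<^sub>R s) * h x \<partial>lborel) \<partial>lborel)"
    by (rule lborel_pair.Fubini') measurable
  also have "\<dots> = (\<integral>\<^sup>+s. \<rho> s * ennreal (s ^ DIM('a)) * (\<integral>\<^sup>+x. indicator L x * h (s *\<^sub>R x) \<partial>lborel) \<partial>lborel)"
  proof (rule nn_integral_cong)
    fix s :: real
    show "(\<integral>\<^sup>+x. \<rho> s * indicator L (x /\<^sub>R s) * h x \<partial>lborel) = 
      \<rho> s * ennreal (s ^ DIM('a)) * (\<integral>\<^sup>+x. indicator L x * h (s *\<^sub>R x) \<partial>lborel)"
    proof (cases "s > 0")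
      case True
      have "(\<integral>\<^sup>+x. \<rho> s * indicator L (x /\<^sub>R s) * h x \<partial>lborel) = 
         ennreal (s ^ DIM('a)) * (\<integral>\<^sup>+x. \<rho> s * indicator L ((s *\<^sub>R x) /\<^sub>R s) * h (s *\<^sub>R x) \<partial>lborel)"
        by (rule nn_integral_lborel_scaleR) (use True in measurable)
      also have "\<dots> = ennreal (s ^ DIM('a)) * (\<integral>\<^sup>+x. \<rho> s * (indicator L x * h (s *\<^sub>R x)) \<partial>lborel)"
        using True by (simp add: mult.assoc)
      also have "\<dots> = ennreal (s ^ DIM('a)) * (\<rho> s * (\<integral>\<^sup>+x. indicator L x * h (s *\<^sub>R x) \<partial>lborel))"
        by (subst nn_integral_cmult) auto
      finally show ?thesis by (simp add: ac_simps)
    qed (simp add: \<rho>)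
  qed
  finally show ?thesis .
qed

definition rayleigh :: "real \<Rightarrow> ennreal" where
  "rayleigh s = ennreal (s * exp (- s\<^sup>2 / 2)) * indicator {0<..} s"

lemma borel_measurable_rayleigh [measurable]: "rayleigh \<in> borel_measurable borel"
  unfolding rayleigh_def by measurable

lemma rayleigh_nonpos: "s \<le> 0 \<Longrightarrow> rayleigh s = 0"
  by (simp add: rayleigh_def)

text \<open>For a star body \<open>L\<close> with gauge \<open>N\<close> this is \<open>exp (- N x ^ 2 / 2)\<close>; as a mixture of indicators of
  dilates it makes sense for every set.\<close>

abbreviation gauss_gauge :: "'a::euclidean_space set \<Rightarrow> 'a \<Rightarrow> ennreal" where
  "gauss_gauge \<equiv> dilate_mixture rayleigh"

text \<open>Let \<open>a\<close> and \<open>b\<close> be the infima of the scales at which the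
  dilates reach \<open>x\<close> and \<open>y\<close>. Polarity gives
  \<open>x \<bullet> y \<le> a * b \<le> (a^2 + b^2) / 2\<close>, while only scales from
  \<open>a\<close> and from \<open>b\<close> on contribute to the two mixtures.\<close>

lemma gauss_gauge_mult_le:
  fixes L M :: "'a::euclidean_space set"
  assumes LM: "\<And>x y. x \<in> L \<Longrightarrow> y \<in> M \<Longrightarrow> x \<bullet> y \<le> 1"
  shows "gauss_gauge L x * gauss_gauge M y \<le> ennreal (exp (- (x \<bullet> y)))"
proof -
  define A B where "A = {s. s > 0 \<and> x /\<^sub>R s \<in> L}" and "B = {s. s > 0 \<and> y /\<^sub>R s \<in> M}"
  have le: "x \<bullet> y \<le> s * t" if "s \<in> A" "t \<in> B" for s t
    using LM[of "x /\<^sub>R s" "y /\<^sub>R t"] that by (simp add: A_def B_def field_simps)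
  have bdd: "bdd_below A" "bdd_below B" by (auto simp: A_def B_def intro!: bdd_belowI[of _ 0])
  have empty: "gauss_gauge L x = 0" if "A = {}"
  proof -
    have "rayleigh s * indicator L (x /\<^sub>R s) = 0" for s
      using that by (auto simp: A_def rayleigh_def indicator_def)
    thus ?thesis unfolding dilate_mixture_def by (simp only: nn_integral_const mult_zero_left)
  qed
  have empty': "gauss_gauge M y = 0" if "B = {}"
  proof -
    have "rayleigh s * indicator M (y /\<^sub>R s) = 0" for s
      using that by (auto simp: B_def rayleigh_def indicator_def)
    thus ?thesis unfolding dilate_mixture_def by (simp only: nn_integral_const mult_zero_left)
  qed
  show ?thesis
  proof (cases "A = {} \<or> B = {}")
    case True
    then show ?thesis using empty empty' by auto
  next
    case False
    hence ne: "A \<noteq> {}" "B \<noteq> {}" by auto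
    define a b where "a = Inf A" and "b = Inf B"
    have a: "a \<ge> 0" "\<And>s. s \<in> A \<Longrightarrow> a \<le> s" unfolding a_def using ne bdd by (auto intro!: cInf_greatest cInf_lower simp: A_def)
    have b: "b \<ge> 0" "\<And>s. s \<in> B \<Longrightarrow> b \<le> s" unfolding b_def using ne bdd by (auto intro!: cInf_greatest cInf_lower simp: B_def)
    have 1: "x \<bullet> y \<le> s * b" if s: "s \<in> A" for s
    proof -
      have "s > 0" using s by (simp add: A_def)
      have "x \<bullet> y / s \<le> b" unfolding b_def
        using le[OF s] \<open>s > 0\<close> ne by (intro cInf_greatest) (auto simp: field_simps)
      thus ?thesis using \<open>s > 0\<close> by (simp add: field_simps)
    qed
    \<comment> \<open>The infima are taken one after the other; a vanishing \<open>b\<close> is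
      treated apart, as it cannot be divided by.\<close>
    have ab: "x \<bullet> y \<le> a * b"
    proof (cases "b = 0")
      case True
      then show ?thesis using 1 ne by auto
    next
      case False
      hence "b > 0" using b by simp
      have "x \<bullet> y / b \<le> a" unfolding a_def
        using 1 \<open>b > 0\<close> ne by (intro cInf_greatest) (auto simp: field_simps)
      thus ?thesis using \<open>b > 0\<close> by (simp add: field_simps)
    qed
    have "gauss_gauge L x \<le> (\<integral>\<^sup>+s. ennreal (s * exp (- s\<^sup>2 / 2)) * indicator {a..} s \<partial>lborel)"
      unfolding dilate_mixture_def using a by (intro nn_integral_mono) (auto simp: rayleigh_def indicator_def A_def)
    moreover have "gauss_gauge M y \<le> (\<integral>\<^sup>+s. ennreal (s * exp (- s\<^sup>2 / 2)) * indicator {b..} s \<partial>lborel)"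
      unfolding dilate_mixture_def using b by (intro nn_integral_mono) (auto simp: rayleigh_def indicator_def B_def)
    ultimately have "gauss_gauge L x * gauss_gauge M y \<le> ennreal (exp (- a\<^sup>2 / 2)) * ennreal (exp (- b\<^sup>2 / 2))"
      unfolding rayleigh_tail[OF a(1)] rayleigh_tail[OF b(1)] by (rule mult_mono) auto
    also have "\<dots> = ennreal (exp (- (a\<^sup>2 + b\<^sup>2) / 2))" by (simp add: ennreal_mult[symmetric] exp_add[symmetric] add_divide_distrib)
    also have "\<dots> \<le> ennreal (exp (- (x \<bullet> y)))"
    proof (intro ennreal_leI, subst exp_le_cancel_iff)
      have "2 * (a * b) \<le> a\<^sup>2 + b\<^sup>2" using sum_squares_bound[of a b] by simp
      thus "- (a\<^sup>2 + b\<^sup>2) / 2 \<le> - (x \<bullet> y)" using ab by simp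
    qed
    finally show ?thesis .
  qed
qed

lemma gauss_gauge_cball: "gauss_gauge (cball 0 1) x = ennreal (exp (- (norm x)\<^sup>2 / 2))"
proof -
  have "gauss_gauge (cball 0 1) x = (\<integral>\<^sup>+s. ennreal (s * exp (- s\<^sup>2 / 2)) * indicator {norm x..} s \<partial>lborel)"
    unfolding dilate_mixture_def
  proof (intro nn_integral_cong_AE AE_I[where N = "{0}"])
    show "{s \<in> space lborel. rayleigh s * indicator (cball 0 1) (x /\<^sub>R s) \<noteq> ennreal (s * exp (- s\<^sup>2 / 2)) * indicator {norm x..} s} \<subseteq> {0}"
    proof safe
      fix s assume s: "rayleigh s * indicator (cball 0 1) (x /\<^sub>R s) \<noteq> ennreal (s * exp (- s\<^sup>2 / 2)) * indicator {norm x..} s"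
      show "s = 0"
      proof (rule ccontr)
        assume "s \<noteq> 0"
        hence "s > 0 \<or> s < 0" by auto
        moreover have "norm (x /\<^sub>R s) \<le> 1 \<longleftrightarrow> norm x \<le> s" if "s > 0" using that by (simp add: field_simps)
        moreover have "\<not> norm x \<le> s" if "s < 0" using that norm_ge_zero[of x] by linarith
        ultimately show False using s by (auto simp: rayleigh_def indicator_def)
      qed
    qed
  qed auto
  thus ?thesis by (simp only: rayleigh_tail norm_ge_zero)
qed

text \<open>The integral of \<open>gauss_gauge A\<close> is \<open>\<kappa>\<close> times the volume
  of \<open>A\<close>, with the same \<open>\<kappa>\<close> for every set. For the unit ball the
  mixture is the Gaussian, and the square of its integral is exactly the bound
  \<open>(2 * pi) ^ DIM('a)\<close>, so that \<open>\<kappa>\<close> cancels and leaves the sharp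
  constant. Tilting a dilate by \<open>w\<close> amounts to tilting \<open>L\<close> by a multiple
  of \<open>w\<close>, hence the mixture inherits the centring of \<open>L\<close>.\<close>

theorem blaschke_santalo_centred:
  fixes L M :: "'a::euclidean_space set"
  assumes [measurable]: "L \<in> sets borel" "M \<in> sets borel"
    and cen: "\<And>w. vol L \<le> (\<integral>\<^sup>+x. indicator L x * ennreal (exp (x \<bullet> w)) \<partial>lborel)"
    and LM: "\<And>x y. x \<in> L \<Longrightarrow> y \<in> M \<Longrightarrow> x \<bullet> y \<le> 1"
  shows "vol L * vol M \<le> (vol (cball (0::'a) 1))\<^sup>2"
proof -
  define \<kappa> where "\<kappa> = (\<integral>\<^sup>+s. rayleigh s * ennreal (s ^ DIM('a)) \<partial>lborel)"
  have vol: "(\<integral>\<^sup>+x. gauss_gauge A x \<partial>lborel) = \<kappa> * vol A" if [measurable]: "A \<in> sets borel" for A :: "'a set"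
    using nn_integral_dilate_mixture[of rayleigh A "\<lambda>_. 1"] rayleigh_nonpos by (simp add: \<kappa>_def nn_integral_multc)
  have ball: "\<kappa> * vol (cball (0::'a) 1) = ennreal (sqrt (2 * pi) ^ DIM('a))"
    using vol[of "cball 0 1"] unfolding gauss_gauge_cball nn_integral_gaussian by simp
  have "(\<integral>\<^sup>+x. gauss_gauge L x \<partial>lborel) * (\<integral>\<^sup>+x. gauss_gauge M x \<partial>lborel) \<le> ennreal ((2 * pi) ^ DIM('a))"
  proof (rule functional_santalo)
    fix w :: 'a
    have "(\<integral>\<^sup>+x. gauss_gauge L x \<partial>lborel) = (\<integral>\<^sup>+s. rayleigh s * ennreal (s ^ DIM('a)) * vol L \<partial>lborel)"
      using vol[of L] by (simp add: \<kappa>_def nn_integral_multc)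
    also have "\<dots> \<le> (\<integral>\<^sup>+s. rayleigh s * ennreal (s ^ DIM('a)) * (\<integral>\<^sup>+x. indicator L x * ennreal (exp ((s *\<^sub>R x) \<bullet> w)) \<partial>lborel) \<partial>lborel)"
    proof (intro nn_integral_mono mult_left_mono)
      fix s :: real
      show "vol L \<le> (\<integral>\<^sup>+x. indicator L x * ennreal (exp ((s *\<^sub>R x) \<bullet> w)) \<partial>lborel)"
        using cen[of "s *\<^sub>R w"] by simp
    qed auto
    also have "\<dots> = (\<integral>\<^sup>+x. gauss_gauge L x * ennreal (exp (x \<bullet> w)) \<partial>lborel)"
      by (subst nn_integral_dilate_mixture) (auto simp: rayleigh_nonpos)
    finally show "(\<integral>\<^sup>+x. gauss_gauge L x \<partial>lborel) \<le> (\<integral>\<^sup>+x. gauss_gauge L x * ennreal (exp (x \<bullet> w)) \<partial>lborel)" .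
  qed (use gauss_gauge_mult_le[of L M] LM in auto)
  also have "ennreal ((2 * pi) ^ DIM('a)) = (\<kappa> * vol (cball (0::'a) 1))\<^sup>2"
    unfolding ball by (simp add: ennreal_power power_mult[symmetric] mult.commute[of _ 2] power_mult)
  finally have le: "\<kappa>\<^sup>2 * (vol L * vol M) \<le> \<kappa>\<^sup>2 * (vol (cball (0::'a) 1))\<^sup>2"
    by (simp add: vol power_mult_distrib power2_eq_square ac_simps)
  \<comment> \<open>That \<open>\<kappa>\<close> is neither 0 nor infinite is read off from the
    identity for the ball.\<close>
  have "ennreal (sqrt (2 * pi) ^ DIM('a)) \<noteq> 0" by (simp add: ennreal_eq_0_iff not_le)
  hence "\<kappa> \<noteq> 0" using ball by auto
  moreover have "\<kappa> \<noteq> top" 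
  proof
    assume "\<kappa> = top"
    moreover have "vol (cball (0::'a) 1) \<noteq> 0" by (simp add: emeasure_cball unit_ball_vol_pos ennreal_eq_0_iff not_le)
    ultimately have "top = ennreal (sqrt (2 * pi) ^ DIM('a))" using ball by (simp add: ennreal_top_mult)
    thus False by simp
  qed
  ultimately obtain r where r: "\<kappa> = ennreal r" "r > 0" by (cases \<kappa>) (auto simp: less_le)
  have "ennreal (1 / r\<^sup>2) * (\<kappa>\<^sup>2 * (vol L * vol M)) \<le> ennreal (1 / r\<^sup>2) * (\<kappa>\<^sup>2 * (vol (cball (0::'a) 1))\<^sup>2)"
    using le by (rule mult_left_mono) simp
  moreover have "ennreal (1 / r\<^sup>2) * (\<kappa>\<^sup>2 * X) = X" for X
  proof -
    have "ennreal (1 / r\<^sup>2) * \<kappa>\<^sup>2 = 1" using r by (simp add: ennreal_power ennreal_mult[symmetric])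
    thus ?thesis by (simp add: mult.assoc[symmetric])
  qed
  ultimately show ?thesis by simp
qed

section \<open>Linear involutions and reflected pieces\<close>

lemma nn_integral_lborel_reflect:
  fixes h :: "'a::euclidean_space \<Rightarrow> ennreal"
  assumes [measurable]: "h \<in> borel_measurable borel"
  shows "(\<integral>\<^sup>+x. h (a - x) \<partial>lborel) = (\<integral>\<^sup>+x. h x \<partial>lborel)"
proof -
  have "(\<integral>\<^sup>+x. h x \<partial>lborel) = (\<integral>\<^sup>+x. h x \<partial>density (distr lborel borel (\<lambda>x. a + (-1) *\<^sub>R x)) (\<lambda>_. ennreal (\<bar>-1\<bar> ^ DIM('a))))"
    using lborel_affine[of "-1" a] by simp
  also have "\<dots> = (\<integral>\<^sup>+x. h (a - x) \<partial>lborel)"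
    by (simp add: density_1 nn_integral_distr)
  finally show ?thesis by simp
qed

text \<open>The Fubini argument for the uniqueness of Haar measure, with the unit ball as test set.\<close>

lemma linear_scales_lborel:
  fixes f :: "'a::euclidean_space \<Rightarrow> 'a"
  assumes f: "linear f" "bij f"
  shows "\<exists>c>0. \<forall>A\<in>sets borel. vol (f -` A) = ennreal c * vol A"
proof -
  define B where "B = cball (0::'a) 1"
  have [measurable]: "B \<in> sets borel" by (simp add: B_def)
  let ?v = "vol B"
  interpret f: linear f by fact
  have blf: "bounded_linear f" using f(1) by (simp add: linear_conv_bounded_linear)
  define g where "g = inv f"
  have fg: "f (g x) = x" "g (f x) = x" for x using f(2) by (auto simp: g_def bij_def surj_f_inv_f)
  have "linear g" unfolding g_def using f by (metis bij_betw_def inj_linear_imp_inv_linear)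
  hence blg: "bounded_linear g" by (simp add: linear_conv_bounded_linear)
  have [measurable]: "f \<in> borel_measurable borel" "g \<in> borel_measurable borel"
    using blf blg by (auto intro!: borel_measurable_continuous_onI linear_continuous_on)
  \<comment> \<open>The volume of \<open>B\<close> is written as an integral over all its
    translates. Replacing \<open>x\<close> by \<open>x - g y\<close>, a translation that changes
    \<open>f x\<close> by \<open>y\<close>, moves \<open>y\<close> from the factor of
    \<open>B\<close> to that of \<open>A\<close>.\<close>
  have sub: "vol (f -` A) * ?v = vol A * vol (f -` B)" if [measurable]: "A \<in> sets borel" for A
  proof -
    have ind: "(\<integral>\<^sup>+x. indicator S (f x) \<partial>lborel) = vol (f -` S)" if [measurable]: "S \<in> sets borel" for S :: "'a set"
    proof -
      have [measurable]: "f -` S \<in> sets borel" using measurable_sets[of f borel borel S] by simp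
      have "(\<integral>\<^sup>+x. indicator S (f x) \<partial>lborel) = (\<integral>\<^sup>+x. indicator (f -` S) x \<partial>lborel)"
        by (intro nn_integral_cong) (auto simp: indicator_def)
      thus ?thesis by simp
    qed
    have "vol (f -` A) * ?v = (\<integral>\<^sup>+x. indicator A (f x) * ?v \<partial>lborel)"
      by (subst nn_integral_multc) (auto simp: ind)
    also have "\<dots> = (\<integral>\<^sup>+x. (\<integral>\<^sup>+y. indicator A (f x) * indicator B (f x + y) \<partial>lborel) \<partial>lborel)"
      by (intro nn_integral_cong) (simp add: nn_integral_cmult nn_integral_lborel_plus[of "indicator B"])
    also have "\<dots> = (\<integral>\<^sup>+y. (\<integral>\<^sup>+x. indicator A (f x) * indicator B (f x + y) \<partial>lborel) \<partial>lborel)"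
      by (rule lborel_pair.Fubini') measurable
    also have "\<dots> = (\<integral>\<^sup>+y. (\<integral>\<^sup>+x. indicator A (f x - y) * indicator B (f x) \<partial>lborel) \<partial>lborel)"
    proof (rule nn_integral_cong)
      fix y
      have "(\<integral>\<^sup>+x. indicator A (f (- g y + x)) * indicator B (f (- g y + x) + y) \<partial>lborel) = 
        (\<integral>\<^sup>+x. indicator A (f x) * (indicator B (f x + y) :: ennreal) \<partial>lborel)"
        by (rule nn_integral_lborel_plus[of "\<lambda>x. indicator A (f x) * indicator B (f x + y)"]) measurable
      thus "(\<integral>\<^sup>+x. indicator A (f x) * (indicator B (f x + y) :: ennreal) \<partial>lborel) = (\<integral>\<^sup>+x. indicator A (f x - y) * indicator B (f x) \<partial>lborel)"
        by (simp add: f.diff fg)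
    qed
    also have "\<dots> = (\<integral>\<^sup>+x. (\<integral>\<^sup>+y. indicator A (f x - y) * indicator B (f x) \<partial>lborel) \<partial>lborel)"
      by (rule lborel_pair.Fubini') measurable
    also have "\<dots> = (\<integral>\<^sup>+x. vol A * indicator B (f x) \<partial>lborel)"
    proof (rule nn_integral_cong)
      fix x
      have "(\<integral>\<^sup>+y. indicator A (f x - y) \<partial>lborel) = vol A"
        using nn_integral_lborel_reflect[of "indicator A" "f x"] by simp
      thus "(\<integral>\<^sup>+y. indicator A (f x - y) * indicator B (f x) \<partial>lborel) = vol A * indicator B (f x)"
        by (subst nn_integral_multc) auto
    qed
    also have "\<dots> = vol A * vol (f -` B)"
      by (subst nn_integral_cmult) (auto simp: ind)
    finally show ?thesis .
  qed
  have fB: "f -` B = g ` B" using fg by (auto simp: image_iff) (metis fg(1))+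
  have "compact (f -` B)"
    unfolding fB unfolding B_def using blg by (intro compact_continuous_image linear_continuous_on) auto
  hence fin: "vol (f -` B) < \<infinity>" by (rule emeasure_compact_finite)
  have "open (f -` ball 0 1)" 
    using blf by (intro open_vimage linear_continuous_on) auto
  moreover have "0 \<in> f -` ball 0 1" by (simp add: f.zero)
  ultimately obtain e where e: "e > 0" "cball 0 e \<subseteq> f -` ball 0 1" by (meson open_contains_cball)
  have "0 < vol (cball (0::'a) e)" using e by (simp add: emeasure_cball ennreal_zero_less_mult_iff unit_ball_vol_pos)
  also have "\<dots> \<le> vol (f -` B)"
    using e measurable_sets[of f borel borel B] by (intro emeasure_mono) (auto simp: subset_iff less_imp_le B_def)
  finally have pos: "0 < vol (f -` B)" .
  obtain m where m: "vol (f -` B) = ennreal m" "m > 0"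
    using fin pos by (cases "vol (f -` B)") auto
  obtain v where v: "?v = ennreal v" "v > 0" 
    by (simp add: B_def emeasure_cball unit_ball_vol_pos)
  show ?thesis
  proof (intro exI[of _ "m / v"] conjI ballI)
    show "m / v > 0" using m v by simp
    fix A :: "'a set" assume "A \<in> sets borel"
    from sub[OF this] have "vol (f -` A) * (ennreal v * ennreal (1 / v)) = (ennreal m * ennreal (1 / v)) * vol A"
      unfolding m v by (simp add: ac_simps) (metis mult.assoc mult.commute)
    moreover have "ennreal v * ennreal (1 / v) = 1" using v by (simp add: ennreal_mult[symmetric])
    moreover have "ennreal m * ennreal (1 / v) = ennreal (m / v)" using m v by (simp add: ennreal_mult[symmetric])
    ultimately show "vol (f -` A) = ennreal (m / v) * vol A" by simp
  qed
qed

text \<open>Applying the scaling factor \<open>c\<close> of the volume twice gives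
  \<open>c * c = 1\<close>.\<close>

lemma involution_preserves_lborel:
  fixes \<sigma> :: "'a::euclidean_space \<Rightarrow> 'a"
  assumes \<sigma>: "linear \<sigma>" "\<And>x. \<sigma> (\<sigma> x) = x"
  shows "distr lborel borel \<sigma> = lborel"
proof -
  have "bij \<sigma>" using \<sigma>(2) by (metis involuntory_imp_bij)
  from linear_scales_lborel[OF \<sigma>(1) this] obtain c where c: "c > 0" 
    "\<And>A. A \<in> sets borel \<Longrightarrow> vol (\<sigma> -` A) = ennreal c * vol A" by blast
  have [measurable]: "\<sigma> \<in> borel_measurable borel"
    using \<sigma>(1) by (auto intro!: borel_measurable_continuous_onI linear_continuous_on simp: linear_conv_bounded_linear)
  let ?B = "cball (0::'a) 1"
  obtain v where v: "vol ?B = ennreal v" "v > 0" by (simp add: emeasure_cball unit_ball_vol_pos)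
  have "\<sigma> -` ?B \<in> sets borel" using measurable_sets[of \<sigma> borel borel ?B] by simp
  from c(2)[OF this] c(2)[of ?B] have "vol (\<sigma> -` (\<sigma> -` ?B)) = ennreal c * (ennreal c * ennreal v)" by (simp add: v)
  moreover have "\<sigma> -` (\<sigma> -` ?B) = ?B" using \<sigma>(2) by auto
  ultimately have "ennreal v = ennreal (c * c * v)" using c v by (simp add: ennreal_mult ac_simps)
  hence "c * c = 1" using c v by simp
  hence "c = 1" using c by (metis abs_of_pos abs_square_eq_1 power2_eq_square)
  hence "vol (\<sigma> -` A) = vol A" if "A \<in> sets borel" for A using c(2)[OF that] by simp
  thus ?thesis by (intro measure_eqI) (auto simp: emeasure_distr)
qed

lemma nn_integral_involution:
  fixes \<sigma> :: "'a::euclidean_space \<Rightarrow> 'a"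
  assumes \<sigma>: "linear \<sigma>" "\<And>x. \<sigma> (\<sigma> x) = x" and [measurable]: "h \<in> borel_measurable borel"
  shows "(\<integral>\<^sup>+x. h (\<sigma> x) \<partial>lborel) = (\<integral>\<^sup>+x. h x \<partial>lborel)"
proof -
  have [measurable]: "\<sigma> \<in> borel_measurable borel"
    using \<sigma>(1) by (auto intro!: borel_measurable_continuous_onI linear_continuous_on simp: linear_conv_bounded_linear)
  have "(\<integral>\<^sup>+x. h x \<partial>distr lborel borel \<sigma>) = (\<integral>\<^sup>+x. h (\<sigma> x) \<partial>lborel)" by (rule nn_integral_distr) auto
  thus ?thesis by (simp add: involution_preserves_lborel[OF \<sigma>])
qed

lemma AE_lborel_hyperplane:
  fixes u :: "'a::euclidean_space"
  assumes "u \<noteq> 0"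
  shows "AE x in lborel. x \<bullet> u \<noteq> c"
proof -
  have "negligible {x. u \<bullet> x = c}" using assms by (intro negligible_hyperplane) auto
  hence "AE x in lebesgue. x \<notin> {x. u \<bullet> x = c}" by (intro AE_not_in) (simp add: negligible_iff_null_sets)
  hence "AE x in lborel. x \<notin> {x. u \<bullet> x = c}" by (simp add: AE_completion_iff)
  thus ?thesis by (simp add: inner_commute)
qed

text \<open>As \<open>\<sigma>\<close> changes the sign of \<open>x \<bullet> u\<close>, the set
  \<open>S\<close> and its mirror image meet only in a hyperplane, a null set.\<close>

lemma nn_integral_reflect_union:
  fixes u :: "'a::euclidean_space"
  assumes \<sigma>: "linear \<sigma>" "\<And>x. \<sigma> (\<sigma> x) = x" "\<And>x. \<sigma> x \<bullet> u = - (x \<bullet> u)" and "u \<noteq> 0"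
    and [measurable]: "S \<in> sets borel" "h \<in> borel_measurable borel" and S: "\<And>x. x \<in> S \<Longrightarrow> x \<bullet> u \<ge> 0"
  shows "(\<integral>\<^sup>+x. indicator (S \<union> \<sigma> -` S) x * h x \<partial>lborel) = (\<integral>\<^sup>+x. indicator S x * (h x + h (\<sigma> x)) \<partial>lborel)"
proof -
  have [measurable]: "\<sigma> \<in> borel_measurable borel"
    using \<sigma>(1) by (auto intro!: borel_measurable_continuous_onI linear_continuous_on simp: linear_conv_bounded_linear)
  have "(\<integral>\<^sup>+x. indicator (S \<union> \<sigma> -` S) x * h x \<partial>lborel) = (\<integral>\<^sup>+x. indicator S x * h x + indicator S (\<sigma> x) * h (\<sigma> (\<sigma> x)) \<partial>lborel)"
  proof (rule nn_integral_cong_AE)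
    show "AE x in lborel. indicator (S \<union> \<sigma> -` S) x * h x = indicator S x * h x + indicator S (\<sigma> x) * h (\<sigma> (\<sigma> x))"
      using AE_lborel_hyperplane[OF \<open>u \<noteq> 0\<close>, of 0]
    proof eventually_elim
      case (elim x)
      have "\<not> (x \<in> S \<and> \<sigma> x \<in> S)" using S[of x] S[of "\<sigma> x"] \<sigma>(3)[of x] elim by auto
      thus ?case by (auto simp: indicator_def \<sigma>(2))
    qed
  qed
  also have "\<dots> = (\<integral>\<^sup>+x. indicator S x * h x \<partial>lborel) + (\<integral>\<^sup>+x. indicator S (\<sigma> x) * h (\<sigma> (\<sigma> x)) \<partial>lborel)"
    by (rule nn_integral_add) auto
  also have "(\<integral>\<^sup>+x. indicator S (\<sigma> x) * h (\<sigma> (\<sigma> x)) \<partial>lborel) = (\<integral>\<^sup>+x. indicator S x * h (\<sigma> x) \<partial>lborel)"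
    by (rule nn_integral_involution[OF \<sigma>(1,2), of "\<lambda>x. indicator S x * h (\<sigma> x)"]) auto
  also have "(\<integral>\<^sup>+x. indicator S x * h x \<partial>lborel) + \<dots> = (\<integral>\<^sup>+x. indicator S x * (h x + h (\<sigma> x)) \<partial>lborel)"
    by (subst nn_integral_add[symmetric]) (auto simp: distrib_left)
  finally show ?thesis .
qed

text \<open>Reflecting \<open>S\<close> in the hyperplane orthogonal to \<open>u\<close> along the direction \<open>v\<close> of its barycentre produces
  a centred set, and the adjoint reflection of \<open>T\<close> keeps the polarity relation.\<close>

lemma blaschke_santalo_half:
  fixes S T :: "'a::euclidean_space set"
  assumes [measurable]: "S \<in> sets borel" "T \<in> sets borel" and uv: "u \<bullet> v = 1"
    and S: "bounded S" "\<And>x. x \<in> S \<Longrightarrow> x \<bullet> u \<ge> 0" and T: "\<And>y. y \<in> T \<Longrightarrow> y \<bullet> v \<ge> 0"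
    and ST: "\<And>x y. x \<in> S \<Longrightarrow> y \<in> T \<Longrightarrow> x \<bullet> y \<le> 1"
    and bary: "\<And>w. (\<integral>x. indicator S x * (x \<bullet> w) \<partial>lborel) = \<beta> * (v \<bullet> w)"
  shows "4 * vol S * vol T \<le> (vol (cball (0::'a) 1))\<^sup>2"
proof -
  have uv0: "u \<noteq> 0" "v \<noteq> 0" using uv by auto
  have vu: "v \<bullet> u = 1" using uv by (simp add: inner_commute)
  define \<sigma> where "\<sigma> x = x - (2 * (x \<bullet> u)) *\<^sub>R v" for x
  define \<tau> where "\<tau> y = y - (2 * (y \<bullet> v)) *\<^sub>R u" for y
  have lin: "linear \<sigma>" "linear \<tau>" unfolding \<sigma>_def \<tau>_def
    by (auto intro!: linearI simp: algebra_simps)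
  have inv: "\<sigma> (\<sigma> x) = x" "\<tau> (\<tau> x) = x" for x
    by (simp_all add: \<sigma>_def \<tau>_def algebra_simps uv vu)
  have neg: "\<sigma> x \<bullet> u = - (x \<bullet> u)" "\<tau> x \<bullet> v = - (x \<bullet> v)" for x
    by (simp_all add: \<sigma>_def \<tau>_def algebra_simps uv vu)
  have [measurable]: "\<sigma> \<in> borel_measurable borel" "\<tau> \<in> borel_measurable borel" 
    unfolding \<sigma>_def \<tau>_def by measurable
  define L M where "L = S \<union> \<sigma> -` S" and "M = T \<union> \<tau> -` T"
  have [measurable]: "L \<in> sets borel" "M \<in> sets borel"
    using measurable_sets[of \<sigma> borel borel S] measurable_sets[of \<tau> borel borel T] by (auto simp: L_def M_def)
  have L2: "vol L = 2 * vol S"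
  proof -
    have "vol L = (\<integral>\<^sup>+x. indicator (S \<union> \<sigma> -` S) x * 1 \<partial>lborel)" by (simp add: L_def[symmetric])
    also have "\<dots> = (\<integral>\<^sup>+x. indicator S x * (1 + 1) \<partial>lborel)"
      by (rule nn_integral_reflect_union[OF lin(1) inv(1) neg(1) uv0(1)]) (use S T in auto)
    also have "\<dots> = vol S * (1 + 1)" by (subst nn_integral_multc) auto
    finally show ?thesis by (simp add: mult.commute)
  qed
  have M2: "vol M = 2 * vol T"
  proof -
    have "vol M = (\<integral>\<^sup>+x. indicator (T \<union> \<tau> -` T) x * 1 \<partial>lborel)" by (simp add: M_def[symmetric])
    also have "\<dots> = (\<integral>\<^sup>+x. indicator T x * (1 + 1) \<partial>lborel)"
      by (rule nn_integral_reflect_union[OF lin(2) inv(2) neg(2) uv0(2)]) (use S T in auto)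
    also have "\<dots> = vol T * (1 + 1)" by (subst nn_integral_multc) auto
    finally show ?thesis by (simp add: mult.commute)
  qed
  have "vol L * vol M \<le> (vol (cball (0::'a) 1))\<^sup>2"
  proof (rule blaschke_santalo_centred)
    fix w :: 'a
    \<comment> \<open>Twice \<open>l x\<close> is
      \<open>x \<bullet> w + \<sigma> x \<bullet> w\<close>, so the average of the two exponentials
      is at least \<open>exp (l x)\<close>. The linear form \<open>l\<close> vanishes on
      \<open>v\<close> and hence has mean zero over \<open>S\<close>.\<close>
    define l where "l x = x \<bullet> (w - (v \<bullet> w) *\<^sub>R u)" for x
    have fin: "vol S < \<infinity>" using S(1) by (rule emeasure_bounded_finite)
    have int: "integrable lborel (\<lambda>x. indicator S x * (x \<bullet> q))" for q
    proof -
      obtain R where R: "\<And>x. x \<in> S \<Longrightarrow> norm x \<le> R" using S(1) by (auto simp: bounded_iff)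
      show ?thesis
      proof (rule integrableI_bounded_set[where A = S and B = "R * norm q"])
        show "AE x in lborel. x \<in> S \<longrightarrow> norm (indicator S x * (x \<bullet> q)) \<le> R * norm q"
        proof (intro AE_I2 impI)
          fix x assume "x \<in> S"
          hence "\<bar>x \<bullet> q\<bar> \<le> norm x * norm q" "norm x * norm q \<le> R * norm q" 
            using Cauchy_Schwarz_ineq2 R by (auto intro: mult_right_mono)
          thus "norm (indicator S x * (x \<bullet> q)) \<le> R * norm q" by (auto simp: indicator_def)
        qed
      qed (use fin in auto)
    qed
    have "(\<integral>x. indicator S x * l x \<partial>lborel) = \<beta> * (v \<bullet> (w - (v \<bullet> w) *\<^sub>R u))"
      unfolding l_def by (rule bary)
    also have "\<dots> = 0" by (simp add: inner_diff_right vu)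
    finally have l0: "(\<integral>x. indicator S x * l x \<partial>lborel) = 0" .
    have "(\<integral>\<^sup>+x. ennreal (indicator S x) \<partial>lborel) \<le> (\<integral>\<^sup>+x. ennreal (indicator S x) * ennreal (exp (l x)) \<partial>lborel)"
    proof (rule nn_integral_exp_tilt)
      show "integrable lborel (\<lambda>x. indicator S x * l x)" unfolding l_def by (rule int)
    qed (use l0 fin in \<open>auto simp: l_def\<close>)
    hence tilt: "vol S \<le> (\<integral>\<^sup>+x. indicator S x * ennreal (exp (l x)) \<partial>lborel)"
      by (simp add: ennreal_indicator)
    have "vol L \<le> 2 * (\<integral>\<^sup>+x. indicator S x * ennreal (exp (l x)) \<partial>lborel)"
      unfolding L2 using tilt by (rule mult_left_mono) simp
    also have "\<dots> = (\<integral>\<^sup>+x. indicator S x * (2 * ennreal (exp (l x))) \<partial>lborel)"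
      by (subst nn_integral_cmult[symmetric]) (auto simp: l_def ac_simps)
    also have "\<dots> \<le> (\<integral>\<^sup>+x. indicator S x * (ennreal (exp (x \<bullet> w)) + ennreal (exp (\<sigma> x \<bullet> w))) \<partial>lborel)"
    proof (intro nn_integral_mono mult_left_mono)
      fix x
      have "2 * exp (l x) \<le> exp (x \<bullet> w) + exp (\<sigma> x \<bullet> w)"
      proof -
        have "2 * l x = x \<bullet> w + \<sigma> x \<bullet> w" by (simp add: l_def \<sigma>_def inner_diff_left inner_diff_right)
        hence "l x = (x \<bullet> w) / 2 + (\<sigma> x \<bullet> w) / 2" by simp
        hence "exp (l x) = exp ((x \<bullet> w) / 2) * exp ((\<sigma> x \<bullet> w) / 2)" by (simp add: exp_add)
        hence "2 * exp (l x) \<le> (exp ((x \<bullet> w) / 2))\<^sup>2 + (exp ((\<sigma> x \<bullet> w) / 2))\<^sup>2"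
          using sum_squares_bound[of "exp ((x \<bullet> w) / 2)" "exp ((\<sigma> x \<bullet> w) / 2)"] by simp
        thus ?thesis by (simp add: exp_double[symmetric])
      qed
      thus "2 * ennreal (exp (l x)) \<le> ennreal (exp (x \<bullet> w)) + ennreal (exp (\<sigma> x \<bullet> w))"
        by (simp add: ennreal_plus[symmetric] ennreal_mult'[symmetric] ennreal_leI del: ennreal_plus flip: ennreal_numeral)
    qed simp
    also have "\<dots> = (\<integral>\<^sup>+x. indicator L x * ennreal (exp (x \<bullet> w)) \<partial>lborel)"
      unfolding L_def by (rule nn_integral_reflect_union[OF lin(1) inv(1) neg(1) uv0(1), symmetric]) (use S in auto)
    finally show "vol L \<le> (\<integral>\<^sup>+x. indicator L x * ennreal (exp (x \<bullet> w)) \<partial>lborel)" .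
  next
    fix x y assume xy: "x \<in> L" "y \<in> M"
    \<comment> \<open>Reflecting one of the two arguments subtracts twice a product that is
      non-negative by the sign conditions on \<open>S\<close> and \<open>T\<close>; reflecting both
      leaves the pairing unchanged, because \<open>\<tau>\<close> is adjoint to
      \<open>\<sigma>\<close>.\<close>
    have *: "p \<bullet> q - 2 * (p \<bullet> u) * (q \<bullet> v) \<le> 1" if "p \<in> S" "q \<in> T" for p q
    proof -
      have "(p \<bullet> u) * (q \<bullet> v) \<ge> 0" using S(2)[OF that(1)] T[OF that(2)] by simp
      thus ?thesis using ST[OF that] by simp
    qed
    consider "x \<in> S" "y \<in> T" | "\<sigma> x \<in> S" "y \<in> T" | "x \<in> S" "\<tau> y \<in> T" | "\<sigma> x \<in> S" "\<tau> y \<in> T"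
      using xy by (auto simp: L_def M_def)
    thus "x \<bullet> y \<le> 1"
    proof cases
      case 1
      thus ?thesis by (rule ST)
    next
      case 2
      from *[OF this] show ?thesis by (simp add: neg) (simp add: \<sigma>_def algebra_simps inner_commute)
    next
      case 3
      from *[OF this] show ?thesis by (simp add: neg) (simp add: \<tau>_def algebra_simps inner_commute)
    next
      case 4
      have "\<sigma> x \<bullet> \<tau> y = x \<bullet> y" by (simp add: \<sigma>_def \<tau>_def algebra_simps uv vu inner_commute)
      thus ?thesis using ST[OF 4] by simp
    qed
  qed auto
  moreover have "2 * a * (2 * b) = 4 * a * b" for a b :: ennreal
  proof -
    have "(4::ennreal) = 2 * 2" by simp
    thus ?thesis by (simp only: ac_simps)
  qed
  ultimately show ?thesis unfolding L2 M2 by simp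
qed

section \<open>Polar bodies with respect to points outside the interior\<close>

lemma closed_polar_at: "closed (polar_at K x)"
proof -
  have "polar_at K x = (\<Inter>z\<in>K. {y. y \<bullet> (z - x) \<le> 1})" by (auto simp: polar_at_def)
  thus ?thesis by (auto intro!: closed_Collect_le continuous_intros)
qed

lemma sets_polar_at [measurable, simp]: "polar_at K x \<in> sets borel"
  by (rule borel_closed[OF closed_polar_at])

text \<open>A hyperplane weakly separating \<open>z\<close> from the interior of \<open>K\<close>
  provides a direction \<open>u\<close> in which the polar body recedes: adding non-negative
  multiples of \<open>u\<close> never leaves it. With a small ball around 0 it therefore contains
  infinitely many disjoint balls of equal radius.\<close>

lemma emeasure_polar_at_infinite:
  fixes K :: "'a::euclidean_space set"
  assumes K: "convex_body K" and z: "z \<notin> interior K"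
  shows "vol (polar_at K z) = \<infinity>"
proof -
  have K': "compact K" "convex K" "interior K \<noteq> {}" using K by (auto simp: convex_body_def)
  have "convex (interior K)" "convex {z}" "interior K \<inter> {z} = {}" using K' z by auto
  from separating_hyperplane_sets[OF this(1,2) K'(3) _ this(3)]
  obtain u b where u: "u \<noteq> 0" "\<forall>x\<in>interior K. u \<bullet> x \<le> b" "b \<le> u \<bullet> z" by auto
  have uK: "u \<bullet> w \<le> u \<bullet> z" if "w \<in> K" for w
  proof -
    have "w \<in> closure (interior K)" using that convex_closure_interior[OF K'(2,3)] closure_subset by auto
    moreover have "closure (interior K) \<subseteq> {x. u \<bullet> x \<le> b}"
      using u(2) by (intro closure_minimal closed_halfspace_le) auto
    ultimately show ?thesis using u(3) by auto
  qed
  have "bounded ((\<lambda>w. w - z) ` K)" using K'(1) by (intro bounded_translation_minus compact_imp_bounded)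
  then obtain R where R: "R > 0" "\<And>w. w \<in> K \<Longrightarrow> norm (w - z) \<le> R" by (auto simp: bounded_pos)
  define e where "e = 1 / R"
  have e: "e > 0" using R by (simp add: e_def)
  \<comment> \<open>The radius \<open>1 / R\<close> keeps the ball around 0 in the polar body, and
    centres at mutual distance at least \<open>2 * e\<close> keep the open balls disjoint.\<close>
  define A where "A k = ball ((real k * (2 * e / norm u)) *\<^sub>R u) e" for k
  have Asub: "A k \<subseteq> polar_at K z" for k
  proof
    fix y assume "y \<in> A k"
    define p where "p = y - (real k * (2 * e / norm u)) *\<^sub>R u"
    have p: "norm p \<le> e" using \<open>y \<in> A k\<close> by (simp add: A_def p_def dist_norm norm_minus_commute)
    show "y \<in> polar_at K z"
      unfolding polar_at_def
    proof safe
      fix w assume w: "w \<in> K"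
      have "p \<bullet> (w - z) \<le> norm p * norm (w - z)" by (rule norm_cauchy_schwarz)
      also have "\<dots> \<le> e * R" using p R(2)[OF w] e by (intro mult_mono) auto
      also have "\<dots> = 1" using R by (simp add: e_def)
      finally have 1: "p \<bullet> (w - z) \<le> 1" .
      have "u \<bullet> (w - z) \<le> 0" using uK[OF w] by (simp add: inner_diff_right)
      hence "(real k * (2 * e / norm u)) * (u \<bullet> (w - z)) \<le> 0" using e by (intro mult_nonneg_nonpos) auto
      moreover have "y \<bullet> (w - z) = p \<bullet> (w - z) + (real k * (2 * e / norm u)) * (u \<bullet> (w - z))"
        by (simp add: p_def inner_diff_left)
      ultimately show "y \<bullet> (w - z) \<le> 1" using 1 by linarith
    qed
  qed
  have disj: "disjoint_family A"
    unfolding disjoint_family_on_def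
  proof safe
    fix j k :: nat and y assume jk: "j \<noteq> k" and y: "y \<in> A j" "y \<in> A k"
    let ?c = "\<lambda>k. (real k * (2 * e / norm u)) *\<^sub>R u"
    have "?c j - ?c k = ((real j - real k) * (2 * e / norm u)) *\<^sub>R u"
      by (simp only: scaleR_diff_left left_diff_distrib)
    hence "norm (?c j - ?c k) = \<bar>real j - real k\<bar> * (2 * e)"
      using u(1) e by (simp add: abs_mult)
    moreover have "\<bar>real j - real k\<bar> \<ge> 1" using jk by linarith
    ultimately have "dist (?c j) (?c k) \<ge> 2 * e" using e by (simp add: dist_norm)
    moreover have "dist (?c j) (?c k) < e + e"
      using y dist_triangle_less_add[of "?c j" y e "?c k" e] by (auto simp: A_def dist_commute)
    ultimately show "y \<in> {}" by simp
  qed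
  define q where "q = unit_ball_vol (real DIM('a)) * e ^ DIM('a)"
  have q: "q > 0" using e by (simp add: q_def unit_ball_vol_pos)
  have Aq: "vol (A k) = ennreal q" for k
    using e by (simp add: A_def q_def emeasure_ball)
  have le: "ennreal (real N * q) \<le> vol (polar_at K z)" for N
  proof -
    have "ennreal (real N * q) = (\<Sum>k<N. vol (A k))" using q by (simp add: Aq ennreal_mult ennreal_of_nat_eq_real_of_nat)
    also have "\<dots> = vol (\<Union>k<N. A k)"
      using disj by (intro sum_emeasure) (auto simp: A_def disjoint_family_on_def)
    also have "\<dots> \<le> vol (polar_at K z)" using Asub by (intro emeasure_mono) auto
    finally show ?thesis .
  qed
  show ?thesis
  proof (rule ccontr)
    assume "vol (polar_at K z) \<noteq> \<infinity>"
    then obtain r where r: "vol (polar_at K z) = ennreal r" "r \<ge> 0" 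
      by (cases "vol (polar_at K z)") auto
    obtain N :: nat where "r < real N * q" using reals_Archimedean3[OF q] by blast
    thus False using le[of N] r by (simp add: ennreal_le_iff)
  qed
qed

section \<open>Hyperplanes cutting a convex body: the theorem of Meyer and Pajor\<close>

lemma integrable_indicator_scaleR:
  fixes S :: "'a::euclidean_space set"
  assumes "bounded S" and [measurable]: "S \<in> sets borel"
  shows "integrable lborel (\<lambda>x. indicator S x *\<^sub>R x)"
proof -
  obtain R where R: "\<And>x. x \<in> S \<Longrightarrow> norm x \<le> R" using assms(1) by (auto simp: bounded_iff)
  show ?thesis
    by (rule integrableI_bounded_set[where A = S and B = R]) (use R emeasure_bounded_finite[OF assms(1)] in auto)
qed

text \<open>Relative to \<open>z\<close> the barycentres of the two pieces lie on opposite rays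
  along \<open>v\<close>, and the polar body is split by the sign of \<open>y \<bullet> v\<close>.
  Four times the volume of a piece times that of the matching part is at most the squared volume of
  the ball; multiplying by the volume of the other piece and adding produces the volume of
  \<open>K\<close> on the right.\<close>

lemma santalo_hyperplane:
  fixes K :: "'a::euclidean_space set"
  assumes K: "convex_body K" and u: "u \<noteq> 0"
    and pos: "measure lborel {x \<in> K. x \<bullet> u \<ge> c} > 0" "measure lborel {x \<in> K. x \<bullet> u \<le> c} > 0"
  shows "\<exists>z\<in>interior K. z \<bullet> u = c \<and> 
    ennreal (4 * measure lborel {x \<in> K. x \<bullet> u \<ge> c} * measure lborel {x \<in> K. x \<bullet> u \<le> c}) * vol (polar_at K z)
     \<le> (vol (cball (0::'a) 1))\<^sup>2 * vol K"
proof -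
  let ?V = "vol (cball (0::'a) 1)"
  have K': "compact K" "closed K" "bounded K" using K by (auto simp: convex_body_def compact_imp_closed compact_imp_bounded)
  have [measurable]: "K \<in> sets borel" using K' by (simp add: borel_closed)
  define H where "H s = {x \<in> K. s * (x \<bullet> u - c) \<ge> 0}" for s
  define m where "m s = measure lborel (H s)" for s
  have Hb: "bounded (H s)" for s using K'(3) by (rule bounded_subset) (auto simp: H_def)
  have [measurable]: "H s \<in> sets borel" for s unfolding H_def by measurable
  have Hpm: "H 1 = {x \<in> K. x \<bullet> u \<ge> c}" "H (-1) = {x \<in> K. x \<bullet> u \<le> c}" by (auto simp: H_def)
  have mpos: "m s > 0" if "s = 1 \<or> s = -1" for s using that pos unfolding m_def Hpm[symmetric] by auto
  have em: "vol (H s) = ennreal (m s)" for s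
    unfolding m_def using emeasure_bounded_finite[OF Hb] by (simp add: emeasure_eq_ennreal_measure less_top)
  define b where "b s = (\<integral>x. indicator (H s) x *\<^sub>R x \<partial>lborel) /\<^sub>R m s" for s
  have intw: "integrable lborel (\<lambda>x. indicator (H s) x * (x \<bullet> w))" for s w
    using integrable_inner_left[OF integrable_indicator_scaleR[OF Hb[of s]], of w] by simp
  have int1: "integrable lborel (indicator (H s) :: 'a \<Rightarrow> real)" for s
    using emeasure_bounded_finite[OF Hb] by simp
  have bw: "(\<integral>x. indicator (H s) x * (x \<bullet> w) \<partial>lborel) = m s * (b s \<bullet> w)" if s: "s = 1 \<or> s = -1" for s w
  proof -
    have "(\<integral>x. (indicator (H s) x *\<^sub>R x) \<bullet> w \<partial>lborel) = (\<integral>x. indicator (H s) x *\<^sub>R x \<partial>lborel) \<bullet> w"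
      by (rule integral_inner_left) (use integrable_indicator_scaleR[OF Hb[of s]] in auto)
    thus ?thesis using mpos[OF s] by (simp add: b_def)
  qed
  have bpos: "s * (b s \<bullet> u - c) > 0" if s: "s = 1 \<or> s = -1" for s
  proof -
    have e: "indicator (H s) x * (s * (x \<bullet> u - c)) = s * (indicator (H s) x * (x \<bullet> u)) - s * c * indicator (H s) x" for x by (simp add: algebra_simps)
    have i1: "integrable lborel (\<lambda>x. indicator (H s) x * (s * (x \<bullet> u - c)))"
      unfolding e using intw[of s u] int1[of s] by simp
    have nn: "indicator (H s) x * (s * (x \<bullet> u - c)) \<ge> 0" for x by (auto simp: H_def indicator_def)
    have "(\<integral>x. indicator (H s) x * (s * (x \<bullet> u - c)) \<partial>lborel) \<noteq> 0"
    proof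
      assume "(\<integral>x. indicator (H s) x * (s * (x \<bullet> u - c)) \<partial>lborel) = 0"
      hence "AE x in lborel. indicator (H s) x * (s * (x \<bullet> u - c)) = 0"
        using integral_nonneg_eq_0_iff_AE[OF i1] nn by simp
      with AE_lborel_hyperplane[OF u, of c] have "AE x in lborel. x \<notin> H s"
        by eventually_elim (use s in \<open>auto simp: indicator_def split: if_splits\<close>)
      hence "vol (H s) = 0" by (subst (asm) AE_iff_measurable[of "H s"]) auto
      with em[of s] mpos[OF s] show False by simp
    qed
    moreover have "(\<integral>x. indicator (H s) x * (s * (x \<bullet> u - c)) \<partial>lborel) \<ge> 0" using nn by (intro Bochner_Integration.integral_nonneg) auto
    moreover have "(\<integral>x. indicator (H s) x * (s * (x \<bullet> u - c)) \<partial>lborel) = m s * (s * (b s \<bullet> u - c))"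
    proof -
      have "(\<integral>x. indicator (H s) x * (s * (x \<bullet> u - c)) \<partial>lborel) = s * (\<integral>x. indicator (H s) x * (x \<bullet> u) \<partial>lborel) - s * c * (\<integral>x. indicator (H s) x \<partial>lborel)"
        unfolding e using intw[of s u] int1[of s] by simp
      also have "(\<integral>x. indicator (H s) x \<partial>lborel) = m s" by (simp add: m_def)
      finally show ?thesis unfolding bw[OF s] by (simp add: algebra_simps)
    qed
    ultimately have "m s * (s * (b s \<bullet> u - c)) > 0" by linarith
    thus ?thesis using mpos[OF s] by (simp add: zero_less_mult_iff)
  qed
  define p q where "p = b 1 \<bullet> u - c" and "q = c - b (-1) \<bullet> u"
  have pq: "p > 0" "q > 0" using bpos[of 1] bpos[of "-1"] by (auto simp: p_def q_def)
  \<comment> \<open>\<open>p\<close> and \<open>q\<close> are the distances, in terms of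
    \<open>u\<close>, of the barycentres from the hyperplane on its two sides; these weights put
    \<open>z\<close> on it, and the scaling makes \<open>u \<bullet> v = 1\<close>, as the
    reflections require.\<close>
  define v z where "v = (b 1 - b (-1)) /\<^sub>R (p + q)" and "z = (q *\<^sub>R b 1 + p *\<^sub>R b (-1)) /\<^sub>R (p + q)"
  have uv: "u \<bullet> v = 1"
  proof -
    have "u \<bullet> v = (b 1 \<bullet> u - b (-1) \<bullet> u) / (p + q)"
      by (simp add: v_def inner_diff_right inner_commute divide_inverse mult.commute)
    also have "b 1 \<bullet> u - b (-1) \<bullet> u = p + q" by (simp add: p_def q_def)
    finally show ?thesis using pq by simp
  qed
  have b1: "b 1 = z + p *\<^sub>R v" and b2: "b (-1) = z - q *\<^sub>R v"
  proof -
    have zv: "(p + q) *\<^sub>R z = q *\<^sub>R b 1 + p *\<^sub>R b (-1)" "(p + q) *\<^sub>R v = b 1 - b (-1)"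
      using pq by (simp_all add: z_def v_def)
    have e: "(p + q) *\<^sub>R (z + p *\<^sub>R v) = (p + q) *\<^sub>R z + p *\<^sub>R ((p + q) *\<^sub>R v)"
      "(p + q) *\<^sub>R (z - q *\<^sub>R v) = (p + q) *\<^sub>R z - q *\<^sub>R ((p + q) *\<^sub>R v)"
      by (simp_all add: scaleR_add_right scaleR_diff_right mult.commute)
    have "(p + q) *\<^sub>R (z + p *\<^sub>R v) = (p + q) *\<^sub>R b 1" "(p + q) *\<^sub>R (z - q *\<^sub>R v) = (p + q) *\<^sub>R b (-1)"
      unfolding e zv by (simp_all add: algebra_simps)
    thus "b 1 = z + p *\<^sub>R v" "b (-1) = z - q *\<^sub>R v" using pq by simp_all
  qed
  have zu: "z \<bullet> u = c"
  proof -
    have "v \<bullet> u = 1" using uv by (simp add: inner_commute)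
    hence "b 1 \<bullet> u = z \<bullet> u + p" by (subst b1) (simp add: inner_add_left)
    thus ?thesis by (simp add: p_def)
  qed
  have bz: "s * ((b s - z) \<bullet> w) = (s * (b s \<bullet> u - c)) * (v \<bullet> w)" if s: "s = 1 \<or> s = -1" for s w
  proof -
    have "b 1 - z = p *\<^sub>R v" "b (-1) - z = - (q *\<^sub>R v)" using b1 b2 by (simp_all add: algebra_simps)
    hence "(b 1 - z) \<bullet> w = p * (v \<bullet> w)" "(b (-1) - z) \<bullet> w = - q * (v \<bullet> w)" by simp_all
    moreover have "b 1 \<bullet> u - c = p" "b (-1) \<bullet> u - c = - q" by (simp_all add: p_def q_def)
    ultimately show ?thesis using s by fastforce
  qed
  define T where "T s = {y \<in> polar_at K z. s * (y \<bullet> v) \<ge> 0}" for s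
  have [measurable]: "T s \<in> sets borel" for s unfolding T_def by measurable
  have half: "4 * ennreal (m s) * vol (T s) \<le> ?V\<^sup>2" if s: "s = 1 \<or> s = -1" for s
  proof -
    have ss: "s * s = 1" using s by auto
    define S where "S = (\<lambda>x. z + x) -` H s"
    have [measurable]: "S \<in> sets borel" using measurable_sets[of "(+) z" borel borel "H s"] by (simp add: S_def)
    have indS: "indicator S x = (indicator (H s) (z + x) :: 'b::zero_neq_one)" for x by (simp add: S_def indicator_def)
    have mS: "vol S = ennreal (m s)"
    proof -
      have "vol S = (\<integral>\<^sup>+x. indicator (H s) (z + x) \<partial>lborel)" by (simp flip: indS)
      also have "\<dots> = (\<integral>\<^sup>+x. indicator (H s) x \<partial>lborel)" by (rule nn_integral_lborel_plus) measurable
      finally show ?thesis by (simp add: em)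
    qed
    have "4 * vol S * vol (T s) \<le> ?V\<^sup>2"
    proof (rule blaschke_santalo_half[where u = "s *\<^sub>R u" and v = "s *\<^sub>R v" and \<beta> = "m s * (s * (b s \<bullet> u - c))"])
      show "s *\<^sub>R u \<bullet> s *\<^sub>R v = 1" using ss uv by (simp add: mult.assoc[symmetric])
      have "S = (\<lambda>x. x - z) ` H s" by (force simp: S_def)
      thus "bounded S" using bounded_translation_minus[OF Hb[of s], of z] by simp
      show "0 \<le> x \<bullet> s *\<^sub>R u" if "x \<in> S" for x using that zu by (auto simp: S_def H_def inner_add_left)
      show "0 \<le> y \<bullet> s *\<^sub>R v" if "y \<in> T s" for y using that by (auto simp: T_def)
      show "x \<bullet> y \<le> 1" if "x \<in> S" "y \<in> T s" for x y
      proof -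
        have "z + x \<in> K" "\<forall>w\<in>K. y \<bullet> (w - z) \<le> 1" using that by (auto simp: S_def H_def T_def polar_at_def)
        thus ?thesis by (metis add_diff_cancel_left' inner_commute)
      qed
      fix w
      have "(\<integral>x. indicator S x * (x \<bullet> w) \<partial>lborel) = (\<integral>x. indicator (H s) (z + x) * (((z + x) - z) \<bullet> w) \<partial>lborel)"
        by (simp add: indS)
      also have "\<dots> = (\<integral>x. indicator (H s) x * ((x - z) \<bullet> w) \<partial>distr lborel borel ((+) z))"
        by (subst integral_distr) auto
      also have "\<dots> = (\<integral>x. indicator (H s) x * (x \<bullet> w) - (z \<bullet> w) * indicator (H s) x \<partial>lborel)"
        by (simp add: lborel_distr_plus algebra_simps inner_diff_left)
      also have "\<dots> = m s * (b s \<bullet> w) - (z \<bullet> w) * m s"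
        using intw[of s w] int1[of s] by (simp add: bw[OF s]) (simp add: m_def)
      also have "\<dots> = m s * ((s * s) * ((b s - z) \<bullet> w))" unfolding ss by (simp add: algebra_simps inner_diff_left)
      also have "\<dots> = m s * (s * (s * ((b s - z) \<bullet> w)))" by (simp only: mult.assoc)
      also have "\<dots> = m s * (s * (b s \<bullet> u - c)) * (s *\<^sub>R v \<bullet> w)" unfolding bz[OF s, of w] by simp
      finally show "(\<integral>x. indicator S x * (x \<bullet> w) \<partial>lborel) = m s * (s * (b s \<bullet> u - c)) * (s *\<^sub>R v \<bullet> w)" .
    qed measurable
    thus ?thesis unfolding mS .
  qed
  have mm: "m 1 > 0" "m (-1) > 0" using mpos by auto
  have mK: "ennreal (m 1) + ennreal (m (-1)) = vol K"
  proof -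
    have "ennreal (m 1) + ennreal (m (-1)) = (\<integral>\<^sup>+x. indicator (H 1) x + indicator (H (-1)) x \<partial>lborel)"
      by (subst nn_integral_add) (auto simp: em)
    also have "\<dots> = (\<integral>\<^sup>+x. indicator K x \<partial>lborel)"
      using AE_lborel_hyperplane[OF u, of c] by (intro nn_integral_cong_AE) (auto simp: H_def indicator_def)
    finally show ?thesis by simp
  qed
  have "polar_at K z = T 1 \<union> T (-1)" by (auto simp: T_def)
  hence "vol (polar_at K z) \<le> vol (T 1) + vol (T (-1))"
    using emeasure_subadditive[of "T 1" lborel "T (-1)"] by simp
  hence "ennreal (4 * m 1 * m (-1)) * vol (polar_at K z) \<le> 
     ennreal (4 * m 1 * m (-1)) * (vol (T 1) + vol (T (-1)))"
    by (rule mult_left_mono) simp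
  also have "\<dots> = ennreal (m (-1)) * (4 * ennreal (m 1) * vol (T 1)) + ennreal (m 1) * (4 * ennreal (m (-1)) * vol (T (-1)))"
    using mm by (simp add: ennreal_mult distrib_left ac_simps)
  also have "\<dots> \<le> ennreal (m (-1)) * ?V\<^sup>2 + ennreal (m 1) * ?V\<^sup>2"
    using half by (intro add_mono mult_left_mono) auto
  also have "\<dots> = ?V\<^sup>2 * vol K" unfolding mK[symmetric] by (simp add: algebra_simps)
  finally have main: "ennreal (4 * m 1 * m (-1)) * vol (polar_at K z) \<le> ?V\<^sup>2 * vol K" .
  \<comment> \<open>Otherwise the polar body would have infinite volume, against the finite bound
    just obtained.\<close>
  have "z \<in> interior K"
  proof (rule ccontr)
    assume "z \<notin> interior K"
    have "ennreal (4 * m 1 * m (-1)) \<noteq> 0" using mm by (simp add: ennreal_eq_0_iff not_le)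
    hence "?V\<^sup>2 * vol K = \<infinity>" 
      using main unfolding emeasure_polar_at_infinite[OF K \<open>z \<notin> interior K\<close>] by (simp add: ennreal_mult_top top_unique)
    moreover have "?V\<^sup>2 < \<infinity>" using emeasure_bounded_finite[OF bounded_cball[of "0::'a" 1]] by (simp add: power_less_top_ennreal)
    moreover have "vol K < \<infinity>" using emeasure_bounded_finite[OF K'(3)] .
    ultimately show False by (metis ennreal_mult_less_top infinity_ennreal_def less_irrefl)
  qed
  with main zu show ?thesis unfolding m_def Hpm by blast
qed

subsection \<open>Volumes of polar bodies as a Laplace transform\<close>

text \<open>The gauge of \<open>polar_at K x\<close> is \<open>y \<mapsto> supp K y - x \<bullet> y\<close>.\<close>

definition supp :: "'a::euclidean_space set \<Rightarrow> 'a \<Rightarrow> real" where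
  "supp K y = (SUP z\<in>K. y \<bullet> z)"

text \<open>The weights that the Laplace transform tolerates at interior points of \<open>K\<close>,
  where its kernel decays exponentially. Every differentiation multiplies the weight by a linear
  form in \<open>y\<close>, so the class has to be closed under products.\<close>

definition subexponential :: "('a::euclidean_space \<Rightarrow> real) \<Rightarrow> bool" where
  "subexponential p \<longleftrightarrow> p \<in> borel_measurable borel \<and> (\<forall>e>0. \<exists>C. \<forall>y. \<bar>p y\<bar> \<le> C * exp (e * norm y))"

definition laplace :: "'a::euclidean_space set \<Rightarrow> ('a \<Rightarrow> real) \<Rightarrow> 'a \<Rightarrow> real" where
  "laplace K p x = (\<integral>y. p y * exp (x \<bullet> y - supp K y) \<partial>lborel)"

lemma subexponential_const: "subexponential (\<lambda>_. 1)"
  unfolding subexponential_def by (auto intro!: exI[of _ 1])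

lemma subexponential_abs: "subexponential p \<Longrightarrow> subexponential (\<lambda>y. \<bar>p y\<bar>)"
  unfolding subexponential_def by auto

lemma norm_le_exp:
  assumes "e > 0"
  shows "norm y \<le> 1 / e * exp (e * norm y)"
proof -
  have "e * norm y \<le> exp (e * norm y)" using exp_ge_add_one_self[of "e * norm y"] by linarith
  thus ?thesis using assms by (simp add: field_simps)
qed

lemma subexponential_norm: "subexponential (norm :: 'a::euclidean_space \<Rightarrow> real)"
  unfolding subexponential_def by (auto intro!: norm_le_exp exI)

lemma subexponential_inner: "subexponential (\<lambda>y. y \<bullet> v)"
  unfolding subexponential_def
proof (intro conjI allI impI)
  fix e :: real assume e: "e > 0"
  have "\<bar>y \<bullet> v\<bar> \<le> norm v / e * exp (e * norm y)" for y
  proof -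
    have "\<bar>y \<bullet> v\<bar> \<le> norm y * norm v" by (rule Cauchy_Schwarz_ineq2)
    also have "\<dots> \<le> (1 / e * exp (e * norm y)) * norm v" by (intro mult_right_mono norm_le_exp e) auto
    finally show ?thesis by (simp add: ac_simps)
  qed
  thus "\<exists>C. \<forall>y. \<bar>y \<bullet> v\<bar> \<le> C * exp (e * norm y)" by blast
qed simp

lemma subexponential_mult:
  assumes p: "subexponential p" and q: "subexponential q"
  shows "subexponential (\<lambda>y. p y * q y)"
  unfolding subexponential_def
proof (intro conjI allI impI)
  show "(\<lambda>y. p y * q y) \<in> borel_measurable borel" using p q by (auto simp: subexponential_def)
  fix e :: real assume "e > 0"
  hence "e / 2 > 0" by simp
  then obtain C D where C: "\<And>y. \<bar>p y\<bar> \<le> C * exp (e / 2 * norm y)" and D: "\<And>y. \<bar>q y\<bar> \<le> D * exp (e / 2 * norm y)"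
    using p q unfolding subexponential_def by meson
  have "\<bar>p y * q y\<bar> \<le> (C * D) * exp (e * norm y)" for y
  proof -
    have "\<bar>p y * q y\<bar> \<le> (C * exp (e / 2 * norm y)) * (D * exp (e / 2 * norm y))"
      unfolding abs_mult using C[of y] D[of y] by (intro mult_mono) (auto intro: order_trans[OF abs_ge_zero])
    also have "exp (e * norm y) = exp (e / 2 * norm y) * exp (e / 2 * norm y)" by (simp add: exp_add[symmetric])
    hence "(C * exp (e / 2 * norm y)) * (D * exp (e / 2 * norm y)) = (C * D) * exp (e * norm y)" by simp
    finally show ?thesis .
  qed
  thus "\<exists>C. \<forall>y. \<bar>p y * q y\<bar> \<le> C * exp (e * norm y)" by blast
qed

text \<open>The estimate behind differentiation of the Laplace transform. The growth factor
  \<open>exp \<bar>a\<bar>\<close> is affordable because half of the decay of the kernel pays for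
  it.\<close>

lemma exp_remainder: "\<bar>exp a - 1 - a\<bar> \<le> a\<^sup>2 * exp \<bar>a\<bar>" for a :: real
proof -
  have 1: "exp a - 1 - a \<ge> 0" using exp_ge_add_one_self[of a] by linarith
  have e: "exp b - 1 \<le> b * exp b" for b :: real
  proof -
    have "(1 - b) * exp b \<le> exp (- b) * exp b" using exp_ge_add_one_self[of "- b"] by (intro mult_right_mono) auto
    thus ?thesis by (simp add: exp_minus algebra_simps)
  qed
  have "exp a - 1 - a \<le> a * (exp a - 1)" using e[of a] by (simp add: algebra_simps)
  also have "\<dots> \<le> \<bar>a\<bar> * (\<bar>a\<bar> * exp \<bar>a\<bar>)"
  proof (cases "a \<ge> 0")
    case True
    thus ?thesis using mult_left_mono[OF e[of a] True] by simp
  next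
    case False
    have "1 - exp a \<le> \<bar>a\<bar> * 1" using exp_ge_add_one_self[of a] False by linarith
    hence le: "\<bar>a\<bar> * (1 - exp a) \<le> \<bar>a\<bar> * (\<bar>a\<bar> * 1)" by (rule mult_left_mono) simp
    have "a * (exp a - 1) = \<bar>a\<bar> * (1 - exp a)" using False by (simp add: algebra_simps)
    also have "\<dots> \<le> \<bar>a\<bar> * (\<bar>a\<bar> * 1)" by (rule le)
    also have "\<dots> \<le> \<bar>a\<bar> * (\<bar>a\<bar> * exp \<bar>a\<bar>)" by (intro mult_left_mono) auto
    finally show ?thesis .
  qed
  finally show ?thesis using 1 by (simp add: power2_eq_square mult.assoc[symmetric])
qed

text \<open>The strict tangent inequality \<open>1 + z < exp z\<close>, used at the intermediate
  point \<open>m\<close> and averaged with weights \<open>a\<close> and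
  \<open>1 - a\<close>.\<close>

lemma exp_strict_convex:
  fixes s t :: real
  assumes "s \<noteq> t" "0 < a" "a < 1"
  shows "exp (a * s + (1 - a) * t) < a * exp s + (1 - a) * exp t"
proof -
  have ex: "1 + z < exp z" if "z \<noteq> 0" for z :: real
  proof (cases "1 + z / 2 \<ge> 0")
    case True
    have "(1 + z / 2)\<^sup>2 = 1 + z + z\<^sup>2 / 4" by (simp add: power2_eq_square field_simps)
    hence "1 + z < (1 + z / 2)\<^sup>2" using that by simp
    also have "\<dots> \<le> (exp (z / 2))\<^sup>2" using True exp_ge_add_one_self[of "z / 2"] by (intro power_mono) auto
    also have "\<dots> = exp z" by (simp add: exp_double[symmetric])
    finally show ?thesis .
  next
    case False
    hence "1 + z < 0" by linarith
    thus ?thesis using exp_gt_zero[of z] by linarith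
  qed
  define m where "m = a * s + (1 - a) * t"
  have sm: "s - m = (1 - a) * (s - t)" "t - m = a * (t - s)" by (simp_all add: m_def algebra_simps)
  have "1 = a * (1 + (s - m)) + (1 - a) * (1 + (t - m))" unfolding sm by (simp add: algebra_simps)
  also have "\<dots> < a * exp (s - m) + (1 - a) * exp (t - m)"
    using assms ex[of "s - m"] ex[of "t - m"] sm by (intro add_strict_mono mult_strict_left_mono) auto
  finally have "exp m * 1 < exp m * (a * exp (s - m) + (1 - a) * exp (t - m))" by (intro mult_strict_left_mono) auto
  also have "\<dots> = a * (exp m * exp (s - m)) + (1 - a) * (exp m * exp (t - m))" by (simp add: algebra_simps)
  also have "\<dots> = a * exp s + (1 - a) * exp t" by (simp only: exp_add[symmetric]) simp
  finally show ?thesis by (simp add: m_def)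
qed

lemma integral_lborel_pos:
  fixes f :: "'a::euclidean_space \<Rightarrow> real"
  assumes f: "integrable lborel f" "\<And>x. f x \<ge> 0" "AE x in lborel. f x > 0"
  shows "(\<integral>x. f x \<partial>lborel) > 0"
proof -
  have "(\<integral>x. f x \<partial>lborel) \<noteq> 0"
  proof
    assume "(\<integral>x. f x \<partial>lborel) = 0"
    hence "AE x in lborel. f x = 0" using integral_nonneg_eq_0_iff_AE[OF f(1)] f(2) by simp
    with f(3) have "AE x in (lborel :: 'a measure). False" by eventually_elim simp
    hence "vol (UNIV :: 'a set) = 0" by (simp add: AE_iff_measurable[of UNIV])
    thus False by simp
  qed
  moreover have "(\<integral>x. f x \<partial>lborel) \<ge> 0" using f(2) by (intro Bochner_Integration.integral_nonneg) auto
  ultimately show ?thesis by simp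
qed

text \<open>On an open set a derivative depends only on the values there. This allows the explicit
  formula for a derivative, known only in the interior of \<open>K\<close>, to be substituted in the
  recursion of \<open>Ck_on\<close>, whose functions live on the whole space.\<close>

lemma Ck_on_cong:
  assumes U: "open U"
  shows "(\<And>x. x \<in> U \<Longrightarrow> f x = g x) \<Longrightarrow> Ck_on k U f \<longleftrightarrow> Ck_on k U g"
proof (induction k arbitrary: f g)
  case 0
  then show ?case by (simp cong: continuous_on_cong)
next
  case (Suc k)
  have der: "(f has_derivative D) (at x) \<longleftrightarrow> (g has_derivative D) (at x)" if "x \<in> U" for x D
    using that Suc.prems U has_derivative_transform_within_open[of f D x UNIV U g] has_derivative_transform_within_open[of g D x UNIV U f]
    by auto
  have "frechet_derivative f (at x) = frechet_derivative g (at x)" if "x \<in> U" for x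
    unfolding frechet_derivative_def der[OF that] ..
  moreover have "f differentiable (at x) \<longleftrightarrow> g differentiable (at x)" if "x \<in> U" for x
    unfolding differentiable_def der[OF that] ..
  ultimately show ?case using Suc.IH by (metis (no_types, lifting) Ck_on.simps(2))
qed

section \<open>Convergence, smoothness and strict convexity of the Laplace transform\<close>

context
  fixes K :: "'a::euclidean_space set"
  assumes K: "convex_body K"
begin

lemma convex_body_basics: "compact K" "convex K" "interior K \<noteq> {}" "K \<noteq> {}" "closed K" "bounded K"
  using K interior_subset by (auto simp: convex_body_def compact_imp_closed compact_imp_bounded)

lemma bdd_above_inner: "bdd_above ((\<lambda>z. y \<bullet> z) ` K)"
  by (intro bounded_imp_bdd_above compact_imp_bounded compact_continuous_image continuous_intros convex_body_basics)

lemma inner_le_supp: "z \<in> K \<Longrightarrow> y \<bullet> z \<le> supp K y"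
  unfolding supp_def by (intro cSUP_upper bdd_above_inner)

lemma supp_le_iff: "supp K y \<le> c \<longleftrightarrow> (\<forall>z\<in>K. y \<bullet> z \<le> c)"
  unfolding supp_def by (intro cSUP_le_iff bdd_above_inner convex_body_basics)

lemma supp_scaleR:
  assumes "s > 0"
  shows "supp K (s *\<^sub>R y) = s * supp K y"
proof (rule antisym)
  show "supp K (s *\<^sub>R y) \<le> s * supp K y"
    unfolding supp_le_iff using assms by (auto intro: mult_left_mono inner_le_supp)
  have "supp K y \<le> supp K (s *\<^sub>R y) / s"
    unfolding supp_le_iff using assms inner_le_supp[of _ "s *\<^sub>R y"] by (auto simp: field_simps)
  thus "s * supp K y \<le> supp K (s *\<^sub>R y)" using assms by (simp add: field_simps)
qed

lemma borel_measurable_supp [measurable]: "supp K \<in> borel_measurable borel"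
proof -
  have "{y. supp K y \<le> c} \<in> sets borel" for c
  proof -
    have "{y. supp K y \<le> c} = (\<Inter>z\<in>K. {y. y \<bullet> z \<le> c})" by (auto simp: supp_le_iff)
    moreover have "closed (\<Inter>z\<in>K. {y. y \<bullet> z \<le> c})" by (auto intro!: closed_Collect_le continuous_intros)
    ultimately show ?thesis by (metis borel_closed)
  qed
  thus ?thesis by (simp add: borel_measurable_iff_le)
qed

lemma polar_at_eq_supp: "polar_at K x = {y. supp K y - x \<bullet> y \<le> 1}"
proof -
  have "(supp K y - x \<bullet> y \<le> 1) = (supp K y \<le> 1 + x \<bullet> y)" for y by auto
  thus ?thesis unfolding polar_at_def supp_le_iff by (auto simp: inner_diff_right inner_commute algebra_simps)
qed

text \<open>Moving from \<open>x\<close> by \<open>r\<close> in the direction of \<open>y\<close>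
  stays in \<open>K\<close>. This is the source of the decay of the Laplace kernel at interior
  points.\<close>

lemma supp_ge_norm:
  assumes "cball x r \<subseteq> K" "r \<ge> 0"
  shows "x \<bullet> y + r * norm y \<le> supp K y"
proof (cases "y = 0")
  case True
  have "supp K 0 \<ge> 0" using inner_le_supp[of _ 0] convex_body_basics(4) by auto
  then show ?thesis using True by simp
next
  case False
  have "x + (r / norm y) *\<^sub>R y \<in> K" using assms False by (auto simp: subset_iff dist_norm)
  from inner_le_supp[OF this, of y] show ?thesis
    using False by (simp add: inner_add_right inner_commute power2_norm_eq_inner[symmetric] power2_eq_square)
qed

lemma inner_le_supp': "x \<in> K \<Longrightarrow> x \<bullet> y \<le> supp K y"
  using inner_le_supp[of x y] by (simp add: inner_commute)

text \<open>\<open>exp (- N y)\<close> is the integral of \<open>exp (- s)\<close> over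
  \<open>s \<ge> N y\<close>, hence a mixture of the dilates of the polar body; scaling the volume
  contributes \<open>s ^ DIM('a)\<close> and with it the factorial. In extended reals the identity
  also covers boundary points of \<open>K\<close>, where both sides are infinite.\<close>

lemma laplace_polar:
  assumes x: "x \<in> K"
  shows "(\<integral>\<^sup>+y. ennreal (exp (x \<bullet> y - supp K y)) \<partial>lborel) = ennreal (fact DIM('a)) * vol (polar_at K x)"
proof -
  define N where "N y = supp K y - x \<bullet> y" for y
  have [measurable]: "N \<in> borel_measurable borel" unfolding N_def by measurable
  have N0: "N y \<ge> 0" for y using inner_le_supp'[OF x, of y] by (simp add: N_def)
  have Ns: "N (s *\<^sub>R y) = s * N y" if "s > 0" for s y using supp_scaleR[OF that, of y] by (simp add: N_def algebra_simps)
  have pol: "polar_at K x = {y. N y \<le> 1}" by (simp add: polar_at_eq_supp N_def)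
  have tail: "ennreal (exp (- a)) = (\<integral>\<^sup>+s. ennreal (exp (- s)) * indicator {a..} s \<partial>lborel)" for a :: real
  proof -
    have "(\<integral>\<^sup>+s. ennreal (exp (- s)) * indicator {a..} s \<partial>lborel) = ennreal (0 - (- exp (- a)))"
    proof (rule nn_integral_FTC_atLeast)
      show "((\<lambda>s::real. - exp (- s)) has_real_derivative exp (- s)) (at s)" for s
        by (auto intro!: derivative_eq_intros)
      show "((\<lambda>s::real. - exp (- s)) \<longlongrightarrow> 0) at_top" by real_asymp
    qed auto
    thus ?thesis by simp
  qed
  define \<rho> where "\<rho> s = ennreal (exp (- s)) * indicator {0<..} s" for s :: real
  have [measurable]: "\<rho> \<in> borel_measurable borel" unfolding \<rho>_def by measurable
  have "ennreal (exp (x \<bullet> y - supp K y)) = dilate_mixture \<rho> (polar_at K x) y" for y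
  proof -
    have "N (y /\<^sub>R s) \<le> 1 \<longleftrightarrow> N y \<le> s" if "s > 0" for s
    proof -
      have "N (y /\<^sub>R s) = N y / s" using Ns[of "inverse s" y] that by (simp add: divide_inverse mult.commute)
      thus ?thesis using that by (simp add: divide_le_eq)
    qed
    hence "\<rho> s * indicator (polar_at K x) (y /\<^sub>R s) = ennreal (exp (- s)) * indicator {N y..} s" if "s \<noteq> 0" for s
      using that N0[of y] by (cases "s > 0") (auto simp: \<rho>_def pol indicator_def)
    hence "dilate_mixture \<rho> (polar_at K x) y = (\<integral>\<^sup>+s. ennreal (exp (- s)) * indicator {N y..} s \<partial>lborel)"
      unfolding dilate_mixture_def using AE_lborel_singleton[of "0::real"] by (intro nn_integral_cong_AE) auto
    thus ?thesis by (simp add: tail[symmetric] N_def)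
  qed
  hence "(\<integral>\<^sup>+y. ennreal (exp (x \<bullet> y - supp K y)) \<partial>lborel) = (\<integral>\<^sup>+y. dilate_mixture \<rho> (polar_at K x) y * 1 \<partial>lborel)"
    by simp
  also have "\<dots> = (\<integral>\<^sup>+s. \<rho> s * ennreal (s ^ DIM('a)) * vol (polar_at K x) \<partial>lborel)"
    by (subst nn_integral_dilate_mixture) (auto simp: \<rho>_def)
  also have "\<dots> = (\<integral>\<^sup>+s. \<rho> s * ennreal (s ^ DIM('a)) \<partial>lborel) * vol (polar_at K x)"
    by (rule nn_integral_multc) measurable
  also have "(\<integral>\<^sup>+s. \<rho> s * ennreal (s ^ DIM('a)) \<partial>lborel) = (\<integral>\<^sup>+s. ennreal (s ^ DIM('a) * exp (- s)) * indicator {0..} s \<partial>lborel)"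
    using AE_lborel_singleton[of "0::real"] by (intro nn_integral_cong_AE) (auto simp: \<rho>_def indicator_def ennreal_mult' mult.commute)
  also have "(\<integral>\<^sup>+s. ennreal (s ^ DIM('a) * exp (- s)) * indicator {0..} s \<partial>lborel) = ennreal (fact DIM('a))"
    by (subst nn_intergal_power_times_exp_Ici) simp
  finally show ?thesis .
qed

lemma emeasure_polar_at_finite:
  assumes "x \<in> interior K"
  shows "vol (polar_at K x) < \<infinity>"
proof -
  obtain r where r: "r > 0" "cball x r \<subseteq> K" using assms by (meson interior_subset mem_interior_cball)
  have "norm y \<le> 1 / r" if "y \<in> polar_at K x" for y
    using that supp_ge_norm[OF r(2), of y] r(1) unfolding polar_at_eq_supp by (auto simp: field_simps)
  hence "bounded (polar_at K x)" by (auto simp: bounded_iff)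
  thus ?thesis by (rule emeasure_bounded_finite)
qed

text \<open>Polar coordinates are avoided: at an interior point of \<open>K\<close> the kernel has
  finite integral by \<open>laplace_polar\<close> and dominates \<open>exp (- (R * norm y))\<close>,
  where \<open>R\<close> bounds the distances to the points of \<open>K\<close>; a dilation changes
  \<open>R\<close> into \<open>r\<close>.\<close>

lemma integrable_exp_norm:
  assumes "r > 0"
  shows "integrable lborel (\<lambda>y::'a. exp (- (r * norm y)))"
proof (rule integrableI_nonneg)
  obtain x where "x \<in> interior K" using convex_body_basics(3) by auto
  obtain R where R: "R > 0" "\<And>z. z \<in> K \<Longrightarrow> norm (z - x) \<le> R" 
    using bounded_translation_minus[OF convex_body_basics(6), of x] by (auto simp: bounded_pos)
  have "x \<in> K" using \<open>x \<in> interior K\<close> interior_subset by auto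
  have fin: "(\<integral>\<^sup>+y. ennreal (exp (x \<bullet> y - supp K y)) \<partial>(lborel::'a measure)) < \<infinity>"
    using emeasure_polar_at_finite[OF \<open>x \<in> interior K\<close>] unfolding laplace_polar[OF \<open>x \<in> K\<close>] by (simp add: ennreal_mult_less_top)
  have le: "supp K y - x \<bullet> y \<le> R * norm y" for y
  proof -
    have "supp K y \<le> x \<bullet> y + R * norm y"
      unfolding supp_le_iff
    proof
      fix z assume "z \<in> K"
      have "y \<bullet> (z - x) \<le> norm y * norm (z - x)" by (rule norm_cauchy_schwarz)
      also have "\<dots> \<le> norm y * R" using R(2)[OF \<open>z \<in> K\<close>] by (intro mult_left_mono) auto
      finally show "y \<bullet> z \<le> x \<bullet> y + R * norm y" by (simp add: inner_diff_right inner_commute mult.commute)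
    qed
    thus ?thesis by simp
  qed
  have "(\<integral>\<^sup>+y. ennreal (exp (- (r * norm y))) \<partial>(lborel::'a measure)) = 
    ennreal ((R / r) ^ DIM('a)) * (\<integral>\<^sup>+y. ennreal (exp (- (r * norm ((R / r) *\<^sub>R y)))) \<partial>(lborel::'a measure))"
    by (rule nn_integral_lborel_scaleR) (use R assms in auto)
  moreover have "(\<integral>\<^sup>+y. ennreal (exp (- (r * norm ((R / r) *\<^sub>R y)))) \<partial>(lborel::'a measure)) \<le> (\<integral>\<^sup>+y. ennreal (exp (x \<bullet> y - supp K y)) \<partial>(lborel::'a measure))"
  proof (intro nn_integral_mono ennreal_leI, subst exp_le_cancel_iff)
    fix y :: 'a
    show "- (r * norm ((R / r) *\<^sub>R y)) \<le> x \<bullet> y - supp K y" using le[of y] R assms by simp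
  qed
  ultimately show "(\<integral>\<^sup>+y. ennreal (exp (- (r * norm y))) \<partial>(lborel::'a measure)) < \<infinity>"
    using fin by (auto simp: ennreal_mult_less_top intro: le_less_trans)
qed auto

lemma inner_minus_supp_le:
  assumes "cball x (2 * r) \<subseteq> K" "r \<ge> 0" "norm d \<le> r"
  shows "(x + d) \<bullet> y - supp K y \<le> - (r * norm y)"
proof -
  have "d \<bullet> y \<le> norm d * norm y" by (rule norm_cauchy_schwarz)
  also have "\<dots> \<le> r * norm y" using assms by (intro mult_right_mono) auto
  finally show ?thesis using supp_ge_norm[OF assms(1), of y] assms(2) by (simp add: inner_add_left)
qed

lemma integrable_subexponential:
  assumes "subexponential p" "r > 0"
  shows "integrable lborel (\<lambda>y::'a. p y * exp (- (r * norm y)))"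
proof -
  have "r / 2 > 0" using assms by simp
  then obtain C where C: "\<And>y. \<bar>p y\<bar> \<le> C * exp (r / 2 * norm y)" using assms(1) unfolding subexponential_def by meson
  have [measurable]: "p \<in> borel_measurable borel" using assms(1) by (simp add: subexponential_def)
  show ?thesis
  proof (rule Bochner_Integration.integrable_bound[OF integrable_mult_right[OF integrable_exp_norm[OF \<open>r / 2 > 0\<close>], of C]])
    show "AE y in lborel. norm (p y * exp (- (r * norm y))) \<le> norm (C * exp (- (r / 2 * norm y)))"
    proof (rule AE_I2)
      fix y :: 'a
      have "norm (p y * exp (- (r * norm y))) \<le> (C * exp (r / 2 * norm y)) * exp (- (r * norm y))"
        using C[of y] by (simp add: abs_mult)
      also have "\<dots> = C * exp (- (r / 2 * norm y))" by (simp add: mult.assoc exp_add[symmetric])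
      finally show "norm (p y * exp (- (r * norm y))) \<le> norm (C * exp (- (r / 2 * norm y)))" by simp
    qed
  qed measurable
qed

lemma integrable_laplace:
  assumes p: "subexponential p" and x: "x \<in> interior K"
  shows "integrable lborel (\<lambda>y. p y * exp (x \<bullet> y - supp K y))"
proof -
  obtain r where r: "r > 0" "cball x r \<subseteq> K" using x by (meson interior_subset mem_interior_cball)
  have [measurable]: "p \<in> borel_measurable borel" using p by (simp add: subexponential_def)
  show ?thesis
  proof (rule Bochner_Integration.integrable_bound[OF integrable_subexponential[OF p, of "r / 2"]])
    show "AE y in lborel. norm (p y * exp (x \<bullet> y - supp K y)) \<le> norm (p y * exp (- (r / 2 * norm y)))"
      using inner_minus_supp_le[of x "r / 2" 0] r by (intro AE_I2) (auto simp: abs_mult intro!: mult_left_mono)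
  qed (use r in auto)
qed

text \<open>The second-order remainder of the exponential is integrated directly, which gives an
  error of at most \<open>C * (norm d)\<^sup>2\<close> near \<open>x\<close> and avoids
  interchanging a limit with the integral.\<close>

lemma laplace_has_derivative:
  assumes p: "subexponential p" and x: "x \<in> interior K"
  shows "(laplace K p has_derivative (\<lambda>v. laplace K (\<lambda>y. p y * (y \<bullet> v)) x)) (at x)"
proof -
  obtain r' where r': "r' > 0" "cball x r' \<subseteq> interior K" using x by (meson open_contains_cball open_interior)
  \<comment> \<open>The kernel at \<open>x\<close> decays at rate \<open>2 * r\<close>: one half is
    spent on \<open>exp \<bar>d \<bullet> y\<bar>\<close> for \<open>norm d \<le> r\<close>, the
    other half keeps the majorant integrable.\<close>
  define r where "r = r' / 2"
  have r: "r > 0" "cball x (2 * r) \<subseteq> K" "cball x r \<subseteq> interior K" using r' interior_subset[of K] by (auto simp: r_def subset_iff)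
  have pv: "subexponential (\<lambda>y. p y * (y \<bullet> v))" for v by (intro subexponential_mult p subexponential_inner)
  let ?D = "\<lambda>v. laplace K (\<lambda>y. p y * (y \<bullet> v)) x"
  define C where "C = (\<integral>y. (\<bar>p y\<bar> * (norm y * norm y)) * exp (- (r * norm y)) \<partial>lborel)"
  have intC: "integrable lborel (\<lambda>y. (\<bar>p y\<bar> * (norm y * norm y)) * exp (- (r * norm y)))"
    by (intro integrable_subexponential subexponential_mult subexponential_abs p subexponential_norm r)
  have bound: "norm (laplace K p (x + d) - laplace K p x - ?D d) \<le> C * (norm d)\<^sup>2" if d: "norm d \<le> r" for d
  proof -
    have xd: "x + d \<in> interior K" using d r by (auto simp: dist_norm)
    let ?w = "\<lambda>y. exp (x \<bullet> y - supp K y)"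
    let ?R = "\<lambda>y. p y * exp ((x + d) \<bullet> y - supp K y) - p y * ?w y - p y * (y \<bullet> d) * ?w y"
    have i: "integrable lborel ?R"
      using integrable_laplace[OF p xd] integrable_laplace[OF p x] integrable_laplace[OF pv x] by simp
    have eq: "laplace K p (x + d) - laplace K p x - ?D d = (\<integral>y. ?R y \<partial>lborel)"
      unfolding laplace_def using integrable_laplace[OF p xd] integrable_laplace[OF p x] integrable_laplace[OF pv x] by simp
    have le: "norm (\<integral>y. ?R y \<partial>lborel) \<le> (\<integral>y. (norm d)\<^sup>2 * ((\<bar>p y\<bar> * (norm y * norm y)) * exp (- (r * norm y))) \<partial>lborel)"
    proof (rule Bochner_Integration.integral_norm_bound_integral[OF i])
      show "integrable lborel (\<lambda>y. (norm d)\<^sup>2 * ((\<bar>p y\<bar> * (norm y * norm y)) * exp (- (r * norm y))))"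
        using intC by simp
      fix y :: 'a
      have "(x + d) \<bullet> y - supp K y = (x \<bullet> y - supp K y) + d \<bullet> y" by (simp add: inner_add_left)
      hence e: "exp ((x + d) \<bullet> y - supp K y) = ?w y * exp (d \<bullet> y)" by (simp only: exp_add)
      have "?R y = p y * ?w y * (exp (d \<bullet> y) - 1 - d \<bullet> y)"
        unfolding e inner_commute[of y d] by (simp add: right_diff_distrib)
      hence e1: "norm (?R y) = \<bar>p y\<bar> * ?w y * \<bar>exp (d \<bullet> y) - 1 - d \<bullet> y\<bar>" by (simp add: abs_mult)
      have l1: "\<bar>p y\<bar> * ?w y * \<bar>exp (d \<bullet> y) - 1 - d \<bullet> y\<bar> \<le> \<bar>p y\<bar> * ?w y * ((d \<bullet> y)\<^sup>2 * exp \<bar>d \<bullet> y\<bar>)"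
        by (intro mult_left_mono exp_remainder) auto
      have l2: "\<bar>p y\<bar> * ?w y * ((d \<bullet> y)\<^sup>2 * exp \<bar>d \<bullet> y\<bar>) \<le> \<bar>p y\<bar> * ?w y * ((norm d * norm y)\<^sup>2 * exp (r * norm y))"
      proof (intro mult_left_mono mult_mono)
        have *: "\<bar>d \<bullet> y\<bar> \<le> norm d * norm y" by (rule Cauchy_Schwarz_ineq2)
        have "(d \<bullet> y)\<^sup>2 = \<bar>d \<bullet> y\<bar>\<^sup>2" by simp
        also have "\<dots> \<le> (norm d * norm y)\<^sup>2" using * by (intro power_mono) auto
        finally show "(d \<bullet> y)\<^sup>2 \<le> (norm d * norm y)\<^sup>2" .
        have "norm d * norm y \<le> r * norm y" using d by (intro mult_right_mono) auto
        thus "exp \<bar>d \<bullet> y\<bar> \<le> exp (r * norm y)" using * by simp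
      qed auto
      have e2: "\<bar>p y\<bar> * ?w y * ((norm d * norm y)\<^sup>2 * exp (r * norm y)) = (norm d)\<^sup>2 * (\<bar>p y\<bar> * (norm y * norm y) * (?w y * exp (r * norm y)))"
        by (simp add: power2_eq_square ac_simps)
      have l3: "(norm d)\<^sup>2 * (\<bar>p y\<bar> * (norm y * norm y) * (?w y * exp (r * norm y))) \<le> (norm d)\<^sup>2 * (\<bar>p y\<bar> * (norm y * norm y) * exp (- (r * norm y)))"
      proof (intro mult_left_mono)
        have "x \<bullet> y - supp K y + r * norm y \<le> - (r * norm y)"
          using supp_ge_norm[OF r(2), of y] r(1) by simp
        thus "?w y * exp (r * norm y) \<le> exp (- (r * norm y))" by (simp add: exp_add[symmetric])
      qed auto
      show "norm (?R y) \<le> (norm d)\<^sup>2 * (\<bar>p y\<bar> * (norm y * norm y) * exp (- (r * norm y)))"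
        by (rule ord_eq_le_trans[OF e1 order_trans[OF l1 order_trans[OF l2 ord_eq_le_trans[OF e2 l3]]]])
    qed
    have "(\<integral>y. (norm d)\<^sup>2 * ((\<bar>p y\<bar> * (norm y * norm y)) * exp (- (r * norm y))) \<partial>lborel) = C * (norm d)\<^sup>2"
      unfolding C_def using intC by simp
    thus ?thesis using le unfolding eq by (simp only:)
  qed
  have "linear ?D"
  proof (rule linearI)
    fix v w :: 'a and c :: real
    show "?D (v + w) = ?D v + ?D w"
      unfolding laplace_def using integrable_laplace[OF pv x]
      by (subst Bochner_Integration.integral_add[symmetric]) (auto simp: inner_add_right algebra_simps)
    show "?D (c *\<^sub>R v) = c *\<^sub>R ?D v"
      unfolding laplace_def by (simp add: integral_mult_right_zero[symmetric] ac_simps del: integral_mult_right_zero)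
  qed
  hence bl: "bounded_linear ?D" by (simp add: linear_conv_bounded_linear)
  have "((\<lambda>h. norm (laplace K p (x + h) - laplace K p x - ?D h) / norm h) \<longlongrightarrow> 0) (at 0)"
  proof (rule Lim_null_comparison)
    have "eventually (\<lambda>h. norm h < r) (at (0::'a))"
      using r(1) by (auto simp: eventually_at dist_norm intro!: exI[of _ r])
    thus "eventually (\<lambda>h. norm (norm (laplace K p (x + h) - laplace K p x - ?D h) / norm h) \<le> C * norm h) (at (0::'a))"
    proof eventually_elim
      case (elim h)
      thus ?case using bound[of h] by (cases "h = 0") (auto simp: divide_le_eq power2_eq_square mult.assoc)
    qed
    show "((\<lambda>h::'a. C * norm h) \<longlongrightarrow> 0) (at 0)" by (auto intro!: tendsto_eq_intros)
  qed
  with bl show ?thesis by (simp add: has_derivative_at)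
qed

lemma frechet_derivative_laplace:
  assumes "subexponential p" "x \<in> interior K"
  shows "frechet_derivative (laplace K p) (at x) v = laplace K (\<lambda>y. p y * (y \<bullet> v)) x"
  using frechet_derivative_at[OF laplace_has_derivative[OF assms], symmetric] by simp

text \<open>The weight stays arbitrary in the induction, since each directional derivative is the
  transform with \<open>p y * (y \<bullet> v)\<close> in place of \<open>p y\<close>.\<close>

lemma Ck_on_laplace: "subexponential p \<Longrightarrow> Ck_on k (interior K) (laplace K p)"
proof (induction k arbitrary: p)
  case 0
  have "continuous (at x) (laplace K p)" if "x \<in> interior K" for x
    using laplace_has_derivative[OF 0 that] has_derivative_continuous by blast
  then show ?case by (auto intro: continuous_at_imp_continuous_on)
next
  case (Suc k)
  have "Ck_on k (interior K) (\<lambda>x. frechet_derivative (laplace K p) (at x) v)" for v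
  proof -
    have "Ck_on k (interior K) (laplace K (\<lambda>y. p y * (y \<bullet> v)))"
      by (intro Suc.IH subexponential_mult Suc.prems subexponential_inner)
    moreover have "Ck_on k (interior K) (\<lambda>x. frechet_derivative (laplace K p) (at x) v) = Ck_on k (interior K) (laplace K (\<lambda>y. p y * (y \<bullet> v)))"
      by (rule Ck_on_cong) (auto simp: frechet_derivative_laplace Suc.prems)
    ultimately show ?thesis by simp
  qed
  moreover have "laplace K p differentiable (at x)" if "x \<in> interior K" for x
    using laplace_has_derivative[OF Suc.prems that] by (auto simp: differentiable_def)
  ultimately show ?case by simp
qed

text \<open>The integrands are strictly convex along the segment except where \<open>w\<close> is
  orthogonal to \<open>x - y\<close>, a null set.\<close>

lemma laplace_strict_convex:
  assumes x: "x \<in> interior K" "y \<in> interior K" "x \<noteq> y" and a: "0 < a" "a < 1"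
  shows "laplace K (\<lambda>_. 1) (a *\<^sub>R x + (1 - a) *\<^sub>R y) < a * laplace K (\<lambda>_. 1) x + (1 - a) * laplace K (\<lambda>_. 1) y"
proof -
  let ?m = "a *\<^sub>R x + (1 - a) *\<^sub>R y"
  have m: "?m \<in> interior K"
    using convexD[OF convex_interior[OF convex_body_basics(2)] x(1,2), of a "1 - a"] a by simp
  note int = integrable_laplace[OF subexponential_const, simplified]
  let ?D = "\<lambda>w. a * exp (x \<bullet> w - supp K w) + (1 - a) * exp (y \<bullet> w - supp K w) - exp (?m \<bullet> w - supp K w)"
  have eq: "?m \<bullet> w - supp K w = a * (x \<bullet> w - supp K w) + (1 - a) * (y \<bullet> w - supp K w)" for w
    by (simp add: inner_add_left algebra_simps)
  have pos: "?D w > 0" if "x \<bullet> w \<noteq> y \<bullet> w" for w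
    unfolding eq using exp_strict_convex[of "x \<bullet> w - supp K w" "y \<bullet> w - supp K w" a] that a by simp
  have zero: "?D w = 0" if "x \<bullet> w = y \<bullet> w" for w
    unfolding eq that by (simp add: algebra_simps)
  have "(\<integral>w. ?D w \<partial>lborel) > 0"
  proof (rule integral_lborel_pos)
    show "integrable lborel ?D" using int[OF x(1)] int[OF x(2)] int[OF m] by simp
    show "?D w \<ge> 0" for w using pos[of w] zero[of w] by (cases "x \<bullet> w = y \<bullet> w") auto
    have "x - y \<noteq> 0" using x by simp
    from AE_lborel_hyperplane[OF this, of 0] show "AE w in lborel. ?D w > 0"
    proof eventually_elim
      case (elim w)
      hence "x \<bullet> w \<noteq> y \<bullet> w" by (simp add: inner_diff_right inner_commute[of w])
      thus ?case by (rule pos)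
    qed
  qed
  also have "(\<integral>w. ?D w \<partial>lborel) = a * laplace K (\<lambda>_. 1) x + (1 - a) * laplace K (\<lambda>_. 1) y - laplace K (\<lambda>_. 1) ?m"
    unfolding laplace_def using int[OF x(1)] int[OF x(2)] int[OF m] by simp
  finally show ?thesis by simp
qed

lemma nn_integral_laplace:
  assumes "x \<in> interior K"
  shows "(\<integral>\<^sup>+y. ennreal (exp (x \<bullet> y - supp K y)) \<partial>lborel) = ennreal (laplace K (\<lambda>_. 1) x)"
  unfolding laplace_def using integrable_laplace[OF subexponential_const assms]
  by (subst nn_integral_eq_integral) auto

lemma laplace_pos:
  assumes "x \<in> interior K"
  shows "laplace K (\<lambda>_. 1) x > 0"
  unfolding laplace_def using integrable_laplace[OF subexponential_const assms]
  by (intro integral_lborel_pos) auto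

section \<open>Santalo regions as sublevel sets of the Laplace transform\<close>

text \<open>Turns the bound \<open>t\<close> on the normalised volume product into a bound on the
  Laplace transform, which exceeds the volume of the polar body by the factorial.\<close>

definition santalo_scale :: real where
  "santalo_scale = (measure lborel (cball (0::'a) 1))\<^sup>2 * fact DIM('a) / measure lborel K"

lemma measure_convex_body_pos: "measure lborel K > 0"
proof -
  obtain x r where r: "r > 0" "ball x r \<subseteq> K" using convex_body_basics(3) by (meson all_not_in_conv mem_interior)
  have "0 < measure lborel (ball x r)" using r by (simp add: content_ball_pos)
  also have "\<dots> \<le> measure lborel K"
    using r convex_body_basics emeasure_bounded_finite[OF convex_body_basics(6)] by (intro measure_mono_fmeasurable) (auto simp: fmeasurable_def borel_closed)
  finally show ?thesis .
qed

text \<open>Points outside the interior of \<open>K\<close> drop out because their polar bodies have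
  infinite volume. For \<open>t < 0\<close> the threshold \<open>ennreal t\<close> is 0, and
  positivity of the transform makes both conditions fail.\<close>

lemma santalo_region_eq: "santalo_region K t = {x \<in> interior K. laplace K (\<lambda>_. 1) x \<le> santalo_scale * t}"
proof -
  let ?V = "measure lborel (cball (0::'a) 1)" and ?k = "measure lborel K"
  have V: "vol (cball (0::'a) 1) = ennreal ?V" "?V > 0"
    using emeasure_bounded_finite[OF bounded_cball[of "0::'a" 1]] content_cball_pos[of 1 "0::'a"] by (auto simp: emeasure_eq_ennreal_measure less_top)
  have k: "vol K = ennreal ?k" "?k > 0"
    using emeasure_bounded_finite[OF convex_body_basics(6)] measure_convex_body_pos by (auto simp: emeasure_eq_ennreal_measure less_top)
  have inner: "vol K * vol (polar_at K x) / (vol (cball (0::'a) 1))\<^sup>2 \<le> ennreal t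
     \<longleftrightarrow> laplace K (\<lambda>_. 1) x \<le> santalo_scale * t" if x: "x \<in> interior K" for x
  proof -
    have "x \<in> K" using x interior_subset by auto
    obtain p where p: "vol (polar_at K x) = ennreal p" "p \<ge> 0"
      using emeasure_polar_at_finite[OF x] by (cases "vol (polar_at K x)") auto
    have "ennreal (laplace K (\<lambda>_. 1) x) = ennreal (fact DIM('a) * p)"
      using laplace_polar[OF \<open>x \<in> K\<close>] nn_integral_laplace[OF x] p by (simp add: ennreal_mult)
    hence L: "laplace K (\<lambda>_. 1) x = fact DIM('a) * p" using laplace_pos[OF x] p by simp
    hence p0: "p > 0" using laplace_pos[OF x] p(2) by (simp add: zero_less_mult_iff)
    have "vol K * vol (polar_at K x) / (vol (cball (0::'a) 1))\<^sup>2 = ennreal (?k * p / ?V\<^sup>2)"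
      unfolding V k p using V k p by (simp add: ennreal_mult[symmetric] ennreal_power divide_ennreal)
    moreover have "ennreal (?k * p / ?V\<^sup>2) \<le> ennreal t \<longleftrightarrow> ?k * p / ?V\<^sup>2 \<le> t"
    proof (cases "t \<ge> 0")
      case False
      have "?k * p / ?V\<^sup>2 > 0" using k p0 V by simp
      thus ?thesis using False by (simp add: ennreal_neg ennreal_eq_0_iff)
    qed (simp add: ennreal_le_iff)
    moreover have "?k * p / ?V\<^sup>2 \<le> t \<longleftrightarrow> laplace K (\<lambda>_. 1) x \<le> santalo_scale * t"
      unfolding L santalo_scale_def using k V by (simp add: field_simps)
    ultimately show ?thesis by simp
  qed
  have outer: "\<not> vol K * vol (polar_at K x) / (vol (cball (0::'a) 1))\<^sup>2 \<le> ennreal t"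
    if x: "x \<notin> interior K" for x
    unfolding emeasure_polar_at_infinite[OF K x] V k using k V 
    by (simp add: ennreal_mult_top ennreal_top_divide ennreal_power ennreal_eq_0_iff not_le top_unique)
  show ?thesis unfolding santalo_region_def using inner outer interior_subset[of K] by auto
qed

lemma closed_santalo_region: "closed (santalo_region K t)"
  unfolding closed_sequential_limits
proof (intro allI impI, elim conjE)
  fix X l assume X: "\<forall>n. X n \<in> santalo_region K t" "X \<longlonglongrightarrow> l"
  have Xi: "X n \<in> interior K" "laplace K (\<lambda>_. 1) (X n) \<le> santalo_scale * t" for n using X(1) by (auto simp: santalo_region_eq)
  have "X n \<in> K" for n using Xi(1)[of n] interior_subset by auto
  hence l: "l \<in> K" using X(2) convex_body_basics(5) closed_sequentially by blast
  have "(\<integral>\<^sup>+y. ennreal (exp (l \<bullet> y - supp K y)) \<partial>lborel) = (\<integral>\<^sup>+y. liminf (\<lambda>n. ennreal (exp (X n \<bullet> y - supp K y))) \<partial>lborel)"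
  proof (intro nn_integral_cong)
    fix y
    have "(\<lambda>n. ennreal (exp (X n \<bullet> y - supp K y))) \<longlonglongrightarrow> ennreal (exp (l \<bullet> y - supp K y))"
      by (intro tendsto_intros X(2) tendsto_ennrealI)
    thus "ennreal (exp (l \<bullet> y - supp K y)) = liminf (\<lambda>n. ennreal (exp (X n \<bullet> y - supp K y)))"
      by (metis lim_imp_Liminf trivial_limit_sequentially)
  qed
  also have "\<dots> \<le> liminf (\<lambda>n. (\<integral>\<^sup>+y. ennreal (exp (X n \<bullet> y - supp K y)) \<partial>lborel))"
    by (rule nn_integral_liminf) measurable
  also have "\<dots> \<le> ennreal (santalo_scale * t)"
  proof -
    have "(\<integral>\<^sup>+y. ennreal (exp (X n \<bullet> y - supp K y)) \<partial>lborel) \<le> ennreal (santalo_scale * t)" for n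
      unfolding nn_integral_laplace[OF Xi(1)] using Xi(2) by (rule ennreal_leI)
    hence "liminf (\<lambda>n. (\<integral>\<^sup>+y. ennreal (exp (X n \<bullet> y - supp K y)) \<partial>lborel)) \<le> liminf (\<lambda>n. ennreal (santalo_scale * t))"
      by (intro Liminf_mono always_eventually) auto
    thus ?thesis by (simp add: Liminf_const)
  qed
  finally have le: "(\<integral>\<^sup>+y. ennreal (exp (l \<bullet> y - supp K y)) \<partial>lborel) \<le> ennreal (santalo_scale * t)" .
  have li: "l \<in> interior K"
  proof (rule ccontr)
    assume "l \<notin> interior K"
    from emeasure_polar_at_infinite[OF K this] le show False
      unfolding laplace_polar[OF l] by (simp add: ennreal_mult_top top_unique)
  qed
  \<comment> \<open>The sign of the threshold is needed to read the inequality between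
    \<open>ennreal\<close> values back in the reals.\<close>
  have "santalo_scale * t > 0" using laplace_pos[OF Xi(1)[of 0]] Xi(2)[of 0] by linarith
  with le li show "l \<in> santalo_region K t"
    unfolding nn_integral_laplace[OF li] santalo_region_eq by (simp add: ennreal_le_iff)
qed

end

subsection \<open>Santalo regions\<close>

text \<open>The two preimages are an ellipsoid, namely the image of the ball under \<open>f\<close>,
  and its polar, because \<open>x \<bullet> y = g x \<bullet> adjoint f y\<close>. The ellipsoid is
  centred by symmetry, as \<open>exp s + exp (- s) \<ge> 2\<close>.\<close>

lemma emeasure_linear_adjoint_le:
  fixes f :: "'a::euclidean_space \<Rightarrow> 'a"
  assumes f: "linear f" "bij f" and g: "linear g" "\<And>x. f (g x) = x" 
  shows "vol (g -` cball 0 1) * vol (adjoint f -` cball 0 1) \<le> (vol (cball (0::'a) 1))\<^sup>2"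
proof (rule blaschke_santalo_centred)
  let ?B = "cball (0::'a) 1"
  have meas: "h -` ?B \<in> sets borel" if "linear h" for h :: "'a \<Rightarrow> 'a"
  proof -
    have "closed (h -` ?B)"
      using that by (intro continuous_closed_vimage linear_continuous_at) (auto simp: linear_conv_bounded_linear)
    thus ?thesis by simp
  qed
  show m[measurable]: "g -` ?B \<in> sets borel" "adjoint f -` ?B \<in> sets borel"
    using meas g(1) adjoint_linear[OF f(1)] by auto
  show "x \<bullet> y \<le> 1" if "x \<in> g -` ?B" "y \<in> adjoint f -` ?B" for x y
  proof -
    have "x \<bullet> y = g x \<bullet> adjoint f y" by (simp add: adjoint_works[OF f(1)] g(2))
    also have "\<dots> \<le> norm (g x) * norm (adjoint f y)" by (rule norm_cauchy_schwarz)
    also have "\<dots> \<le> 1 * 1" using that by (intro mult_mono) auto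
    finally show ?thesis by simp
  qed
  fix w :: 'a
  let ?L = "g -` ?B"
  have sym: "indicator ?L (0 - x) = (indicator ?L x :: ennreal)" for x
    using linear_neg[OF g(1), of x] by (simp add: indicator_def)
  have "(\<integral>\<^sup>+x. indicator ?L x * ennreal (exp (x \<bullet> w)) \<partial>lborel) = (\<integral>\<^sup>+x. indicator ?L (0 - x) * ennreal (exp ((0 - x) \<bullet> w)) \<partial>lborel)"
    by (rule nn_integral_lborel_reflect[symmetric]) measurable
  also have "\<dots> = (\<integral>\<^sup>+x. indicator ?L x * ennreal (exp (- (x \<bullet> w))) \<partial>lborel)"
    unfolding sym by simp
  finally have eq: "(\<integral>\<^sup>+x. indicator ?L x * ennreal (exp (x \<bullet> w)) \<partial>lborel) = (\<integral>\<^sup>+x. indicator ?L x * ennreal (exp (- (x \<bullet> w))) \<partial>lborel)" .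
  have "2 * vol ?L = (\<integral>\<^sup>+x. indicator ?L x * 2 \<partial>lborel)"
    by (subst nn_integral_multc) (auto simp: mult.commute)
  also have "\<dots> \<le> (\<integral>\<^sup>+x. indicator ?L x * (ennreal (exp (x \<bullet> w)) + ennreal (exp (- (x \<bullet> w)))) \<partial>lborel)"
  proof (intro nn_integral_mono mult_left_mono)
    fix x :: 'a
    have "2 \<le> exp (x \<bullet> w) + exp (- (x \<bullet> w))"
      using exp_ge_add_one_self[of "x \<bullet> w"] exp_ge_add_one_self[of "- (x \<bullet> w)"] by linarith
    thus "2 \<le> ennreal (exp (x \<bullet> w)) + ennreal (exp (- (x \<bullet> w)))"
      by (simp add: ennreal_plus[symmetric] ennreal_leI del: ennreal_plus flip: ennreal_numeral)
  qed simp
  also have "\<dots> = 2 * (\<integral>\<^sup>+x. indicator ?L x * ennreal (exp (x \<bullet> w)) \<partial>lborel)"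
    by (simp add: distrib_left nn_integral_add eq[symmetric] mult_2)
  finally have "ennreal (1/2) * (2 * vol ?L) \<le> ennreal (1/2) * (2 * (\<integral>\<^sup>+x. indicator ?L x * ennreal (exp (x \<bullet> w)) \<partial>lborel))"
    by (rule mult_left_mono) simp
  moreover have "ennreal (1/2) * (2 * X) = X" for X
  proof -
    have "ennreal (1/2) * 2 = ennreal (1/2) * ennreal 2" by simp
    also have "\<dots> = 1" by (subst ennreal_mult[symmetric]) auto
    finally show ?thesis by (simp add: mult.assoc[symmetric])
  qed
  ultimately show "vol ?L \<le> (\<integral>\<^sup>+x. indicator ?L x * ennreal (exp (x \<bullet> w)) \<partial>lborel)" by simp
qed

text \<open>Instead of comparing determinants, apply the Blaschke-Santalo inequality to an ellipsoid and its
  polar, once for \<open>f\<close> and once for its inverse.\<close>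

lemma emeasure_linear_adjoint:
  fixes f :: "'a::euclidean_space \<Rightarrow> 'a"
  assumes f: "linear f" "bij f" and A: "A \<in> sets borel" "B \<in> sets borel"
  shows "vol (f ` A) * vol (adjoint f -` B) = vol A * vol B"
proof -
  let ?B = "cball (0::'a) 1"
  define g where "g = inv f"
  have fg: "f (g x) = x" "g (f x) = x" for x using f(2) by (auto simp: g_def bij_def surj_f_inv_f)
  have g: "linear g" unfolding g_def using f by (metis bij_betw_def inj_linear_imp_inv_linear)
  have "bij g" using f(2) by (simp add: g_def bij_imp_bij_inv)
  have adj: "linear (adjoint f)" "linear (adjoint g)" using f g adjoint_linear by auto
  have adj_inv: "adjoint f (adjoint g x) = x" "adjoint g (adjoint f x) = x" for x
  proof -
    have "y \<bullet> adjoint f (adjoint g x) = y \<bullet> x" "y \<bullet> adjoint g (adjoint f x) = y \<bullet> x" for y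
      by (simp_all add: adjoint_works[OF f(1)] adjoint_works[OF g] fg)
    thus "adjoint f (adjoint g x) = x" "adjoint g (adjoint f x) = x" using vector_eq_rdot by (metis inner_commute)+
  qed
  have "bij (adjoint f)" "bij (adjoint g)" 
    by (rule o_bij[of "adjoint g"] o_bij[of "adjoint f"]; auto simp: adj_inv fun_eq_iff)+
  obtain a where a: "a > 0" "\<And>S. S \<in> sets borel \<Longrightarrow> vol (f -` S) = ennreal a * vol S"
    using linear_scales_lborel[OF f] by blast
  obtain b where b: "b > 0" "\<And>S. S \<in> sets borel \<Longrightarrow> vol (g -` S) = ennreal b * vol S"
    using linear_scales_lborel[OF g \<open>bij g\<close>] by blast
  obtain c where c: "c > 0" "\<And>S. S \<in> sets borel \<Longrightarrow> vol (adjoint f -` S) = ennreal c * vol S"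
    using linear_scales_lborel[OF adj(1) \<open>bij (adjoint f)\<close>] by blast
  obtain d where d: "d > 0" "\<And>S. S \<in> sets borel \<Longrightarrow> vol (adjoint g -` S) = ennreal d * vol S"
    using linear_scales_lborel[OF adj(2) \<open>bij (adjoint g)\<close>] by blast
  obtain v where v: "vol ?B = ennreal v" "v > 0" by (simp add: emeasure_cball unit_ball_vol_pos)
  have meas: "h -` ?B \<in> sets borel" if "linear h" for h :: "'a \<Rightarrow> 'a"
  proof -
    have "closed (h -` ?B)"
      using that by (intro continuous_closed_vimage linear_continuous_at) (auto simp: linear_conv_bounded_linear)
    thus ?thesis by simp
  qed
  have cancel: "x * y = 1" if "x > 0" "y > 0" "ennreal x * (ennreal y * ennreal v) = ennreal v" for x y
  proof -
    have "ennreal (x * y * v) = ennreal v" using that v by (simp add: ennreal_mult ac_simps)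
    thus ?thesis using that v by simp
  qed
  have ab: "a * b = 1"
  proof (rule cancel)
    have "f -` (g -` ?B) = ?B" by (auto simp: fg)
    thus "ennreal a * (ennreal b * ennreal v) = ennreal v" using a(2)[OF meas[OF g]] b(2)[of ?B] v by simp
  qed (use a b in auto)
  have cd: "c * d = 1"
  proof (rule cancel)
    have "adjoint f -` (adjoint g -` ?B) = ?B" by (auto simp: adj_inv)
    thus "ennreal c * (ennreal d * ennreal v) = ennreal v" using c(2)[OF meas[OF adj(2)]] d(2)[of ?B] v by simp
  qed (use c d in auto)
  have le: "x * y \<le> 1" if "x > 0" "y > 0" "ennreal x * ennreal v * (ennreal y * ennreal v) \<le> (ennreal v)\<^sup>2" for x y
  proof -
    have "ennreal x * ennreal v * (ennreal y * ennreal v) = ennreal (x * y * v\<^sup>2)"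
      using that v by (simp add: ennreal_mult power2_eq_square ac_simps)
    hence "ennreal (x * y * v\<^sup>2) \<le> ennreal (v\<^sup>2)" using that(3) v by (simp add: ennreal_power)
    hence "x * y * v\<^sup>2 \<le> 1 * v\<^sup>2" by (simp add: ennreal_le_iff)
    thus ?thesis using v by (simp add: mult_le_cancel_right)
  qed
  \<comment> \<open>Both \<open>b * c\<close> and \<open>a * d\<close> are at most 1 while their
    product is 1, so both equal 1.\<close>
  have "b * c \<le> 1" 
    by (rule le) (use emeasure_linear_adjoint_le[OF f g fg(1)] b c v in auto)
  moreover have "a * d \<le> 1"
    by (rule le) (use emeasure_linear_adjoint_le[OF g \<open>bij g\<close> f(1) fg(2)] a d v in auto)
  moreover have "(b * c) * (a * d) = 1" using ab cd by (metis mult.assoc mult.commute mult.left_neutral)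
  ultimately have bc: "b * c = 1"
    using a b c d by (metis antisym mult.right_neutral mult_le_cancel_left_pos mult_pos_pos)
  have "f ` A = g -` A" using fg by (auto simp: image_iff) (metis fg(1))+
  hence "vol (f ` A) * vol (adjoint f -` B) = (ennreal b * ennreal c) * (vol A * vol B)"
    using b(2)[OF A(1)] c(2)[OF A(2)] by (simp add: ac_simps)
  also have "ennreal b * ennreal c = 1" using bc b c by (simp add: ennreal_mult[symmetric])
  finally show ?thesis by simp
qed

lemma polar_at_affine_image:
  fixes f :: "'a::euclidean_space \<Rightarrow> 'a"
  assumes "linear f"
  shows "polar_at ((\<lambda>x. f x + b) ` K) (f x + b) = adjoint f -` polar_at K x"
  using linear_diff[OF assms] adjoint_works[OF assms]
  by (auto simp: polar_at_def inner_commute algebra_simps)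

text \<open>The volume product is the same at \<open>x\<close> and at its image: \<open>f\<close>
  multiplies the volume of \<open>K\<close> by the factor by which the adjoint divides that of the
  polar body. The translation by \<open>b\<close> is split off first.\<close>

lemma santalo_region_affine_image:
  fixes f :: "'a::euclidean_space \<Rightarrow> 'a"
  assumes f: "linear f" "bij f" and K: "convex_body K"
  shows "santalo_region ((\<lambda>x. f x + b) ` K) t = (\<lambda>x. f x + b) ` santalo_region K t"
proof -
  have [measurable]: "K \<in> sets borel" using K by (simp add: convex_body_def compact_imp_closed borel_closed)
  have fK: "f ` K \<in> sets borel" 
    using K f(1) by (intro borel_closed compact_imp_closed compact_continuous_image linear_continuous_on) (auto simp: convex_body_def linear_conv_bounded_linear)
  have "vol ((\<lambda>x. f x + b) ` K) = (\<integral>\<^sup>+x. indicator ((+) b ` f ` K) x \<partial>lborel)"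
  proof -
    have "(\<lambda>x. f x + b) ` K = (+) b ` f ` K" by (auto simp: image_image add.commute)
    moreover have "(+) b ` f ` K \<in> sets borel"
      using K f(1) by (intro borel_closed compact_imp_closed compact_continuous_image linear_continuous_on continuous_intros) (auto simp: convex_body_def linear_conv_bounded_linear)
    ultimately show ?thesis by simp
  qed
  also have "\<dots> = (\<integral>\<^sup>+x. indicator ((+) b ` f ` K) (b + x) \<partial>lborel)"
  proof (rule nn_integral_lborel_plus[symmetric])
    have "(+) b ` f ` K \<in> sets borel"
      using K f(1) by (intro borel_closed compact_imp_closed compact_continuous_image linear_continuous_on continuous_intros) (auto simp: convex_body_def linear_conv_bounded_linear)
    thus "indicator ((+) b ` f ` K) \<in> borel_measurable borel" by simp
  qed
  also have "\<dots> = (\<integral>\<^sup>+x. indicator (f ` K) x \<partial>lborel)" by (intro nn_integral_cong) (auto simp: indicator_def)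
  finally have eK: "vol ((\<lambda>x. f x + b) ` K) = vol (f ` K)" using fK by simp
  have prod: "vol ((\<lambda>x. f x + b) ` K) * vol (polar_at ((\<lambda>x. f x + b) ` K) (f x + b)) = 
    vol K * vol (polar_at K x)" for x
    unfolding eK polar_at_affine_image[OF f(1)] by (rule emeasure_linear_adjoint[OF f]) auto
  show ?thesis unfolding santalo_region_def by (auto simp: prod)
qed

section \<open>Smooth functions and the one-point submanifold\<close>

lemma Ck_on_diff_const:
  assumes U: "open U"
  shows "Ck_on k U f \<Longrightarrow> Ck_on k U (\<lambda>x. f x - c)"
proof (cases k)
  case 0
  assume "Ck_on k U f"
  thus ?thesis using 0 by (simp add: continuous_on_diff)
next
  case (Suc j)
  assume f: "Ck_on k U f"
  have d: "((\<lambda>x. f x - c) has_derivative frechet_derivative f (at x)) (at x)" if "x \<in> U" for x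
    using f that Suc frechet_derivative_works[of f "at x"] by (auto intro!: derivative_eq_intros)
  have "Ck_on j U (\<lambda>x. frechet_derivative (\<lambda>x. f x - c) (at x) v) = Ck_on j U (\<lambda>x. frechet_derivative f (at x) v)" for v
    by (rule Ck_on_cong[OF U]) (simp add: frechet_derivative_at[OF d, symmetric])
  thus ?thesis using f Suc d by (auto simp: differentiable_def)
qed

lemma Ck_on_const: "Ck_on k U (\<lambda>_. c)"
  by (induction k arbitrary: c) (auto simp: frechet_derivative_const)

lemma has_derivative_inner_affine: "((\<lambda>x. (x - x0) \<bullet> e) has_derivative (\<lambda>v. v \<bullet> e)) (at x)"
  by (auto intro!: derivative_eq_intros)

lemma Ck_on_inner_affine: "Ck_on k U (\<lambda>x. (x - x0) \<bullet> e)"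
proof (cases k)
  case (Suc j)
  have "frechet_derivative (\<lambda>x. (x - x0) \<bullet> e) (at x) = (\<lambda>v. v \<bullet> e)" for x
    using frechet_derivative_at[OF has_derivative_inner_affine] by metis
  thus ?thesis using Suc has_derivative_inner_affine[of x0 e] by (auto simp: Ck_on_const differentiable_def)
qed (auto intro!: continuous_intros)

text \<open>The defining functions are the coordinates of \<open>x - x0\<close>; evaluating a linear
  relation between their differentials at the basis vectors shows independence. This covers a
  Santalo region that has shrunk to a point.\<close>

lemma Cinf_submanifold_point: "Cinf_submanifold DIM('a) {x0 :: 'a::euclidean_space}"
proof -
  obtain e where e: "bij_betw e {..<DIM('a)} (Basis :: 'a set)"
    using ex_bij_betw_nat_finite[OF finite_Basis[where ?'a = 'a]] by (auto simp: atLeast0LessThan)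
  have eB: "e i \<in> Basis" if "i < DIM('a)" for i using e that by (auto simp: bij_betw_def)
  have der: "frechet_derivative (\<lambda>x. (x - x0) \<bullet> e i) (at x) v = v \<bullet> e i" for i x v
    using frechet_derivative_at[OF has_derivative_inner_affine] by metis
  have zero: "x = x0" if x: "\<forall>i<DIM('a). (x - x0) \<bullet> e i = 0" for x
  proof (rule euclidean_eqI)
    fix b :: 'a assume "b \<in> Basis"
    then obtain i where "i < DIM('a)" "b = e i" using e by (auto simp: bij_betw_def image_iff)
    thus "x \<bullet> b = x0 \<bullet> b" using x by (simp add: inner_diff_left)
  qed
  show ?thesis
    unfolding Cinf_submanifold_def
  proof (intro ballI exI[of _ UNIV] exI[of _ "\<lambda>i x. (x - x0) \<bullet> e i"] conjI allI impI)
    fix b :: "nat \<Rightarrow> real" and p :: 'a and j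
    assume b: "\<forall>v. (\<Sum>i<DIM('a). b i * frechet_derivative (\<lambda>x. (x - x0) \<bullet> e i) (at p) v) = 0" and j: "j < DIM('a)"
    have "(\<Sum>i<DIM('a). b i * (e j \<bullet> e i)) = 0" using b by (simp add: der)
    also have "(\<Sum>i<DIM('a). b i * (e j \<bullet> e i)) = (\<Sum>i<DIM('a). if i = j then b i else 0)"
    proof (rule sum.cong)
      fix i assume "i \<in> {..<DIM('a)}"
      hence "e j = e i \<longleftrightarrow> i = j" using e j by (auto simp: bij_betw_def inj_on_def)
      thus "b i * (e j \<bullet> e i) = (if i = j then b i else 0)" using eB[of i] eB[of j] j \<open>i \<in> _\<close> by (auto simp: inner_Basis)
    qed simp
    finally show "b j = 0" using j by simp
  qed (auto simp: Cinf_on_def Ck_on_inner_affine intro: zero)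
qed

section \<open>Convexity and boundary of a Santalo region\<close>

context
  fixes K :: "'a::euclidean_space set"
  assumes K: "convex_body K"
begin

abbreviation (input) "\<Phi> \<equiv> laplace K (\<lambda>_. 1)"

lemma laplace_convex:
  assumes "x \<in> interior K" "y \<in> interior K" "0 \<le> a" "a \<le> 1"
  shows "\<Phi> (a *\<^sub>R x + (1 - a) *\<^sub>R y) \<le> a * \<Phi> x + (1 - a) * \<Phi> y"
proof -
  consider "x = y" | "a = 0" | "a = 1" | "x \<noteq> y" "0 < a" "a < 1" using assms by fastforce
  thus ?thesis
  proof cases
    case 1
    have "a *\<^sub>R y + (1 - a) *\<^sub>R y = y" by (simp add: scaleR_add_left[symmetric])
    moreover have "a * \<Phi> y + (1 - a) * \<Phi> y = \<Phi> y" by (simp add: algebra_simps)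
    ultimately show ?thesis using 1 by simp
  next
    case 4
    thus ?thesis using laplace_strict_convex[OF K assms(1,2) 4] by simp
  qed auto
qed

lemma interior_convex_combination:
  assumes "x \<in> interior K" "y \<in> interior K" "0 \<le> a" "a \<le> 1"
  shows "a *\<^sub>R x + (1 - a) *\<^sub>R y \<in> interior K"
  using convexD[OF convex_interior[OF convex_body_basics(2)[OF K]] assms(1,2), of a "1 - a"] assms by simp

lemma santalo_region_concave:
  assumes "x \<in> santalo_region K t" "y \<in> santalo_region K s" "0 \<le> a" "a \<le> 1"
  shows "a *\<^sub>R x + (1 - a) *\<^sub>R y \<in> santalo_region K (a * t + (1 - a) * s)"
proof -
  let ?k = "santalo_scale K"
  have x: "x \<in> interior K" "\<Phi> x \<le> ?k * t" and y: "y \<in> interior K" "\<Phi> y \<le> ?k * s"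
    using assms(1,2) by (auto simp: santalo_region_eq[OF K])
  have "\<Phi> (a *\<^sub>R x + (1 - a) *\<^sub>R y) \<le> a * \<Phi> x + (1 - a) * \<Phi> y" by (rule laplace_convex[OF x(1) y(1) assms(3,4)])
  also have "\<dots> \<le> a * (?k * t) + (1 - a) * (?k * s)" using x y assms by (intro add_mono mult_left_mono) auto
  also have "\<dots> = ?k * (a * t + (1 - a) * s)" by (simp add: algebra_simps)
  finally show ?thesis using interior_convex_combination[OF x(1) y(1) assms(3,4)] by (simp add: santalo_region_eq[OF K])
qed

lemma convex_santalo_region: "convex (santalo_region K t)"
proof (rule convexI)
  fix x y u v assume "x \<in> santalo_region K t" "y \<in> santalo_region K t" and uv: "0 \<le> u" "0 \<le> v" "u + v = (1::real)"
  moreover have "v = 1 - u" using uv by simp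
  moreover have "u * t + (1 - u) * t = t" by (simp add: algebra_simps)
  ultimately show "u *\<^sub>R x + v *\<^sub>R y \<in> santalo_region K t"
    using santalo_region_concave[of x t y t u] by simp
qed

lemma continuous_on_laplace: "continuous_on (interior K) \<Phi>"
  using Ck_on_laplace[OF K subexponential_const, of 0] by simp

lemma interior_santalo_region:
  assumes "x \<in> interior K" "\<Phi> x < santalo_scale K * t"
  shows "x \<in> interior (santalo_region K t)"
proof -
  have "open {x \<in> interior K. \<Phi> x < santalo_scale K * t}"
  proof -
    have "open (interior K \<inter> \<Phi> -` {..<santalo_scale K * t})"
      by (rule continuous_open_preimage[OF continuous_on_laplace]) auto
    moreover have "interior K \<inter> \<Phi> -` {..<santalo_scale K * t} = {x \<in> interior K. \<Phi> x < santalo_scale K * t}" by auto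
    ultimately show ?thesis by simp
  qed
  moreover have "{x \<in> interior K. \<Phi> x < santalo_scale K * t} \<subseteq> santalo_region K t"
    by (auto simp: santalo_region_eq[OF K])
  ultimately show ?thesis using assms by (intro interiorI) auto
qed

lemma strictly_convex_santalo_region: "strictly_convex (santalo_region K t)"
  unfolding strictly_convex_def
proof (intro conjI ballI impI subsetI)
  show "convex (santalo_region K t)" by (rule convex_santalo_region)
  fix x y z assume xy: "x \<in> santalo_region K t" "y \<in> santalo_region K t" "x \<noteq> y" and "z \<in> open_segment x y"
  then obtain u where u: "0 < u" "u < 1" "z = (1 - u) *\<^sub>R x + u *\<^sub>R y" by (auto simp: in_segment)
  have x: "x \<in> interior K" "\<Phi> x \<le> santalo_scale K * t" and y: "y \<in> interior K" "\<Phi> y \<le> santalo_scale K * t"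
    using xy by (auto simp: santalo_region_eq[OF K])
  have "\<Phi> z < (1 - u) * \<Phi> x + u * \<Phi> y"
    using laplace_strict_convex[OF K x(1) y(1) xy(3), of "1 - u"] u by simp
  also have "\<dots> \<le> (1 - u) * (santalo_scale K * t) + u * (santalo_scale K * t)"
    using x y u by (intro add_mono mult_left_mono) auto
  also have "\<dots> = santalo_scale K * t" by (simp add: algebra_simps)
  finally show "z \<in> interior (santalo_region K t)"
    using interior_convex_combination[OF x(1) y(1), of "1 - u"] u by (intro interior_santalo_region) auto
qed

text \<open>Integrates \<open>1 + y \<bullet> (z - x) \<le> exp (y \<bullet> (z - x))\<close>
  against the kernel at \<open>x\<close>. It makes every critical point a minimum over the interior
  of \<open>K\<close>.\<close>

lemma laplace_above_tangent:
  assumes x: "x \<in> interior K" "z \<in> interior K"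
  shows "\<Phi> x + frechet_derivative \<Phi> (at x) (z - x) \<le> \<Phi> z"
proof -
  note int = integrable_laplace[OF K subexponential_const, simplified]
  have i2: "integrable lborel (\<lambda>y. (y \<bullet> (z - x)) * exp (x \<bullet> y - supp K y))"
    by (rule integrable_laplace[OF K subexponential_inner x(1)])
  have "\<Phi> x + frechet_derivative \<Phi> (at x) (z - x) = (\<integral>y. exp (x \<bullet> y - supp K y) + (y \<bullet> (z - x)) * exp (x \<bullet> y - supp K y) \<partial>lborel)"
    unfolding frechet_derivative_laplace[OF K subexponential_const x(1)] unfolding laplace_def using int[OF x(1)] i2 by simp
  also have "\<dots> \<le> \<Phi> z"
    unfolding laplace_def
  proof (rule integral_mono)
    show "integrable lborel (\<lambda>y. exp (x \<bullet> y - supp K y) + (y \<bullet> (z - x)) * exp (x \<bullet> y - supp K y))" using int[OF x(1)] i2 by simp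
    show "integrable lborel (\<lambda>y. 1 * exp (z \<bullet> y - supp K y))" using int[OF x(2)] by simp
    fix y :: 'a
    have "exp (x \<bullet> y - supp K y) * (1 + y \<bullet> (z - x)) \<le> exp (x \<bullet> y - supp K y) * exp (y \<bullet> (z - x))"
      by (intro mult_left_mono exp_ge_add_one_self) auto
    also have "\<dots> = exp (z \<bullet> y - supp K y)" by (simp add: exp_add[symmetric] inner_diff_right inner_commute[of y])
    finally show "exp (x \<bullet> y - supp K y) + (y \<bullet> (z - x)) * exp (x \<bullet> y - supp K y) \<le> 1 * exp (z \<bullet> y - supp K y)" 
      by (simp add: algebra_simps)
  qed
  finally show ?thesis .
qed

text \<open>Points below the threshold are interior by continuity. A point at the threshold is not:
  it would be the midpoint of two others of the region, and strict convexity would put its value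
  below the threshold.\<close>

lemma frontier_santalo_region:
  assumes "interior (santalo_region K t) \<noteq> {}"
  shows "frontier (santalo_region K t) = {x \<in> interior K. \<Phi> x - santalo_scale K * t = 0}"
proof (intro set_eqI iffI)
  fix x assume x: "x \<in> frontier (santalo_region K t)"
  have "x \<in> santalo_region K t" "x \<notin> interior (santalo_region K t)"
    using x closed_santalo_region[OF K] by (auto simp: frontier_def closure_closed)
  thus "x \<in> {x \<in> interior K. \<Phi> x - santalo_scale K * t = 0}"
    using interior_santalo_region[of x t] by (force simp: santalo_region_eq[OF K])
next
  fix x assume x: "x \<in> {x \<in> interior K. \<Phi> x - santalo_scale K * t = 0}"
  hence xS: "x \<in> santalo_region K t" by (auto simp: santalo_region_eq[OF K])
  have "x \<notin> interior (santalo_region K t)"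
  proof
    assume "x \<in> interior (santalo_region K t)"
    then obtain r where r: "r > 0" "cball x r \<subseteq> santalo_region K t" by (meson mem_interior_cball)
    obtain e :: 'a where e: "norm e = r" using vector_choose_size[of r] r by (metis less_imp_le)
    have ne: "x + e \<noteq> x - e" 
    proof
      assume "x + e = x - e"
      hence "2 *\<^sub>R e = 0" by (simp add: scaleR_2 algebra_simps)
      thus False using e r by simp
    qed
    have mem: "x + e \<in> santalo_region K t" "x - e \<in> santalo_region K t" using r e by (auto simp: subset_iff dist_norm)
    have "(1/2) *\<^sub>R (x + e) + (1 - 1/2) *\<^sub>R (x - e) = x"
      by (simp add: scaleR_add_right scaleR_diff_right scaleR_add_left[symmetric])
    hence "\<Phi> x < 1/2 * \<Phi> (x + e) + (1 - 1/2) * \<Phi> (x - e)"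
      using laplace_strict_convex[OF K _ _ ne, of "1/2"] mem by (simp add: santalo_region_eq[OF K])
    also have "\<dots> \<le> santalo_scale K * t" using mem by (simp add: santalo_region_eq[OF K])
    finally show False using x by simp
  qed
  thus "x \<in> frontier (santalo_region K t)" using xS closed_santalo_region[OF K] by (auto simp: frontier_def closure_closed)
qed

text \<open>Strict convexity leaves a single point when there is no interior. Otherwise the
  transform minus the threshold is a defining function: a critical boundary point would minimise the
  transform, although its midpoint with any second point of the region has a smaller value.\<close>

lemma Cinf_boundary_santalo_region:
  assumes "santalo_region K t \<noteq> {}"
  shows "Cinf_boundary (santalo_region K t)"
proof (cases "interior (santalo_region K t) = {}")
  case True
  obtain x0 where x0: "x0 \<in> santalo_region K t" using assms by auto
  have "x = x0" if "x \<in> santalo_region K t" for x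
  proof (rule ccontr)
    assume "x \<noteq> x0"
    hence "open_segment x x0 \<subseteq> interior (santalo_region K t)" "open_segment x x0 \<noteq> {}"
      using strictly_convex_santalo_region[of t] that x0 by (auto simp: strictly_convex_def)
    thus False using True by auto
  qed
  hence "santalo_region K t = {x0}" using x0 by blast
  thus ?thesis unfolding Cinf_boundary_def using Cinf_submanifold_point[of x0] by (intro exI[of _ "DIM('a)"]) (auto simp: frontier_def)
next
  case False
  let ?f = "\<lambda>x. \<Phi> x - santalo_scale K * t"
  have der: "frechet_derivative ?f (at p) = frechet_derivative \<Phi> (at p)" if "p \<in> interior K" for p
  proof -
    have "(\<Phi> has_derivative frechet_derivative \<Phi> (at p)) (at p)"
      using laplace_has_derivative[OF K subexponential_const that] frechet_derivative_works differentiable_def by blast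
    hence "(?f has_derivative frechet_derivative \<Phi> (at p)) (at p)" by (auto intro!: derivative_eq_intros)
    thus ?thesis using frechet_derivative_at by metis
  qed
  have "Cinf_submanifold 1 (frontier (santalo_region K t))"
    unfolding Cinf_submanifold_def
  proof (intro ballI exI[of _ "interior K"] exI[of _ "\<lambda>_. ?f"] conjI allI impI)
    fix p assume "p \<in> frontier (santalo_region K t)"
    hence p: "p \<in> interior K" "\<Phi> p = santalo_scale K * t" by (auto simp: frontier_santalo_region[OF False])
    show "p \<in> interior K" by (rule p)
    show "Cinf_on (interior K) ?f"
      unfolding Cinf_on_def using Ck_on_laplace[OF K subexponential_const] by (auto intro: Ck_on_diff_const)
    show "frontier (santalo_region K t) \<inter> interior K = {x \<in> interior K. \<forall>i<1::nat. \<Phi> x - santalo_scale K * t = 0}"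
      by (auto simp: frontier_santalo_region[OF False])
    fix b :: "nat \<Rightarrow> real" and i :: nat
    assume b: "\<forall>v. (\<Sum>i<1. b i * frechet_derivative ?f (at p) v) = 0" and i: "i < 1"
    have "b 0 = 0"
    proof (rule ccontr)
      assume "b 0 \<noteq> 0"
      hence D0: "frechet_derivative \<Phi> (at p) v = 0" for v using b by (simp add: der[OF p(1)])
      obtain q where q: "q \<in> santalo_region K t" "q \<noteq> p"
      proof -
        obtain c r where "r > 0" "cball c r \<subseteq> santalo_region K t" using False by (meson all_not_in_conv mem_interior_cball)
        moreover obtain e :: 'a where "norm e = r" using vector_choose_size[of r] \<open>r > 0\<close> by (metis less_imp_le)
        ultimately have "c \<in> santalo_region K t" "c + e \<in> santalo_region K t" "c + e \<noteq> c" by (auto simp: subset_iff dist_norm)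
        thus ?thesis using that by metis
      qed
      have qi: "q \<in> interior K" "\<Phi> q \<le> \<Phi> p" using q p by (auto simp: santalo_region_eq[OF K])
      define m where "m = (1/2) *\<^sub>R q + (1 - 1/2) *\<^sub>R p"
      have "m \<in> interior K" unfolding m_def by (rule interior_convex_combination[OF qi(1) p(1)]) auto
      have "\<Phi> m < 1/2 * \<Phi> q + (1 - 1/2) * \<Phi> p"
        unfolding m_def by (rule laplace_strict_convex[OF K qi(1) p(1) q(2)]) auto
      also have "\<dots> \<le> \<Phi> p" using qi by simp
      finally show False using laplace_above_tangent[OF p(1) \<open>m \<in> interior K\<close>] D0 by simp
    qed
    thus "b i = 0" using i by simp
  qed auto
  thus ?thesis unfolding Cinf_boundary_def by blast
qed

section \<open>Cut levels and the floating body\<close>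

lemma measure_halfspaces:
  assumes u: "u \<noteq> 0"
  shows "measure lborel {x \<in> K. x \<bullet> u \<ge> c} + measure lborel {x \<in> K. x \<bullet> u \<le> c} = measure lborel K"
    and "measure lborel {x \<in> K. x \<bullet> u < c} = measure lborel {x \<in> K. x \<bullet> u \<le> c}"
proof -
  note K' = convex_body_basics[OF K]
  have [measurable]: "K \<in> sets borel" using K'(5) by (rule borel_closed)
  have fin: "vol A \<noteq> \<infinity>" if "A \<subseteq> K" for A
    using emeasure_bounded_finite[OF bounded_subset[OF K'(6) that]] by simp
  have eq: "measure lborel {x \<in> K. x \<bullet> u < c} = measure lborel {x \<in> K. x \<bullet> u \<le> c}"
    using AE_lborel_hyperplane[OF u, of c] by (intro measure_eq_AE) auto
  have "measure lborel K = measure lborel ({x \<in> K. x \<bullet> u \<ge> c} \<union> {x \<in> K. x \<bullet> u < c})" by (intro arg_cong[where f = "measure lborel"]) auto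
  also have "\<dots> = measure lborel {x \<in> K. x \<bullet> u \<ge> c} + measure lborel {x \<in> K. x \<bullet> u < c}"
    by (intro measure_Union fin) auto
  finally show "measure lborel {x \<in> K. x \<bullet> u \<ge> c} + measure lborel {x \<in> K. x \<bullet> u \<le> c} = measure lborel K" using eq by simp
  show "measure lborel {x \<in> K. x \<bullet> u < c} = measure lborel {x \<in> K. x \<bullet> u \<le> c}" by (rule eq)
qed

text \<open>The frontier of a convex set is negligible, so a part of positive volume cannot lie
  within it.\<close>

lemma interior_point_of_positive_part:
  assumes "A \<subseteq> K" "A \<in> sets borel" "measure lborel A > 0"
  shows "\<exists>p\<in>A. p \<in> interior K"
proof (rule ccontr)
  assume "\<not> ?thesis"
  hence "A \<subseteq> frontier K" using assms(1) closure_subset by (auto simp: frontier_def)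
  moreover have "negligible (frontier K)" by (rule negligible_convex_frontier[OF convex_body_basics(2)[OF K]])
  ultimately have "negligible A" using negligible_subset by blast
  hence "measure lebesgue A = 0" by (rule negligible_imp_measure0)
  thus False using assms by (simp add: measure_completion)
qed

text \<open>Existence is the quantile lemma for the complementary volume. For uniqueness, the bounds
  on \<open>d\<close> give interior points of \<open>K\<close> on both sides of the slab between two
  levels; the segment joining them crosses it at interior points, so the slab has positive volume.
  This justifies the description in \<open>cut_level\<close>.\<close>

lemma ex1_cut_level:
  assumes u: "u \<noteq> 0" and d: "0 < d" "d < measure lborel K"
  shows "\<exists>!a. measure lborel {x \<in> K. x \<bullet> u \<ge> a} = d"
proof -
  note K' = convex_body_basics[OF K]
  have [measurable]: "K \<in> sets borel" using K'(5) by (rule borel_closed)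
  have fm: "A \<in> fmeasurable lborel" if "A \<in> sets borel" "A \<subseteq> K" for A
    using that emeasure_bounded_finite[OF bounded_subset[OF K'(6) that(2)]] by (simp add: fmeasurable_def)
  have fin: "vol A \<noteq> \<infinity>" if "A \<subseteq> K" for A
    using emeasure_bounded_finite[OF bounded_subset[OF K'(6) that]] by simp
  have "integrable lborel (indicator K :: 'a \<Rightarrow> real)"
    using emeasure_bounded_finite[OF K'(6)] by simp
  then obtain a where "(\<integral>x. indicator K x * indicator {..a} (x \<bullet> u) \<partial>lborel) = measure lborel K - d"
    using quantile_exists[of "indicator K" lborel "\<lambda>x. x \<bullet> u" "measure lborel K - d"] d AE_lborel_hyperplane[OF u] by auto
  moreover have "(\<integral>x. indicator K x * indicator {..a} (x \<bullet> u) \<partial>lborel) = (\<integral>x. (indicator {x \<in> K. x \<bullet> u \<le> a} x :: real) \<partial>lborel)"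
    by (intro Bochner_Integration.integral_cong) (auto simp: indicator_def)
  ultimately have "measure lborel {x \<in> K. x \<bullet> u \<le> a} = measure lborel K - d" by simp
  with measure_halfspaces(1)[OF u, of a] have a: "measure lborel {x \<in> K. x \<bullet> u \<ge> a} = d" by simp
  have less: False if ab: "a < b" and a: "measure lborel {x \<in> K. x \<bullet> u \<ge> a} = d" and b: "measure lborel {x \<in> K. x \<bullet> u \<ge> b} = d" for a b
  proof -
    have "measure lborel {x \<in> K. x \<bullet> u < a} > 0"
      using measure_halfspaces[OF u, of a] a d by simp
    then obtain q where q: "q \<in> interior K" "q \<bullet> u < a" using interior_point_of_positive_part[of "{x \<in> K. x \<bullet> u < a}"] by auto
    obtain p where p: "p \<in> interior K" "p \<bullet> u \<ge> b" using interior_point_of_positive_part[of "{x \<in> K. x \<bullet> u \<ge> b}"] b d by auto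
    define c where "c = (a + b) / 2"
    \<comment> \<open>The weight at which the segment from \<open>q\<close> to \<open>p\<close>
      reaches the middle level \<open>c\<close> of the slab.\<close>
    define l where "l = (c - q \<bullet> u) / (p \<bullet> u - q \<bullet> u)"
    have pq: "p \<bullet> u - q \<bullet> u > 0" using p q ab by simp
    have l: "0 \<le> l" "l \<le> 1" using pq p q ab by (auto simp: l_def c_def field_simps)
    have "l * (p \<bullet> u - q \<bullet> u) = c - q \<bullet> u" using pq by (simp add: l_def)
    hence "(l *\<^sub>R p + (1 - l) *\<^sub>R q) \<bullet> u = c" by (simp add: inner_add_left algebra_simps)
    moreover have "l *\<^sub>R p + (1 - l) *\<^sub>R q \<in> interior K" by (rule interior_convex_combination[OF p(1) q(1) l])
    ultimately have ne: "interior K \<inter> {x. a < x \<bullet> u \<and> x \<bullet> u < b} \<noteq> {}" using ab by (auto simp: c_def)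
    have op: "open (interior K \<inter> {x. a < x \<bullet> u \<and> x \<bullet> u < b})"
      by (intro open_Int open_interior open_Collect_conj open_Collect_less continuous_intros)
    let ?D = "{x \<in> K. a \<le> x \<bullet> u \<and> x \<bullet> u < b}"
    have "{x \<in> K. x \<bullet> u \<ge> a} = {x \<in> K. x \<bullet> u \<ge> b} \<union> ?D" using ab by auto
    hence "measure lborel {x \<in> K. x \<bullet> u \<ge> a} = measure lborel {x \<in> K. x \<bullet> u \<ge> b} + measure lborel ?D"
      by (simp, intro measure_Union fin) auto
    hence D0: "measure lborel ?D = 0" using a b by simp
    obtain w r where r: "r > 0" "ball w r \<subseteq> interior K \<inter> {x. a < x \<bullet> u \<and> x \<bullet> u < b}"
      using ne op by (meson all_not_in_conv open_contains_ball)
    have "0 < measure lborel (ball w r)" using r by (simp add: content_ball_pos)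
    also have "\<dots> \<le> measure lborel ?D"
      using r interior_subset[of K] by (intro measure_mono_fmeasurable fm) (auto simp: subset_iff)
    finally show False using D0 by simp
  qed
  show ?thesis
  proof (rule ex1I[of _ a])
    show "measure lborel {x \<in> K. x \<bullet> u \<ge> a} = d" by (rule a)
    fix b assume "measure lborel {x \<in> K. x \<bullet> u \<ge> b} = d"
    thus "b = a" using less[of a b] less[of b a] a by (metis linorder_neqE)
  qed
qed

lemma measure_cut_level:
  assumes "u \<noteq> 0" "0 < d" "d < measure lborel K"
  shows "measure lborel {x \<in> K. x \<bullet> u \<ge> cut_level K d u} = d"
  unfolding cut_level_def by (rule theI'[OF ex1_cut_level[OF assms]])

text \<open>As \<open>x\<close> lies at or below the cut level in direction \<open>u\<close>, the
  half-space through \<open>x\<close> contains the cap of volume \<open>d\<close>.\<close>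

lemma floating_body_halfspace:
  assumes x: "x \<in> floating_body K d" and u: "norm u = 1" and d: "0 < d" "d < measure lborel K"
  shows "d \<le> measure lborel {z \<in> K. z \<bullet> u \<ge> x \<bullet> u}"
proof -
  note K' = convex_body_basics[OF K]
  have [measurable]: "K \<in> sets borel" using K'(5) by (rule borel_closed)
  have "u \<noteq> 0" using u by auto
  have le: "x \<bullet> u \<le> cut_level K d u" using x u by (auto simp: floating_body_def)
  have "d = measure lborel {z \<in> K. z \<bullet> u \<ge> cut_level K d u}" using measure_cut_level[OF \<open>u \<noteq> 0\<close> d] by simp
  also have "\<dots> \<le> measure lborel {z \<in> K. z \<bullet> u \<ge> x \<bullet> u}"
  proof (rule measure_mono_fmeasurable)
    have "bounded {z \<in> K. z \<bullet> u \<ge> x \<bullet> u}" using K'(6) by (rule bounded_subset) auto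
    from emeasure_bounded_finite[OF this] show "{z \<in> K. z \<bullet> u \<ge> x \<bullet> u} \<in> fmeasurable lborel" by (simp add: fmeasurable_def)
  qed (use le in auto)
  finally show ?thesis .
qed

lemma floating_body_subset_santalo_region:
  assumes \<delta>: "0 < \<delta>" "\<delta> < 1 / 2"
  shows "floating_body K (\<delta> * measure lborel K) \<subseteq> santalo_region K (1 / (4 * \<delta> * (1 - \<delta>)))"
proof
  fix x assume x: "x \<in> floating_body K (\<delta> * measure lborel K)"
  let ?T = "1 / (4 * \<delta> * (1 - \<delta>))"
  let ?S = "santalo_region K ?T"
  let ?k = "measure lborel K"
  have k: "?k > 0" by (rule measure_convex_body_pos[OF K])
  have d: "0 < \<delta> * ?k" "\<delta> * ?k < ?k" using k \<delta> by auto
  show "x \<in> ?S"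
  proof (rule ccontr)
    assume "x \<notin> ?S"
    \<comment> \<open>A direction for which the hyperplane through \<open>x\<close> misses the
      region. An empty region is covered as well: any direction then serves, and the point
      \<open>z\<close> found below contradicts the emptiness.\<close>
    obtain u where u: "norm u = 1" "\<And>z. z \<in> ?S \<Longrightarrow> z \<bullet> u \<noteq> x \<bullet> u"
    proof (cases "?S = {}")
      case True
      obtain e :: 'a where "norm e = 1" using vector_choose_size[of 1] by auto
      thus ?thesis using that True by auto
    next
      case False
      obtain a b where ab: "a \<bullet> x < b" "\<forall>z\<in>?S. b < a \<bullet> z"
        using separating_hyperplane_closed_point[OF convex_santalo_region closed_santalo_region[OF K] \<open>x \<notin> ?S\<close>] by blast
      have "a \<noteq> 0" using ab False by auto
      show ?thesis
      proof (rule that[of "a /\<^sub>R norm a"])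
        show "norm (a /\<^sub>R norm a) = 1" using \<open>a \<noteq> 0\<close> by simp
        fix z assume "z \<in> ?S"
        hence "a \<bullet> x \<noteq> a \<bullet> z" using ab by fastforce
        thus "z \<bullet> (a /\<^sub>R norm a) \<noteq> x \<bullet> (a /\<^sub>R norm a)" using \<open>a \<noteq> 0\<close> by (simp add: inner_commute)
      qed
    qed
    have "u \<noteq> 0" using u by auto
    define c where "c = x \<bullet> u"
    define mp mm where "mp = measure lborel {z \<in> K. z \<bullet> u \<ge> c}" and "mm = measure lborel {z \<in> K. z \<bullet> u \<le> c}"
    have mp: "mp \<ge> \<delta> * ?k" unfolding mp_def c_def by (rule floating_body_halfspace[OF x u(1) d])
    have mm: "mm \<ge> \<delta> * ?k" using floating_body_halfspace[OF x _ d, of "- u"] u(1) by (simp add: mm_def c_def)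
    have sum: "mp + mm = ?k" unfolding mp_def mm_def by (rule measure_halfspaces(1)[OF \<open>u \<noteq> 0\<close>])
    have pos: "mp > 0" "mm > 0" using mp mm d by linarith+
    obtain z where z: "z \<in> interior K" "z \<bullet> u = c" 
      "ennreal (4 * mp * mm) * vol (polar_at K z) \<le> (vol (cball (0::'a) 1))\<^sup>2 * vol K"
      using santalo_hyperplane[OF K \<open>u \<noteq> 0\<close>, of c] pos unfolding mp_def mm_def by blast
    let ?V = "measure lborel (cball (0::'a) 1)"
    have V: "vol (cball (0::'a) 1) = ennreal ?V" "?V > 0"
      using emeasure_bounded_finite[OF bounded_cball[of "0::'a" 1]] content_cball_pos[of 1 "0::'a"] by (auto simp: emeasure_eq_ennreal_measure less_top)
    have kk: "vol K = ennreal ?k"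
      using emeasure_bounded_finite[OF convex_body_basics(6)[OF K]] by (auto simp: emeasure_eq_ennreal_measure less_top)
    obtain p where p: "vol (polar_at K z) = ennreal p" "p \<ge> 0"
      using emeasure_polar_at_finite[OF K z(1)] by (cases "vol (polar_at K z)") auto
    have "ennreal (4 * mp * mm * p) \<le> ennreal (?V\<^sup>2 * ?k)"
      using z(3) pos p k V(2) unfolding V kk p by (simp add: ennreal_mult ennreal_power)
    hence le: "4 * mp * mm * p \<le> ?V\<^sup>2 * ?k" using k by (simp add: ennreal_le_iff)
    \<comment> \<open>With a fixed sum and both volumes at least \<open>\<delta> * ?k\<close>, the
      product is smallest when one of them equals that bound.\<close>
    have prod: "\<delta> * (1 - \<delta>) * ?k\<^sup>2 \<le> mp * mm"
    proof -
      have "0 \<le> (mp - \<delta> * ?k) * (mm - \<delta> * ?k)" using mp mm by simp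
      also have "\<dots> = mp * mm - \<delta> * ?k * (mp + mm) + \<delta>\<^sup>2 * ?k\<^sup>2" by (simp add: algebra_simps power2_eq_square)
      also have "\<dots> = mp * mm - \<delta> * (1 - \<delta>) * ?k\<^sup>2" unfolding sum by (simp add: algebra_simps power2_eq_square)
      finally show ?thesis by simp
    qed
    have "4 * (\<delta> * (1 - \<delta>) * ?k\<^sup>2) * p \<le> 4 * (mp * mm) * p" using prod p by (intro mult_right_mono) auto
    also have "\<dots> \<le> ?V\<^sup>2 * ?k" using le by (simp add: ac_simps)
    finally have "(4 * \<delta> * (1 - \<delta>) * (?k * p)) * ?k \<le> ?V\<^sup>2 * ?k" by (simp only: power2_eq_square ac_simps)
    hence "4 * \<delta> * (1 - \<delta>) * (?k * p) \<le> ?V\<^sup>2" using k by (rule mult_right_le_imp_le)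
    hence "?k * p / ?V\<^sup>2 \<le> ?T" using \<delta> V(2) by (simp add: field_simps)
    hence "ennreal (?k * p / ?V\<^sup>2) \<le> ennreal ?T" by (rule ennreal_leI)
    moreover have "vol K * vol (polar_at K z) / (vol (cball (0::'a) 1))\<^sup>2 = ennreal (?k * p / ?V\<^sup>2)"
      unfolding V kk p using V k p by (simp add: ennreal_mult[symmetric] ennreal_power divide_ennreal)
    ultimately have "z \<in> ?S" using z(1) interior_subset by (auto simp: santalo_region_def)
    thus False using u(2) z(2) by (auto simp: c_def)
  qed
qed

end

lemma santalo_region_mono: "s \<le> t \<Longrightarrow> santalo_region K s \<subseteq> santalo_region K t"
  unfolding santalo_region_def using ennreal_leI order_trans by blast

theorem proposition1:
  fixes K :: "(real ^ 'n) set"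
  assumes "convex_body K"
  shows
    "(\<forall>t. santalo_region K t \<noteq> {} \<longrightarrow> strictly_convex (santalo_region K t)) \<and>
     (\<forall>(M :: real ^ 'n ^ 'n) b t. invertible M \<longrightarrow> santalo_region K t \<noteq> {} \<longrightarrow>
        santalo_region ((\<lambda>x. M *v x + b) ` K) t = (\<lambda>x. M *v x + b) ` santalo_region K t) \<and>
     (\<forall>t. santalo_region K t \<noteq> {} \<longrightarrow> Cinf_boundary (santalo_region K t)) \<and>
     (\<forall>s t. santalo_region K s \<noteq> {} \<longrightarrow> santalo_region K t \<noteq> {} \<longrightarrow> s \<le> t \<longrightarrow>
        santalo_region K s \<subseteq> santalo_region K t) \<and>
     (\<forall>t s \<alpha>. santalo_region K t \<noteq> {} \<longrightarrow> santalo_region K s \<noteq> {} \<longrightarrow> 0 \<le> \<alpha> \<longrightarrow> \<alpha> \<le> 1 \<longrightarrow>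
        {\<alpha> *\<^sub>R x + (1 - \<alpha>) *\<^sub>R y | x y. x \<in> santalo_region K t \<and> y \<in> santalo_region K s}
          \<subseteq> santalo_region K (\<alpha> * t + (1 - \<alpha>) * s)) \<and>
     (\<forall>\<delta>. 0 < \<delta> \<longrightarrow> \<delta> < 1 / 2 \<longrightarrow>
        floating_body K (\<delta> * measure lborel K) \<subseteq> santalo_region K (1 / (4 * \<delta> * (1 - \<delta>))))"
proof (intro conjI allI impI)
  fix M :: "real ^ 'n ^ 'n" and b t
  assume "invertible M"
  hence "bij ((*v) M)" by (simp add: invertible_eq_bij)
  from santalo_region_affine_image[OF matrix_vector_mul_linear this assms]
  show "santalo_region ((\<lambda>x. M *v x + b) ` K) t = (\<lambda>x. M *v x + b) ` santalo_region K t" .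
next
  fix t s \<alpha> :: real
  assume "0 \<le> \<alpha>" "\<alpha> \<le> 1"
  thus "{\<alpha> *\<^sub>R x + (1 - \<alpha>) *\<^sub>R y | x y. x \<in> santalo_region K t \<and> y \<in> santalo_region K s}
          \<subseteq> santalo_region K (\<alpha> * t + (1 - \<alpha>) * s)"
    using santalo_region_concave[OF assms] by auto
qed (auto intro: strictly_convex_santalo_region Cinf_boundary_santalo_region assms
    dest: subsetD[OF santalo_region_mono] subsetD[OF floating_body_subset_santalo_region[OF assms]])

end
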